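(* Let $\Phi:\mathcal{F}=\mathbb{QP}({\bf x}^{\mathrm{g}}_{t_0})\to\mathcal{S}/\mathrm{Ker}\,\hat\psi$ be the field isomorphism determined by $\Phi(x^{\mathrm{g}}_{i;t_0})=[X_{i;t_0}]$ ($i=1,\dots,n$) and $\Phi(p)=[p]$ ($p\in\mathbb{P}$). Then for every $i=1,\dots,n$ and $t\in\mathbb{T}_n$, $$\Phi(y_{i;t}^{\mathrm{g}}) = \left[\prod_{l=1}^{r_i}y_{il;t}^{\mathrm{c}}\right]^{\frac{1}{r_i}},\qquad \Phi(x_{i;t}^{\mathrm{g}}) = [X_{i;t}].$$
   Context: Notation: $[a]_+=\max(a,0)$. A semifield $(\mathbb{P},\oplus,\cdot)$ is a multiplicative abelian group with a commutative associative addition $\oplus$ over which multiplication distributes; $\mathbb{P}_0=\mathbb{P}\sqcup\{0\}$ with $0\oplus p=p$, $0\cdot p=0$. $\mathbb{ZP}$ is the group ring of $(\mathbb{P},\cdot)$ (an integral domain), $\mathbb{QP}$ its fraction field, $\mathbb{NP}\subset\mathbb{ZP}$ the elements with nonnegative coefficients, and $\pi_{\mathbb{P}_0}:\mathbb{NP}\to\mathbb{P}_0$, $\sum_j a_jp_j\mapsto\bigoplus_j (p_j\oplus\cdots\oplus p_j)$ ($a_j$ terms). Generalized cluster pattern. Fix $n\ge1$, ${\bf r}=(r_1,\dots,r_n)\in\mathbb{Z}_{\ge1}^n$, a semifield $\mathbb{P}$, and a field $\mathcal{F}$ of rational functions in $n$ variables over $\mathbb{QP}$. A generalized seed is $({\bf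 x},{\bf y},{\bf Z},B)$ with ${\bf x}=(x_1,\dots,x_n)$ a free generating set of $\mathcal{F}$, ${\bf y}\in\mathbb{P}^n$, ${\bf Z}=(Z_1(u),\dots,Z_n(u))$ with $Z_i(u)=\sum_{l=0}^{r_i}\hat z_{il}u^l$, $\hat z_{il}\in\mathbb{NP}$, $\hat z_{i0}=\hat z_{ir_i}=1$, and $B=(b_{ij})$ a skew-symmetrizable integer $n\times n$ matrix. Put $\hat y_k=y_k\prod_j x_j^{b_{jk}}$, $Z_k|_{\mathbb{P}_0}(y)=\bigoplus_l\pi_{\mathbb{P}_0}(\hat z_{kl})y^l$. The mutation $\mu_k^{\bf r}$ in direction $k$ gives: $x_k'=x_k^{-1}\bigl(\prod_j x_j^{[-b_{jk}]_+}\bigr)^{r_k}Z_k(\hat y_k)/Z_k|_{\mathbb{P}_0}(y_k)$, $x_i'=x_i$ ($i\ne k$); $y_k'=y_k^{-1}$, $y_i'=y_i(y_k^{[b_{ki}]_+})^{r_k}Z_k|_{\mathbb{P}_0}(y_k)^{-b_{ki}}$ ($i\neq k$); $Z_k'(u)=u^{r_k}Z_k(u^{-1})$, $Z_i'=Z_i$ ($i\ne k$); $b'_{ij}=-b_{ij}$ if $i=k$ or $j=k$, else $b'_{ij}=b_{ij}+r_k(b_{ik}[b_{kj}]_++[-b_{ik}]_+b_{kj})$. $\mathbb{T}_n$ is the $n$-regular tree with edges labeled $1,\dots,n$ (the $n$ edges at each vertex having distinct labels); vertices joined by an edge labeled $k$ are $k$-adjacent; $t_0$ is a fixed vertex. A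 generalized cluster pattern is a family of generalized seeds $\{\Sigma_t\}_{t\in\mathbb{T}_n}$ with $\Sigma_{t'}=\mu_k^{\bf r}(\Sigma_t)$ for all $k$-adjacent $t,t'$. The case ${\bf r}=(1,\dots,1)$, $Z_i(u)=1+u$ is the ordinary case (ordinary seeds $({\bf x},{\bf y},B)$, ordinary mutation $\mu_k$). Let ${\bf \Sigma}^{\mathrm{g}}=\{({\bf x}^{\mathrm{g}}_t,{\bf y}^{\mathrm{g}}_t,{\bf Z}_t,B_t)\}_{t\in\mathbb{T}_n}$ be any generalized cluster pattern, ${\bf Z}=(Z_i(u)=\sum_l\hat z_{il}u^l)$ the exchange polynomials at $t_0$, $z_{il}=\pi_{\mathbb{P}_0}(\hat z_{il})$. Extended semifield. Let $\mathcal{D}=\{(i,l)\mid 1\le i\le n,\ 1\le l\le r_i\}$, $\mathcal{N}=|\mathcal{D}|=r_1+\dots+r_n$, ${\bf s}=\{s_{il}\}_{(i,l)\in\mathcal{D}}$ formal variables, and $\overline{\mathbb{P}}=\{f/g\in\mathbb{QP}({\bf s})\mid f,g\in\mathbb{NP}[{\bf s}]\setminus\{0\}\}$, a semifield under addition (denoted $\bar\oplus$) and multiplication of fractions. Let $e_{il}\in\overline{\mathbb{P}}$ be the degree-$l$ elementary symmetric polynomial in $s_{i1},\dots,s_{ir_i}$ with respect to $\bar\oplus$, ${\bf e}=\{e_{il}\}_{(i,l)\in\mathcal{D}}$, and $\psi:\mathbb{NP}[{\bf e}]\to\mathbb{P}_0$ the additive and multiplicative homomorphism extending $\pi_{\mathbb{P}_0}$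 with $\psi(e_{il})=z_{il}$. Let $\mathbb{S}=\{f/g\in\overline{\mathbb{P}}\mid f,g\in\mathbb{NP}[{\bf e}],\ \psi(f),\psi(g)\ne0\}$, a subsemifield of $\overline{\mathbb{P}}$ containing $\mathbb{P}$ (via $p=p/1$); $\psi$ extends to a semifield homomorphism $\psi:\mathbb{S}\to\mathbb{P}$, $\psi(f/g)=\psi(f)/\psi(g)$. Write $f\sim g$ iff $\psi(f)=\psi(g)$ for $f,g\in\mathbb{S}$. Associated composite pattern. Let $\overline{\mathcal{F}}$ be a field of rational functions in $\mathcal{N}$ variables over $\mathbb{Q}\overline{\mathbb{P}}$ (the fraction field of the group ring $\mathbb{Z}\overline{\mathbb{P}}$). Let $\mathcal{B}_{t_0}$ be the $\mathcal{D}\times\mathcal{D}$ matrix whose $((i,l),(j,m))$ entry is $b_{ij;t_0}$. Take the ordinary seed of rank $\mathcal{N}$ (indexed by $\mathcal{D}$), with coefficients in $\overline{\mathbb{P}}$ and ambient field $\overline{\mathcal{F}}$, given by $\Sigma^{\mathrm{c}}_{t_0}=({\bf x}^{\mathrm{c}}_{t_0},{\bf y}^{\mathrm{c}}_{t_0},\mathcal{B}_{t_0})$ with ${\bf x}^{\mathrm{c}}_{t_0}$ a free generating set of $\overline{\mathcal{F}}$ and $y^{\mathrm{c}}_{il;t_0}=s_{il}y^{\mathrm{g}}_{i;t_0}$. With $\mu_{il}$ the ordinary mutation in direction $(i,l)\in\mathcal{D}$, set $\mu^{\mathrm{c}}_k=\mu_{kr_k}\circ\cdots\circ\mu_{k1}$.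 The composite cluster pattern is the family $\{\Sigma^{\mathrm{c}}_t=({\bf x}^{\mathrm{c}}_t,{\bf y}^{\mathrm{c}}_t,\mathcal{B}_t)\}_{t\in\mathbb{T}_n}$ with $\Sigma^{\mathrm{c}}_{t'}=\mu^{\mathrm{c}}_k(\Sigma^{\mathrm{c}}_t)$ for $k$-adjacent $t,t'$. Put $X_{i;t}=\prod_{l=1}^{r_i}x^{\mathrm{c}}_{il;t}$ and ${\bf X}=(X_{1;t_0},\dots,X_{n;t_0})$. The algebra $\mathcal{S}$. Let $\hat e_{il}\in\mathbb{Z}\overline{\mathbb{P}}\subset\overline{\mathcal{F}}$ be the degree-$l$ elementary symmetric polynomial in $s_{i1},\dots,s_{ir_i}$ with respect to the addition $+$ of $\mathbb{Z}\overline{\mathbb{P}}$ (elements of $\overline{\mathbb{P}}$ being viewed as basis elements of the group ring), $\hat{\bf e}=\{\hat e_{il}\}$. Let $\hat\psi:\mathbb{ZS}[\hat{\bf e},{\bf X}]\to\mathbb{ZP}[{\bf X}]$ be the $\mathbb{ZP}$-algebra homomorphism extending $\psi:\mathbb{S}\to\mathbb{P}$ with $X_{i;t_0}\mapsto X_{i;t_0}$, $\hat e_{il}\mapsto\hat z_{il}$. Let $\mathcal{S}=\{f/g\in\overline{\mathcal{F}}\mid f,g\in\mathbb{ZS}[\hat{\bf e},{\bf X}],\ \hat\psi(g)\neq0\}$, and extend $\hat\psi$ to $\hat\psi:\mathcal{S}\to\mathbb{QP}({\bf X})=\mathrm{Frac}(\mathbb{ZP}[{\bf X}])$ by $\hat\psi(f/g)=\hat\psi(f)/\hat\psi(g)$.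 Here $[\cdot]$ is the class in $\mathcal{S}/\mathrm{Ker}\,\hat\psi$. All $X_{i;t}$ lie in $\mathcal{S}$ and all products $\prod_{l}y^{\mathrm{c}}_{il;t}$ lie in $\mathbb{S}\subset\mathcal{S}$. The $r_i$-th root is the unique $r_i$-th root taken inside $\mathbb{S}/{\sim}$, identified with the image of $\mathbb{S}$ in $\mathcal{S}/\mathrm{Ker}\,\hat\psi$ (semifields are torsion-free as multiplicative groups, so the root is unique there). *)

theory Defs
  imports
    "HOL-Library.Poly_Mapping"
    "HOL-Algebra.QuotRing"
    "HOL-Algebra.Generated_Rings"
    "HOL-Algebra.Algebraic_Closure_Type"
begin

section \<open>Semifields\<close>

text \<open>The operation \<open>+\<close> of this class is the semifield addition \<open>\<oplus>\<close>; it has no neutral element.\<close>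

class semifield = comm_semiring + comm_monoid_mult + inverse +
  assumes semifield_left_inverse: "inverse a * a = 1"
    and semifield_divide_inverse: "a / b = a * inverse b"
begin

lemma semifield_right_inverse: "a * inverse a = 1"
  by (metis semifield_left_inverse mult.commute)

lemma semifield_cancel: "a * c = b * c \<Longrightarrow> a = b"
  by (metis mult.assoc mult_1_right semifield_right_inverse)

lemma semifield_inverse_unique: "a * b = 1 \<Longrightarrow> b = inverse a"
  by (metis semifield_left_inverse mult.commute semifield_cancel)

lemma semifield_inverse_mult: "inverse (a * b) = inverse a * inverse b"
  by (rule semifield_inverse_unique [symmetric])
    (metis mult.assoc mult.left_commute mult_1_right semifield_right_inverse)

lemma semifield_inverse_inverse: "inverse (inverse a) = a"
  by (rule semifield_inverse_unique [symmetric]) (rule semifield_left_inverse semifield_right_inverse)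

lemma semifield_inverse_one: "inverse 1 = 1"
  by (metis mult_1_right semifield_left_inverse semifield_right_inverse)

end

lemma semifield_torsion_free:
  fixes x :: "'p :: semifield"
  assumes "x ^ Suc n = 1"
  shows "x = 1"
proof -
  define g where "g = rec_nat (1 :: 'p) (\<lambda>i s. s + x ^ Suc i)"
  have g0: "g 0 = 1" and gS: "\<And>i. g (Suc i) = g i + x ^ Suc i"
    by (simp_all add: g_def)
  have shift: "g (Suc i) = 1 + x * g i" for i
  proof (induction i)
    case 0
    show ?case by (simp add: g0 gS)
  next
    case (Suc i)
    have "g (Suc (Suc i)) = 1 + x * g i + x ^ Suc (Suc i)"
      using gS[of "Suc i"] Suc.IH by simp
    also have "\<dots> = 1 + x * (g i + x ^ Suc i)"
      by (simp add: distrib_left add.assoc)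
    finally show ?case by (simp only: gS)
  qed
  show ?thesis
  proof (cases n)
    case 0
    with assms show ?thesis by simp
  next
    case (Suc m)
    have "x * g (Suc m) = x * g m + x ^ Suc (Suc m)"
      by (simp add: gS distrib_left)
    also have "\<dots> = 1 * g (Suc m)"
      using assms Suc by (simp add: shift add.commute)
    finally show ?thesis by (rule semifield_cancel)
  qed
qed


section \<open>The semifield with zero adjoined\<close>

datatype 'p with_zero = Zero | Nz (unNz: 'p)

instantiation with_zero :: (semifield) comm_semiring_1
begin

definition "0 = Zero"

definition "1 = Nz 1"

fun plus_with_zero :: "'a with_zero \<Rightarrow> 'a with_zero \<Rightarrow> 'a with_zero" where
  "Zero + b = b"
| "Nz p + Zero = Nz p"
| "Nz p + Nz q = Nz (p + q)"

fun times_with_zero :: "'a with_zero \<Rightarrow> 'a with_zero \<Rightarrow> 'a with_zero" where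
  "Zero * b = Zero"
| "Nz p * Zero = Zero"
| "Nz p * Nz q = Nz (p * q)"

instance
proof
  fix a b c :: "'a with_zero"
  show "a * b * c = a * (b * c)"
    by (cases a; cases b; cases c) (auto simp: mult.assoc)
  show "a * b = b * a"
    by (cases a; cases b) (auto simp: mult.commute)
  show "1 * a = a"
    by (cases a) (auto simp: one_with_zero_def)
  show "a + b + c = a + (b + c)"
    by (cases a; cases b; cases c) (auto simp: add.assoc)
  show "a + b = b + a"
    by (cases a; cases b) (auto simp: add.commute)
  show "0 + a = a"
    by (cases a) (auto simp: zero_with_zero_def)
  show "(a + b) * c = a * c + b * c"
    by (cases a; cases b; cases c) (auto simp: distrib_right)
  show "0 * a = 0" "a * 0 = 0"
    by (cases a; auto simp: zero_with_zero_def)+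
  show "(0 :: 'a with_zero) \<noteq> 1"
    by (simp add: zero_with_zero_def one_with_zero_def)
qed

end


section \<open>The group ring of a semifield and its fraction field\<close>

text \<open>
  \<open>poly_mapping\<close> forms monoid rings over additively written monoids, so the multiplicative group
  of the semifield is first rewritten additively.
\<close>

datatype 'p expo = Expo (expo_base: 'p)

instantiation expo :: (semifield) ab_group_add
begin

definition "0 = Expo 1"
definition "a + b = Expo (expo_base a * expo_base b)"
definition "- a = Expo (inverse (expo_base a))"
definition "a - b = Expo (expo_base a * inverse (expo_base b))"

instance
  by standard
    (auto simp: zero_expo_def plus_expo_def uminus_expo_def minus_expo_def mult_ac
      semifield_left_inverse semifield_right_inverse)

end

text \<open>
  A semifield is a torsion-free multiplicative group, hence can be linearly ordered. Such an order
  is chosen arbitrarily; it only serves to show that the group ring is an integral domain.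
\<close>

definition is_cone :: "'p :: semifield set \<Rightarrow> bool" where
  "is_cone C \<longleftrightarrow> 1 \<in> C \<and> (\<forall>x\<in>C. \<forall>y\<in>C. x * y \<in> C) \<and> (\<forall>x\<in>C. inverse x \<in> C \<longrightarrow> x = 1)"

lemma is_cone_power: "is_cone C \<Longrightarrow> x \<in> C \<Longrightarrow> x ^ n \<in> C"
  by (induction n) (auto simp: is_cone_def)

lemma semifield_inverse_power:
  fixes x :: "'p :: semifield"
  shows "inverse (x ^ n) = inverse x ^ n"
  by (induction n) (auto simp: semifield_inverse_one semifield_inverse_mult)

lemma maximal_cone_total_aux:
  fixes C :: "'p :: semifield set"
  assumes C: "is_cone C" and max: "\<And>E. is_cone E \<Longrightarrow> C \<subseteq> E \<Longrightarrow> E = C" and x: "x \<notin> C"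
  shows "\<exists>k. inverse x ^ Suc k \<in> C"
proof -
  define E where "E = {p * x ^ n | p n. p \<in> C}"
  have sub: "C \<subseteq> E"
  proof
    fix p assume "p \<in> C"
    then have "p = p * x ^ 0 \<and> p \<in> C" by simp
    then show "p \<in> E" unfolding E_def by blast
  qed
  have "x = 1 * x ^ 1 \<and> 1 \<in> C" using C by (simp add: is_cone_def)
  then have "x \<in> E" unfolding E_def by blast
  with x have "\<not> is_cone E" using max sub by blast
  moreover have "1 \<in> E" using sub C by (auto simp: is_cone_def)
  moreover have "a * b \<in> E" if "a \<in> E" "b \<in> E" for a b
  proof -
    from that obtain p n q m where pq: "a = p * x ^ n" "p \<in> C" "b = q * x ^ m" "q \<in> C"
      unfolding E_def by blast
    then have "a * b = (p * q) * x ^ (n + m)" by (simp add: power_add mult_ac)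
    moreover have "p * q \<in> C" using pq C by (auto simp: is_cone_def)
    ultimately show ?thesis unfolding E_def by blast
  qed
  ultimately obtain a where a: "a \<in> E" "inverse a \<in> E" "a \<noteq> 1"
    unfolding is_cone_def by blast
  then obtain p n q m where pq: "a = p * x ^ n" "p \<in> C" "inverse a = q * x ^ m" "q \<in> C"
    unfolding E_def by blast
  have "(p * q) * x ^ (n + m) = (p * x ^ n) * (q * x ^ m)" by (simp add: power_add mult_ac)
  also have "\<dots> = a * inverse a" by (simp only: pq(1,3) [symmetric])
  finally have eq: "(p * q) * x ^ (n + m) = 1" by (simp only: semifield_right_inverse)
  show ?thesis
  proof (cases "n + m")
    case 0
    then have "p * q = 1" using eq by simp
    then have "q = inverse p" by (rule semifield_inverse_unique)
    then have "p = 1" using pq C by (auto simp: is_cone_def)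
    then have "a = 1" using pq 0 by simp
    with a show ?thesis by simp
  next
    case (Suc k)
    have "x ^ Suc k * (p * q) = 1" using eq Suc by (simp add: mult_ac)
    then have "p * q = inverse x ^ Suc k"
      unfolding semifield_inverse_power [symmetric] by (rule semifield_inverse_unique)
    moreover have "p * q \<in> C" using pq C by (auto simp: is_cone_def)
    ultimately show ?thesis by metis
  qed
qed

lemma total_cone_exists: "\<exists>C :: 'p :: semifield set. is_cone C \<and> (\<forall>x. x \<in> C \<or> inverse x \<in> C)"
proof -
  have "\<exists>M\<in>{C :: 'p set. is_cone C}. \<forall>E\<in>{C. is_cone C}. M \<subseteq> E \<longrightarrow> E = M"
  proof (rule subset_Zorn_nonempty)
    have "is_cone {1 :: 'p}" by (simp add: is_cone_def)
    then show "{C :: 'p set. is_cone C} \<noteq> {}" by blast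
    fix \<C> :: "'p set set"
    assume ne: "\<C> \<noteq> {}" and ch: "subset.chain {C. is_cone C} \<C>"
    have cone: "is_cone C" if "C \<in> \<C>" for C
      using ch that unfolding subset.chain_def by blast
    have tot: "C \<subseteq> E \<or> E \<subseteq> C" if "C \<in> \<C>" "E \<in> \<C>" for C E
      using ch that unfolding subset.chain_def by blast
    have "is_cone (\<Union>\<C>)"
      unfolding is_cone_def
    proof (intro conjI ballI impI)
      show "1 \<in> \<Union>\<C>" using ne cone by (auto simp: is_cone_def)
      fix x assume x: "x \<in> \<Union>\<C>"
      {
        fix y assume y: "y \<in> \<Union>\<C>"
        from x y obtain C E where "C \<in> \<C>" "x \<in> C" "E \<in> \<C>" "y \<in> E" by blast
        with tot[of C E] have "\<exists>G\<in>\<C>. x \<in> G \<and> y \<in> G" by blast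
      }
      note common = this
      show "x * y \<in> \<Union>\<C>" if "y \<in> \<Union>\<C>" for y
        using common[OF that] cone by (auto simp: is_cone_def)
      show "x = 1" if "inverse x \<in> \<Union>\<C>"
        using common[OF that] cone by (auto simp: is_cone_def)
    qed
    then show "\<Union>\<C> \<in> {C. is_cone C}" by simp
  qed
  then obtain C :: "'p set" where C: "is_cone C"
    and max: "\<And>E. is_cone E \<Longrightarrow> C \<subseteq> E \<Longrightarrow> E = C" by blast
  have "x \<in> C \<or> inverse x \<in> C" for x
  proof (rule ccontr)
    assume "\<not> ?thesis"
    then obtain k l where "inverse x ^ Suc k \<in> C" "x ^ Suc l \<in> C"
      using maximal_cone_total_aux[OF C max] by (metis semifield_inverse_inverse)
    then have "(inverse x ^ Suc k) ^ Suc l \<in> C" "(x ^ Suc l) ^ Suc k \<in> C"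
      using is_cone_power[OF C] by blast+
    then have "(x ^ Suc l) ^ Suc k \<in> C" "inverse ((x ^ Suc l) ^ Suc k) \<in> C"
      by (simp_all only: semifield_inverse_power power_mult [symmetric] mult.commute)
    then have "(x ^ Suc l) ^ Suc k = 1" using C unfolding is_cone_def by blast
    then have "x = 1" using semifield_torsion_free by blast
    with C \<open>\<not> ?thesis\<close> show False by (simp add: is_cone_def)
  qed
  with C show ?thesis by blast
qed

definition total_cone :: "'p :: semifield set" where
  "total_cone = (SOME C. is_cone C \<and> (\<forall>x. x \<in> C \<or> inverse x \<in> C))"

lemma total_cone:
  "is_cone (total_cone :: 'p :: semifield set)" "x \<in> total_cone \<or> inverse x \<in> (total_cone :: 'p set)"
proof -
  have *: "is_cone (total_cone :: 'p set) \<and> (\<forall>x. x \<in> total_cone \<or> inverse x \<in> (total_cone :: 'p set))"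
    unfolding total_cone_def by (rule someI_ex) (rule total_cone_exists)
  then show "is_cone (total_cone :: 'p set)" "x \<in> total_cone \<or> inverse x \<in> (total_cone :: 'p set)"
    by blast+
qed

instantiation expo :: (semifield) linordered_ab_group_add
begin

definition "(a :: 'a expo) \<le> b \<longleftrightarrow> expo_base (b - a) \<in> total_cone"
definition "(a :: 'a expo) < b \<longleftrightarrow> a \<le> b \<and> \<not> b \<le> a"

instance
proof
  fix a b c :: "'a expo"
  have mult: "x * y \<in> total_cone" if "x \<in> total_cone" "y \<in> total_cone" for x y :: 'a
    using that total_cone(1) by (auto simp: is_cone_def)
  have inv: "inverse (expo_base (b - a)) = expo_base (a - b)"
    by (simp add: minus_expo_def semifield_inverse_mult semifield_inverse_inverse mult.commute)
  show "(a < b) = (a \<le> b \<and> \<not> b \<le> a)" by (rule less_expo_def)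
  show "a \<le> a"
    using total_cone(1)[where 'p = 'a] by (simp add: less_eq_expo_def zero_expo_def is_cone_def)
  show "a \<le> c" if "a \<le> b" "b \<le> c"
  proof -
    have "expo_base (c - a) = expo_base ((c - b) + (b - a))" by simp
    also have "\<dots> = expo_base (c - b) * expo_base (b - a)" by (simp only: plus_expo_def expo.sel)
    finally show ?thesis using that mult by (simp only: less_eq_expo_def)
  qed
  show "a = b" if "a \<le> b" "b \<le> a"
  proof -
    have "expo_base (b - a) = 1"
      using that inv total_cone(1) unfolding less_eq_expo_def is_cone_def by metis
    then have "b - a = 0" by (metis expo.collapse zero_expo_def)
    then show ?thesis by simp
  qed
  show "a \<le> b \<or> b \<le> a"
    using total_cone(2)[of "expo_base (b - a)"] inv by (simp only: less_eq_expo_def)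
  show "c + a \<le> c + b" if "a \<le> b"
    using that by (simp add: less_eq_expo_def)
qed

end

type_synonym 'p group_ring = "'p expo \<Rightarrow>\<^sub>0 int"

type_synonym 'p qfield = "'p group_ring fract"

definition gr :: "'p :: semifield \<Rightarrow> 'p group_ring" where
  "gr p = Poly_Mapping.single (Expo p) 1"

definition NP :: "'p :: semifield group_ring set" where
  "NP = {f. \<forall>a. 0 \<le> Poly_Mapping.lookup f a}"

definition pi0 :: "'p :: semifield group_ring \<Rightarrow> 'p with_zero" where
  "pi0 f = (\<Sum>a\<in>Poly_Mapping.keys f. of_nat (nat (Poly_Mapping.lookup f a)) * Nz (expo_base a))"

abbreviation embP :: "('p :: semifield qfield \<Rightarrow> 'f :: field) \<Rightarrow> 'p \<Rightarrow> 'f" where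
  "embP \<kappa> p \<equiv> \<kappa> (to_fract (gr p))"


section \<open>Generalized and ordinary seeds\<close>

text \<open>
  An ambient field over the field of fractions of the group ring is a field \<open>'f\<close> together with a
  ring homomorphism \<open>\<kappa>\<close>. Indices \<open>1, \<dots>, n\<close> are the elements of a finite type \<open>'n\<close>.
\<close>

definition poly_eval ::
  "('p :: semifield qfield \<Rightarrow> 'f :: field) \<Rightarrow> ('n :: finite \<Rightarrow> 'f) \<Rightarrow> (('n \<Rightarrow>\<^sub>0 nat) \<Rightarrow>\<^sub>0 'p qfield) \<Rightarrow> 'f"
  where
  "poly_eval \<kappa> x f =
    (\<Sum>\<alpha>\<in>Poly_Mapping.keys f.
      \<kappa> (Poly_Mapping.lookup f \<alpha>) * (\<Prod>j\<in>UNIV. x j ^ Poly_Mapping.lookup \<alpha> j))"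

definition free_generating ::
  "('p :: semifield qfield \<Rightarrow> 'f :: field) \<Rightarrow> ('n :: finite \<Rightarrow> 'f) \<Rightarrow> bool" where
  "free_generating \<kappa> x \<longleftrightarrow>
    (\<forall>f. poly_eval \<kappa> x f = 0 \<longrightarrow> f = 0) \<and>
    (\<forall>a. \<exists>f g. poly_eval \<kappa> x g \<noteq> 0 \<and> a = poly_eval \<kappa> x f / poly_eval \<kappa> x g)"

definition skew_symmetrizable :: "('n \<Rightarrow> 'n \<Rightarrow> int) \<Rightarrow> bool" where
  "skew_symmetrizable B \<longleftrightarrow>
    (\<exists>d :: 'n \<Rightarrow> int. (\<forall>i. 0 < d i) \<and> (\<forall>i j. d i * B i j = - (d j * B j i)))"

record ('f, 'p, 'n) ord_seed =
  sx :: "'n \<Rightarrow> 'f"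
  sy :: "'n \<Rightarrow> 'p"
  sB :: "'n \<Rightarrow> 'n \<Rightarrow> int"

record ('f, 'p, 'n) gen_seed = "('f, 'p, 'n) ord_seed" +
  sZ :: "'n \<Rightarrow> 'p group_ring poly"

definition is_gen_seed ::
  "('p :: semifield qfield \<Rightarrow> 'f :: field) \<Rightarrow> ('n :: finite \<Rightarrow> nat) \<Rightarrow> ('f, 'p, 'n) gen_seed \<Rightarrow> bool"
  where
  "is_gen_seed \<kappa> r \<sigma> \<longleftrightarrow>
    free_generating \<kappa> (sx \<sigma>) \<and>
    (\<forall>i. Polynomial.degree (sZ \<sigma> i) = r i \<and>
      (\<forall>l. Polynomial.coeff (sZ \<sigma> i) l \<in> NP) \<and>
      Polynomial.coeff (sZ \<sigma> i) 0 = 1 \<and> Polynomial.coeff (sZ \<sigma> i) (r i) = 1) \<and>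
    skew_symmetrizable (sB \<sigma>)"

abbreviation pos :: "int \<Rightarrow> int" where
  "pos a \<equiv> max a 0"

definition yhat ::
  "('p :: semifield qfield \<Rightarrow> 'f :: field) \<Rightarrow> ('f, 'p, 'n :: finite) gen_seed \<Rightarrow> 'n \<Rightarrow> 'f" where
  "yhat \<kappa> \<sigma> k = embP \<kappa> (sy \<sigma> k) * (\<Prod>j\<in>UNIV. sx \<sigma> j powi sB \<sigma> j k)"

text \<open>The value lies in the semifield itself because the constant coefficient is \<open>1\<close>.\<close>

definition Ztrop :: "'p :: semifield group_ring poly \<Rightarrow> 'p \<Rightarrow> 'p" where
  "Ztrop Z y = unNz (\<Sum>l\<le>Polynomial.degree Z. pi0 (Polynomial.coeff Z l) * Nz y ^ l)"

text \<open>
  \<open>reflect_poly Z\<close> is \<open>u ^ r * Z (1 / u)\<close> for a polynomial \<open>Z\<close> of degree \<open>r\<close>.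
\<close>

definition gen_mutation ::
  "('p :: semifield qfield \<Rightarrow> 'f :: field) \<Rightarrow> ('n :: finite \<Rightarrow> nat) \<Rightarrow> 'n \<Rightarrow>
    ('f, 'p, 'n) gen_seed \<Rightarrow> ('f, 'p, 'n) gen_seed" where
  "gen_mutation \<kappa> r k \<sigma> =
    (let x = sx \<sigma>; y = sy \<sigma>; Z = sZ \<sigma>; b = sB \<sigma>; z = Ztrop (Z k) (y k) in
    \<lparr> sx = (\<lambda>i. if i = k
        then inverse (x k) * (\<Prod>j\<in>UNIV. x j powi pos (- b j k)) ^ r k
          * poly (map_poly (\<lambda>c. \<kappa> (to_fract c)) (Z k)) (yhat \<kappa> \<sigma> k) / embP \<kappa> z
        else x i),
      sy = (\<lambda>i. if i = k then inverse (y k)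
        else y i * (y k powi pos (b k i)) ^ r k * z powi (- b k i)),
      sB = (\<lambda>i j. if i = k \<or> j = k then - b i j
        else b i j + int (r k) * (b i k * pos (b k j) + pos (- b i k) * b k j)),
      sZ = (\<lambda>i. if i = k then reflect_poly (Z k) else Z i) \<rparr>)"

definition ord_mutation ::
  "('p :: semifield qfield \<Rightarrow> 'f :: field) \<Rightarrow> 'n :: finite \<Rightarrow>
    ('f, 'p, 'n) ord_seed \<Rightarrow> ('f, 'p, 'n) ord_seed" where
  "ord_mutation \<kappa> k \<sigma> =
    ord_seed.truncate (gen_mutation \<kappa> (\<lambda>_. 1) k
      \<lparr> sx = sx \<sigma>, sy = sy \<sigma>, sB = sB \<sigma>, sZ = (\<lambda>_. [:1, 1:]) \<rparr>)"


section \<open>The labeled regular tree and patterns\<close>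

definition is_tree :: "('t \<Rightarrow> 't \<Rightarrow> bool) \<Rightarrow> bool" where
  "is_tree E \<longleftrightarrow>
    (\<forall>u v. E u v \<longrightarrow> E v u) \<and> (\<forall>u. \<not> E u u) \<and> (\<forall>u v. E\<^sup>*\<^sup>* u v) \<and>
    \<not> (\<exists>c. 3 \<le> length c \<and> distinct c \<and> successively E c \<and> E (last c) (hd c))"

text \<open>\<open>adj k u v\<close> means that \<open>u\<close> and \<open>v\<close> are joined by an edge labeled \<open>k\<close>.\<close>

definition labeled_regular_tree :: "('n \<Rightarrow> 't \<Rightarrow> 't \<Rightarrow> bool) \<Rightarrow> bool" where
  "labeled_regular_tree adj \<longleftrightarrow>
    is_tree (\<lambda>u v. \<exists>k. adj k u v) \<and>
    (\<forall>k u v. adj k u v \<longrightarrow> adj k v u) \<and>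
    (\<forall>k l u v. adj k u v \<longrightarrow> adj l u v \<longrightarrow> k = l) \<and>
    (\<forall>k u. \<exists>!v. adj k u v)"

definition gen_cluster_pattern ::
  "('p :: semifield qfield \<Rightarrow> 'f :: field) \<Rightarrow> ('n :: finite \<Rightarrow> nat) \<Rightarrow> ('n \<Rightarrow> 't \<Rightarrow> 't \<Rightarrow> bool) \<Rightarrow>
    ('t \<Rightarrow> ('f, 'p, 'n) gen_seed) \<Rightarrow> bool" where
  "gen_cluster_pattern \<kappa> r adj \<Sigma> \<longleftrightarrow>
    (\<forall>t. is_gen_seed \<kappa> r (\<Sigma> t)) \<and>
    (\<forall>k t t'. adj k t t' \<longrightarrow> \<Sigma> t' = gen_mutation \<kappa> r k (\<Sigma> t))"


section \<open>The extended semifield\<close>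

text \<open>
  The variables \<open>s\<close> are indexed by a finite type \<open>'d\<close> which stands for the set of pairs
  \<open>(i, l)\<close> with \<open>1 \<le> l \<le> r i\<close>, through a bijection written \<open>D\<close> below. The linear order on \<open>'d\<close> is
  only needed by the library to make the polynomial ring an integral domain. The field of rational
  functions in \<open>s\<close> is formed as the fraction field of the polynomials over the group ring.
\<close>

type_synonym ('p, 'd) spoly = "('d \<Rightarrow>\<^sub>0 nat) \<Rightarrow>\<^sub>0 'p group_ring"

type_synonym ('p, 'd) srat = "('p, 'd) spoly fract"

definition NPs :: "('p :: semifield, 'd) spoly set" where
  "NPs = {f. \<forall>\<alpha>. Poly_Mapping.lookup f \<alpha> \<in> NP}"

lemma lookup_mult_closed:
  fixes f g :: "'a :: monoid_add \<Rightarrow>\<^sub>0 'b :: semiring_0"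
  assumes zero: "0 \<in> C" and add: "\<And>a b. a \<in> C \<Longrightarrow> b \<in> C \<Longrightarrow> a + b \<in> C"
    and mult: "\<And>a b. a \<in> C \<Longrightarrow> b \<in> C \<Longrightarrow> a * b \<in> C"
    and f: "\<And>k. Poly_Mapping.lookup f k \<in> C" and g: "\<And>k. Poly_Mapping.lookup g k \<in> C"
  shows "Poly_Mapping.lookup (f * g) k \<in> C"
proof -
  have S: "sum h A \<in> C" if "\<And>a. h a \<in> C" for h :: "'a \<Rightarrow> 'b" and A
    using that by (induction A rule: infinite_finite_induct) (auto intro: zero add)
  have "(\<Sum>q. Poly_Mapping.lookup g q when k = l + q) \<in> C" for l
    unfolding Sum_any.expand_set by (rule S) (auto simp: when_def zero g)
  then show ?thesis
    unfolding lookup_mult Sum_any.expand_set[where g = "\<lambda>l. Poly_Mapping.lookup f l * _ l"]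
    by (intro S mult f)
qed

lemma NP_zero: "0 \<in> NP" and NP_one: "1 \<in> NP"
  by (simp_all add: NP_def lookup_one when_def)

lemma NP_add: "f \<in> NP \<Longrightarrow> g \<in> NP \<Longrightarrow> f + g \<in> NP"
  by (simp add: NP_def lookup_add)

lemma NP_mult: "f \<in> NP \<Longrightarrow> g \<in> NP \<Longrightarrow> f * g \<in> NP"
  using lookup_mult_closed[of "{0..}" f g] by (simp add: NP_def)

lemma NP_add_eq_0: "f \<in> NP \<Longrightarrow> g \<in> NP \<Longrightarrow> f + g = 0 \<Longrightarrow> f = 0"
  by (rule poly_mapping_eqI)
    (metis (mono_tags, lifting) NP_def add_nonneg_eq_0_iff lookup_add lookup_zero mem_Collect_eq)

lemma NPs_one: "1 \<in> NPs"
  by (simp add: NPs_def lookup_one when_def NP_zero NP_one)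

lemma NPs_add: "f \<in> NPs \<Longrightarrow> g \<in> NPs \<Longrightarrow> f + g \<in> NPs"
  by (simp add: NPs_def lookup_add NP_add)

lemma NPs_mult: "f \<in> NPs \<Longrightarrow> g \<in> NPs \<Longrightarrow> f * g \<in> NPs"
  using lookup_mult_closed[of NP f g] by (simp add: NPs_def NP_zero NP_add NP_mult)

lemma NPs_add_eq_0: "f \<in> NPs \<Longrightarrow> g \<in> NPs \<Longrightarrow> f + g = 0 \<Longrightarrow> f = 0"
  by (rule poly_mapping_eqI)
    (metis (mono_tags, lifting) NPs_def NP_add_eq_0 lookup_add lookup_zero mem_Collect_eq)

definition pbar_set :: "('p :: semifield, 'd :: linorder) srat set" where
  "pbar_set = {Fract f g | f g. f \<in> NPs \<and> g \<in> NPs \<and> f \<noteq> 0 \<and> g \<noteq> 0}"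

lemma pbar_setE:
  assumes "a \<in> pbar_set"
  obtains f g where "a = Fract f g" "f \<in> NPs" "g \<in> NPs" "f \<noteq> 0" "g \<noteq> 0"
  using assms unfolding pbar_set_def by blast

lemma pbar_setI: "f \<in> NPs \<Longrightarrow> g \<in> NPs \<Longrightarrow> f \<noteq> 0 \<Longrightarrow> g \<noteq> 0 \<Longrightarrow> Fract f g \<in> pbar_set"
  unfolding pbar_set_def by blast

lemma pbar_set_one: "1 \<in> pbar_set"
  unfolding One_fract_def by (intro pbar_setI) (simp_all add: NPs_one)

lemma pbar_set_mult: "a \<in> pbar_set \<Longrightarrow> b \<in> pbar_set \<Longrightarrow> a * b \<in> pbar_set"
  by (elim pbar_setE) (simp add: pbar_setI NPs_mult)

lemma pbar_set_inverse: "a \<in> pbar_set \<Longrightarrow> inverse a \<in> pbar_set"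
  by (elim pbar_setE) (simp add: pbar_setI)

lemma pbar_set_add:
  fixes a b :: "('p :: semifield, 'd :: linorder) srat"
  shows "a \<in> pbar_set \<Longrightarrow> b \<in> pbar_set \<Longrightarrow> a + b \<in> pbar_set"
proof (elim pbar_setE)
  fix f g f' g' :: "('p, 'd) spoly"
  assume *: "a = Fract f g" "f \<in> NPs" "g \<in> NPs" "f \<noteq> 0" "g \<noteq> 0"
    "b = Fract f' g'" "f' \<in> NPs" "g' \<in> NPs" "f' \<noteq> 0" "g' \<noteq> 0"
  have "f * g' + f' * g \<noteq> 0"
    using NPs_add_eq_0[of "f * g'" "f' * g"] * by (auto simp: NPs_mult)
  then show ?thesis using * by (simp add: pbar_setI NPs_mult NPs_add)
qed

lemma pbar_set_nonzero: "a \<in> pbar_set \<Longrightarrow> a \<noteq> 0"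
  by (elim pbar_setE) (simp add: Zero_fract_def eq_fract)

typedef (overloaded) ('p :: semifield, 'd :: linorder) pbar = "pbar_set :: ('p, 'd) srat set"
  morphisms rat_of_pbar Abs_pbar
  using pbar_set_one by blast

setup_lifting type_definition_pbar

instantiation pbar :: (semifield, linorder) semifield
begin

lift_definition one_pbar :: "('a, 'b) pbar" is 1 by (rule pbar_set_one)
lift_definition plus_pbar :: "('a, 'b) pbar \<Rightarrow> ('a, 'b) pbar \<Rightarrow> ('a, 'b) pbar" is "(+)"
  by (rule pbar_set_add)
lift_definition times_pbar :: "('a, 'b) pbar \<Rightarrow> ('a, 'b) pbar \<Rightarrow> ('a, 'b) pbar" is "(*)"
  by (rule pbar_set_mult)
lift_definition inverse_pbar :: "('a, 'b) pbar \<Rightarrow> ('a, 'b) pbar" is inverse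
  by (rule pbar_set_inverse)
lift_definition divide_pbar :: "('a, 'b) pbar \<Rightarrow> ('a, 'b) pbar \<Rightarrow> ('a, 'b) pbar" is "(/)"
  by (simp add: divide_inverse pbar_set_mult pbar_set_inverse)

instance
  by standard (transfer; simp add: algebra_simps divide_inverse pbar_set_nonzero)+

end

definition s_const :: "'p :: semifield group_ring \<Rightarrow> ('p, 'd :: linorder) srat" where
  "s_const c = to_fract (Poly_Mapping.single 0 c)"

definition s_var :: "'d \<Rightarrow> ('p :: semifield, 'd :: linorder) srat" where
  "s_var d = to_fract (Poly_Mapping.single (Poly_Mapping.single d 1) 1)"

lemma s_const_gr_pbar: "s_const (gr p) \<in> pbar_set"
proof -
  have "Poly_Mapping.single 0 (gr p) \<in> NPs"
    by (auto simp: NPs_def NP_def gr_def lookup_single when_def)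
  moreover have "Poly_Mapping.single 0 (gr p) \<noteq> 0"
    by (metis gr_def lookup_single_eq lookup_zero one_neq_zero)
  ultimately show ?thesis
    unfolding s_const_def to_fract_def by (intro pbar_setI) (simp_all add: NPs_one)
qed

lemma s_var_pbar: "s_var d \<in> pbar_set"
proof -
  have "Poly_Mapping.single (Poly_Mapping.single d 1) 1 \<in> NPs"
    by (auto simp: NPs_def lookup_single when_def NP_zero NP_one)
  moreover have "Poly_Mapping.single (Poly_Mapping.single d (1 :: nat)) (1 :: 'b group_ring) \<noteq> 0"
    by (metis lookup_single_eq lookup_zero one_neq_zero)
  ultimately show ?thesis
    unfolding s_var_def to_fract_def by (intro pbar_setI) (simp_all add: NPs_one)
qed

lift_definition inP :: "'p :: semifield \<Rightarrow> ('p, 'd :: linorder) pbar" is "\<lambda>p. s_const (gr p)"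
  by (rule s_const_gr_pbar)

lift_definition svar :: "'d \<Rightarrow> ('p :: semifield, 'd :: linorder) pbar" is s_var
  by (rule s_var_pbar)

definition elem_sym :: "nat \<Rightarrow> 'i set \<Rightarrow> ('i \<Rightarrow> 'a :: comm_semiring_1) \<Rightarrow> 'a" where
  "elem_sym l A f = (\<Sum>J | J \<subseteq> A \<and> card J = l. \<Prod>j\<in>J. f j)"

definition e_elem :: "('n \<Rightarrow> nat) \<Rightarrow> ('n \<Rightarrow> nat \<Rightarrow> 'd) \<Rightarrow> 'n \<Rightarrow> nat \<Rightarrow> ('p :: semifield, 'd :: linorder) srat"
  where
  "e_elem r D i l = elem_sym l {1..r i} (\<lambda>m. s_var (D i m))"

inductive_set NPe :: "('n \<Rightarrow> nat) \<Rightarrow> ('n \<Rightarrow> nat \<Rightarrow> 'd) \<Rightarrow> ('p :: semifield, 'd :: linorder) srat set"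
  for r :: "'n \<Rightarrow> nat" and D :: "'n \<Rightarrow> nat \<Rightarrow> 'd" where
  const: "c \<in> NP \<Longrightarrow> s_const c \<in> NPe r D"
| elem: "1 \<le> l \<Longrightarrow> l \<le> r i \<Longrightarrow> e_elem r D i l \<in> NPe r D"
| add: "f \<in> NPe r D \<Longrightarrow> g \<in> NPe r D \<Longrightarrow> f + g \<in> NPe r D"
| mult: "f \<in> NPe r D \<Longrightarrow> g \<in> NPe r D \<Longrightarrow> f * g \<in> NPe r D"

text \<open>
  The homomorphism on \<open>\<nat>P[e]\<close> is uniquely determined there by its defining properties; its values
  elsewhere are irrelevant. In the following, \<open>Z\<close> are the exchange polynomials at \<open>t\<^sub>0\<close>.
\<close>

definition psi0 ::
  "('n \<Rightarrow> nat) \<Rightarrow> ('n \<Rightarrow> nat \<Rightarrow> 'd) \<Rightarrow> ('n \<Rightarrow> 'p group_ring poly) \<Rightarrow>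
    ('p :: semifield, 'd :: linorder) srat \<Rightarrow> 'p with_zero" where
  "psi0 r D Z = (SOME h.
    (\<forall>f\<in>NPe r D. \<forall>g\<in>NPe r D. h (f + g) = h f + h g \<and> h (f * g) = h f * h g) \<and>
    (\<forall>c\<in>NP. h (s_const c) = pi0 c) \<and>
    (\<forall>i. \<forall>l\<in>{1..r i}. h (e_elem r D i l) = pi0 (Polynomial.coeff (Z i) l)))"

definition SS ::
  "('n \<Rightarrow> nat) \<Rightarrow> ('n \<Rightarrow> nat \<Rightarrow> 'd) \<Rightarrow> ('n \<Rightarrow> 'p group_ring poly) \<Rightarrow>
    ('p :: semifield, 'd :: linorder) pbar set" where
  "SS r D Z = {p. \<exists>f\<in>NPe r D. \<exists>g\<in>NPe r D.
    psi0 r D Z f \<noteq> 0 \<and> psi0 r D Z g \<noteq> 0 \<and> rat_of_pbar p = f / g}"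

definition psi ::
  "('n \<Rightarrow> nat) \<Rightarrow> ('n \<Rightarrow> nat \<Rightarrow> 'd) \<Rightarrow> ('n \<Rightarrow> 'p group_ring poly) \<Rightarrow>
    ('p :: semifield, 'd :: linorder) pbar \<Rightarrow> 'p" where
  "psi r D Z p = (THE v. \<exists>f\<in>NPe r D. \<exists>g\<in>NPe r D.
    psi0 r D Z f \<noteq> 0 \<and> psi0 r D Z g \<noteq> 0 \<and> rat_of_pbar p = f / g \<and>
    v = unNz (psi0 r D Z f) / unNz (psi0 r D Z g))"


section \<open>The composite cluster pattern\<close>

definition comp_mutation ::
  "(('p :: semifield, 'd :: {finite, linorder}) pbar qfield \<Rightarrow> 'g :: field) \<Rightarrow> ('n \<Rightarrow> nat) \<Rightarrow>
    ('n \<Rightarrow> nat \<Rightarrow> 'd) \<Rightarrow> 'n \<Rightarrow>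
    ('g, ('p, 'd) pbar, 'd) ord_seed \<Rightarrow> ('g, ('p, 'd) pbar, 'd) ord_seed" where
  "comp_mutation \<kappa> r D k = fold (\<lambda>l. ord_mutation \<kappa> (D k l)) [1..<Suc (r k)]"

definition composite_pattern ::
  "(('p :: semifield, 'd :: {finite, linorder}) pbar qfield \<Rightarrow> 'g :: field) \<Rightarrow> ('n \<Rightarrow> nat) \<Rightarrow>
    ('n \<Rightarrow> nat \<Rightarrow> 'd) \<Rightarrow> ('n \<Rightarrow> 't \<Rightarrow> 't \<Rightarrow> bool) \<Rightarrow> 't \<Rightarrow> ('n \<Rightarrow> 'p) \<Rightarrow> ('n \<Rightarrow> 'n \<Rightarrow> int) \<Rightarrow>
    ('t \<Rightarrow> ('g, ('p, 'd) pbar, 'd) ord_seed) \<Rightarrow> bool" where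
  "composite_pattern \<kappa> r D adj t0 y b \<Sigma> \<longleftrightarrow>
    free_generating \<kappa> (sx (\<Sigma> t0)) \<and>
    (\<forall>i. \<forall>l\<in>{1..r i}. sy (\<Sigma> t0) (D i l) = svar (D i l) * inP (y i)) \<and>
    (\<forall>i j. \<forall>l\<in>{1..r i}. \<forall>m\<in>{1..r j}. sB (\<Sigma> t0) (D i l) (D j m) = b i j) \<and>
    (\<forall>k t t'. adj k t t' \<longrightarrow> \<Sigma> t' = comp_mutation \<kappa> r D k (\<Sigma> t))"

definition bigX ::
  "('n \<Rightarrow> nat) \<Rightarrow> ('n \<Rightarrow> nat \<Rightarrow> 'd) \<Rightarrow> ('g :: field, 'q, 'd) ord_seed \<Rightarrow> 'n \<Rightarrow> 'g" where
  "bigX r D \<sigma> i = (\<Prod>l\<in>{1..r i}. sx \<sigma> (D i l))"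


section \<open>The algebra of fractions and its quotient\<close>

definition ehat ::
  "('n \<Rightarrow> nat) \<Rightarrow> ('n \<Rightarrow> nat \<Rightarrow> 'd) \<Rightarrow> 'n \<Rightarrow> nat \<Rightarrow> ('p :: semifield, 'd :: linorder) pbar group_ring"
  where
  "ehat r D i l = elem_sym l {1..r i} (\<lambda>m. gr (svar (D i m)))"

text \<open>The inclusion of group rings induced by the inclusion of semifields \<open>inP\<close>.\<close>

definition inZP :: "'p :: semifield group_ring \<Rightarrow> ('p, 'd :: linorder) pbar group_ring" where
  "inZP c = (\<Sum>a\<in>Poly_Mapping.keys c. of_int (Poly_Mapping.lookup c a) * gr (inP (expo_base a)))"

definition ZSeX ::
  "(('p :: semifield, 'd :: linorder) pbar qfield \<Rightarrow> 'g :: field) \<Rightarrow> ('n \<Rightarrow> nat) \<Rightarrow>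
    ('n \<Rightarrow> nat \<Rightarrow> 'd) \<Rightarrow> ('n \<Rightarrow> 'p group_ring poly) \<Rightarrow> ('n \<Rightarrow> 'g) \<Rightarrow> 'g set" where
  "ZSeX \<kappa> r D Z X0 = generate_ring ring_of_type_algebra
    (embP \<kappa> ` SS r D Z \<union> {\<kappa> (to_fract (ehat r D i l)) | i l. 1 \<le> l \<and> l \<le> r i} \<union> range X0)"

definition ZPX ::
  "(('p :: semifield, 'd :: linorder) pbar qfield \<Rightarrow> 'g :: field) \<Rightarrow> ('n \<Rightarrow> 'g) \<Rightarrow> 'g set" where
  "ZPX \<kappa> X0 = generate_ring ring_of_type_algebra (range (\<lambda>p. embP \<kappa> (inP p)) \<union> range X0)"

text \<open>
  Again determined uniquely on \<open>ZSeX\<close>; linearity over the group ring of the base semifield follows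
  since \<open>psi\<close> is the identity on that semifield.
\<close>

definition psihat0 ::
  "(('p :: semifield, 'd :: linorder) pbar qfield \<Rightarrow> 'g :: field) \<Rightarrow> ('n \<Rightarrow> nat) \<Rightarrow>
    ('n \<Rightarrow> nat \<Rightarrow> 'd) \<Rightarrow> ('n \<Rightarrow> 'p group_ring poly) \<Rightarrow> ('n \<Rightarrow> 'g) \<Rightarrow> 'g \<Rightarrow> 'g" where
  "psihat0 \<kappa> r D Z X0 = (SOME h.
    h \<in> ring_hom (ring_of_type_algebra\<lparr>carrier := ZSeX \<kappa> r D Z X0\<rparr>)
      (ring_of_type_algebra\<lparr>carrier := ZPX \<kappa> X0\<rparr>) \<and>
    (\<forall>p\<in>SS r D Z. h (embP \<kappa> p) = embP \<kappa> (inP (psi r D Z p))) \<and>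
    (\<forall>i. h (X0 i) = X0 i) \<and>
    (\<forall>i. \<forall>l\<in>{1..r i}. h (\<kappa> (to_fract (ehat r D i l)))
      = \<kappa> (to_fract (inZP (Polynomial.coeff (Z i) l)))))"

definition calS ::
  "(('p :: semifield, 'd :: linorder) pbar qfield \<Rightarrow> 'g :: field) \<Rightarrow> ('n \<Rightarrow> nat) \<Rightarrow>
    ('n \<Rightarrow> nat \<Rightarrow> 'd) \<Rightarrow> ('n \<Rightarrow> 'p group_ring poly) \<Rightarrow> ('n \<Rightarrow> 'g) \<Rightarrow> 'g set" where
  "calS \<kappa> r D Z X0 = {f / g | f g. f \<in> ZSeX \<kappa> r D Z X0 \<and> g \<in> ZSeX \<kappa> r D Z X0 \<and>
    psihat0 \<kappa> r D Z X0 g \<noteq> 0}"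

definition psihat ::
  "(('p :: semifield, 'd :: linorder) pbar qfield \<Rightarrow> 'g :: field) \<Rightarrow> ('n \<Rightarrow> nat) \<Rightarrow>
    ('n \<Rightarrow> nat \<Rightarrow> 'd) \<Rightarrow> ('n \<Rightarrow> 'p group_ring poly) \<Rightarrow> ('n \<Rightarrow> 'g) \<Rightarrow> 'g \<Rightarrow> 'g" where
  "psihat \<kappa> r D Z X0 a = (THE v. \<exists>f\<in>ZSeX \<kappa> r D Z X0. \<exists>g\<in>ZSeX \<kappa> r D Z X0.
    psihat0 \<kappa> r D Z X0 g \<noteq> 0 \<and> a = f / g \<and>
    v = psihat0 \<kappa> r D Z X0 f / psihat0 \<kappa> r D Z X0 g)"

definition ringS ::
  "(('p :: semifield, 'd :: linorder) pbar qfield \<Rightarrow> 'g :: field) \<Rightarrow> ('n \<Rightarrow> nat) \<Rightarrow>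
    ('n \<Rightarrow> nat \<Rightarrow> 'd) \<Rightarrow> ('n \<Rightarrow> 'p group_ring poly) \<Rightarrow> ('n \<Rightarrow> 'g) \<Rightarrow> 'g ring" where
  "ringS \<kappa> r D Z X0 = ring_of_type_algebra\<lparr>carrier := calS \<kappa> r D Z X0\<rparr>"

definition kerS ::
  "(('p :: semifield, 'd :: linorder) pbar qfield \<Rightarrow> 'g :: field) \<Rightarrow> ('n \<Rightarrow> nat) \<Rightarrow>
    ('n \<Rightarrow> nat \<Rightarrow> 'd) \<Rightarrow> ('n \<Rightarrow> 'p group_ring poly) \<Rightarrow> ('n \<Rightarrow> 'g) \<Rightarrow> 'g set" where
  "kerS \<kappa> r D Z X0 = a_kernel (ringS \<kappa> r D Z X0) ring_of_type_algebra (psihat \<kappa> r D Z X0)"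

definition quotS ::
  "(('p :: semifield, 'd :: linorder) pbar qfield \<Rightarrow> 'g :: field) \<Rightarrow> ('n \<Rightarrow> nat) \<Rightarrow>
    ('n \<Rightarrow> nat \<Rightarrow> 'd) \<Rightarrow> ('n \<Rightarrow> 'p group_ring poly) \<Rightarrow> ('n \<Rightarrow> 'g) \<Rightarrow> 'g set ring" where
  "quotS \<kappa> r D Z X0 = ringS \<kappa> r D Z X0 Quot kerS \<kappa> r D Z X0"

definition clsS ::
  "(('p :: semifield, 'd :: linorder) pbar qfield \<Rightarrow> 'g :: field) \<Rightarrow> ('n \<Rightarrow> nat) \<Rightarrow>
    ('n \<Rightarrow> nat \<Rightarrow> 'd) \<Rightarrow> ('n \<Rightarrow> 'p group_ring poly) \<Rightarrow> ('n \<Rightarrow> 'g) \<Rightarrow> 'g \<Rightarrow> 'g set" where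
  "clsS \<kappa> r D Z X0 a = kerS \<kappa> r D Z X0 +>\<^bsub>ringS \<kappa> r D Z X0\<^esub> a"

text \<open>The \<open>m\<close>-th root of a class, taken inside the image of the semifield \<open>SS\<close> in the quotient.\<close>

definition rootS ::
  "(('p :: semifield, 'd :: linorder) pbar qfield \<Rightarrow> 'g :: field) \<Rightarrow> ('n \<Rightarrow> nat) \<Rightarrow>
    ('n \<Rightarrow> nat \<Rightarrow> 'd) \<Rightarrow> ('n \<Rightarrow> 'p group_ring poly) \<Rightarrow> ('n \<Rightarrow> 'g) \<Rightarrow> nat \<Rightarrow> 'g set \<Rightarrow> 'g set" where
  "rootS \<kappa> r D Z X0 m c = (THE c'. c' \<in> (\<lambda>p. clsS \<kappa> r D Z X0 (embP \<kappa> p)) ` SS r D Z \<and>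
    c' [^]\<^bsub>quotS \<kappa> r D Z X0\<^esub> m = c)"

definition is_Phi ::
  "('p :: semifield qfield \<Rightarrow> 'f :: field) \<Rightarrow> (('p, 'd :: linorder) pbar qfield \<Rightarrow> 'g :: field) \<Rightarrow>
    ('n \<Rightarrow> nat) \<Rightarrow> ('n \<Rightarrow> nat \<Rightarrow> 'd) \<Rightarrow> ('n \<Rightarrow> 'p group_ring poly) \<Rightarrow> ('n \<Rightarrow> 'g) \<Rightarrow> ('n \<Rightarrow> 'f) \<Rightarrow>
    ('f \<Rightarrow> 'g set) \<Rightarrow> bool" where
  "is_Phi \<kappa> \<kappa>' r D Z X0 x \<Phi> \<longleftrightarrow>
    \<Phi> \<in> ring_iso ring_of_type_algebra (quotS \<kappa>' r D Z X0) \<and>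
    (\<forall>i. \<Phi> (x i) = clsS \<kappa>' r D Z X0 (X0 i)) \<and>
    (\<forall>p. \<Phi> (embP \<kappa> p) = clsS \<kappa>' r D Z X0 (embP \<kappa>' (inP p)))"

end

theory Submission
  imports Defs
begin

text \<open>
  By induction along the tree, the composite seed at \<open>t\<close> keeps the form it has at \<open>t\<^sub>0\<close>: for every
  index \<open>i\<close> the \<open>y\<close>-variables with first index \<open>i\<close> are \<open>s\<^sub>i\<^sub>l w\<^sub>i\<close> or \<open>s\<^sub>i\<^sub>l\<inverse> w\<^sub>i\<close> with a common
  factor \<open>w\<^sub>i\<close> whose image under \<open>\<psi>\<close> is the \<open>y\<close>-variable of the generalized seed, and the exchange
  polynomial of the generalized seed is the original one or its reflection, respectively. A composite
  mutation multiplies the binomials \<open>1 + s\<^sub>i\<^sub>l v\<close> over \<open>l\<close>, which yields the elementary symmetric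
  polynomials in \<open>s\<^sub>i\<^sub>1, s\<^sub>i\<^sub>2, \<dots>\<close>; the two homomorphisms turn these into the coefficients of the
  exchange polynomial, both tropically and in the ambient field.

  That the two homomorphisms exist rests on specializing the variables \<open>s\<close> in the algebraic closure of
  the ambient field. Roots for which the elementary symmetric polynomials become the free generators
  show that these polynomials are algebraically independent. Roots of the exchange polynomials, on
  the other hand, give a homomorphism from the ring spanned by the products of elements of \<open>S\<close> and
  monomials in the \<open>s\<^sub>i\<^sub>l\<close> to the closure; this is consistent with \<open>\<psi>\<close> because the elements of \<open>S\<close>
  are symmetric in \<open>s\<^sub>i\<^sub>1, s\<^sub>i\<^sub>2, \<dots>\<close>.
\<close>


section \<open>Homomorphisms and evaluation of monoid rings\<close>

text \<open>The functions \<open>psi0\<close> and \<open>psihat0\<close> are given by a choice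
  operator, so nothing is known of them until some function with the required properties is
  exhibited. For \<open>psihat0\<close> this is no free extension, since the generators are related:
  for l = r i the element \<open>ehat\<close> is the basis element of s_i1 s_i2 ..., which itself
  lies in S. The normalization of the exchange polynomials resolves the conflict: their leading
  coefficient 1 makes both psi and the specialization at the roots send that product to 1. For the
  same reason the factors \<open>svar\<close> disappear from the product of the y-variables of a
  family, leaving an r i-th power; this is where the root in the statement comes from. The algebraic
  closure is only a detour, because the resulting values lie in ZP[X]. Likewise the quotient is
  never computed in: psihat identifies it with a subfield of the ambient field, \<Phi> becomes an
  embedding \<open>theta\<close> of F into that field, and every claim about classes becomes an
  equation between \<open>psih\<close> and \<open>theta\<close>. The single mutations that make up a
  composite one do not disturb each other because the diagonal entries of a skew-symmetrizable
  matrix vanish.\<close>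

locale type_hom =
  fixes h :: "'a :: comm_ring_1 \<Rightarrow> 'b :: comm_ring_1"
  assumes hom_add: "h (a + b) = h a + h b"
    and hom_mult: "h (a * b) = h a * h b"
    and hom_one [simp]: "h 1 = 1"
begin

lemma hom_zero [simp]: "h 0 = 0"
  using hom_add[of 0 0] by simp

lemma hom_uminus: "h (- a) = - h a"
  using hom_add[of a "- a"] by (simp add: eq_neg_iff_add_eq_0 add.commute)

lemma hom_diff: "h (a - b) = h a - h b"
  using hom_add[of a "- b"] by (simp add: hom_uminus)

lemma hom_sum: "h (sum f A) = (\<Sum>x\<in>A. h (f x))"
  by (induction A rule: infinite_finite_induct) (auto simp: hom_add)

lemma hom_prod: "h (prod f A) = (\<Prod>x\<in>A. h (f x))"
  by (induction A rule: infinite_finite_induct) (auto simp: hom_mult)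

lemma hom_power: "h (a ^ n) = h a ^ n"
  by (induction n) (auto simp: hom_mult)

lemma hom_of_nat: "h (of_nat n) = of_nat n"
  by (induction n) (auto simp: hom_add)

lemma hom_of_int: "h (of_int n) = of_int n"
  by (cases n) (auto simp: hom_of_nat hom_uminus hom_diff)

lemma hom_elem_sym: "h (elem_sym l A f) = elem_sym l A (\<lambda>i. h (f i))"
  by (simp add: elem_sym_def hom_sum hom_prod)

lemma inj_homI: "(\<And>a. h a = 0 \<Longrightarrow> a = 0) \<Longrightarrow> inj h"
  by (rule injI) (metis hom_diff right_minus_eq)

end

lemma type_hom_compose: "type_hom g \<Longrightarrow> type_hom h \<Longrightarrow> type_hom (\<lambda>a. g (h a))"
  by (simp add: type_hom_def)

lemma type_hom_ring_hom:
  "type_hom h \<longleftrightarrow> h \<in> ring_hom ring_of_type_algebra ring_of_type_algebra"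
  by (simp add: type_hom_def ring_hom_def ring_of_type_algebra_def) blast

locale field_hom = type_hom h for h :: "'a :: field \<Rightarrow> 'b :: field"
begin

lemma hom_eq_0_iff [simp]: "h a = 0 \<longleftrightarrow> a = 0"
proof
  assume "h a = 0"
  then have "h (a * inverse a) = 0" by (simp add: hom_mult)
  then show "a = 0" by (cases "a = 0") auto
qed simp

lemma hom_eq_iff [simp]: "h a = h b \<longleftrightarrow> a = b"
  using hom_eq_0_iff[of "a - b"] by (simp add: hom_diff del: hom_eq_0_iff)

lemma hom_inverse: "h (inverse a) = inverse (h a)"
proof (cases "a = 0")
  case False
  then have "h a * h (inverse a) = 1" by (simp flip: hom_mult)
  then show ?thesis by (simp add: inverse_unique)
qed simp

lemma hom_divide: "h (a / b) = h a / h b"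
  by (simp add: divide_inverse hom_mult hom_inverse)

lemma hom_powi: "h (a powi n) = h a powi n"
  by (simp add: power_int_def hom_power hom_inverse)

end

lemma field_hom_iff: "field_hom h \<longleftrightarrow> type_hom h"
  by (simp add: field_hom_def)

lemma type_hom_to_ac: "type_hom to_ac"
  by unfold_locales auto

lemma type_hom_to_fract: "type_hom to_fract"
  by unfold_locales auto

text \<open>One operator covers \<open>pi0\<close>, \<open>inZP\<close>, \<open>poly_eval\<close>
  and all specializations below. The target is only a semiring because \<open>pi0\<close> takes
  values in \<open>'p with_zero\<close>, and \<phi> and \<chi> are arbitrary functions because they
  may be homomorphic on a part of their domain only.\<close>

definition lin :: "('b :: zero \<Rightarrow> 'c :: comm_semiring_1) \<Rightarrow> ('a \<Rightarrow> 'c) \<Rightarrow> ('a \<Rightarrow>\<^sub>0 'b) \<Rightarrow> 'c" where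
  "lin \<phi> \<chi> f = (\<Sum>a\<in>Poly_Mapping.keys f. \<phi> (Poly_Mapping.lookup f a) * \<chi> a)"

lemma lin_superset:
  assumes "finite A" "Poly_Mapping.keys f \<subseteq> A" "\<phi> 0 = 0"
  shows "lin \<phi> \<chi> f = (\<Sum>a\<in>A. \<phi> (Poly_Mapping.lookup f a) * \<chi> a)"
  unfolding lin_def using assms
  by (intro sum.mono_neutral_left) (auto simp: in_keys_iff)

lemma lin_zero [simp]: "lin \<phi> \<chi> 0 = 0"
  by (simp add: lin_def)

lemma lin_single: "\<phi> 0 = 0 \<Longrightarrow> lin \<phi> \<chi> (Poly_Mapping.single a b) = \<phi> b * \<chi> a"
  by (cases "b = 0") (simp_all add: lin_def)

lemma lookup_sum_single: "(\<Sum>a\<in>Poly_Mapping.keys f. Poly_Mapping.single a (Poly_Mapping.lookup f a)) = f"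
  by (rule poly_mapping_eqI)
    (auto simp: lookup_sum lookup_single when_def in_keys_iff sum.delta)

lemma mult_sum_single:
  fixes f g :: "'a :: monoid_add \<Rightarrow>\<^sub>0 'b :: semiring_0"
  shows "f * g = (\<Sum>a\<in>Poly_Mapping.keys f. \<Sum>b\<in>Poly_Mapping.keys g.
    Poly_Mapping.single (a + b) (Poly_Mapping.lookup f a * Poly_Mapping.lookup g b))"
proof -
  have "f * g = (\<Sum>a\<in>Poly_Mapping.keys f. Poly_Mapping.single a (Poly_Mapping.lookup f a)) *
    (\<Sum>a\<in>Poly_Mapping.keys g. Poly_Mapping.single a (Poly_Mapping.lookup g a))"
    by (simp only: lookup_sum_single)
  then show ?thesis by (simp add: sum_product mult_single)
qed

text \<open>
  The restrictions to \<open>C\<close> and \<open>M\<close> cannot be dropped: \<open>pi0\<close> is additive on nonnegative coefficients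
  only, and an element of the extended semifield can be specialized only if it is the product of an
  element of \<open>SS\<close> and a monomial in the variables \<open>svar\<close>.
\<close>

locale partial_hom =
  fixes C :: "'b :: comm_semiring_1 set" and \<phi> :: "'b \<Rightarrow> 'c :: comm_semiring_1"
    and M :: "'a :: comm_monoid_add set" and \<chi> :: "'a \<Rightarrow> 'c"
  assumes C_zero: "0 \<in> C" and C_one: "1 \<in> C" and C_add: "\<And>a b. a \<in> C \<Longrightarrow> b \<in> C \<Longrightarrow> a + b \<in> C"
    and C_mult: "\<And>a b. a \<in> C \<Longrightarrow> b \<in> C \<Longrightarrow> a * b \<in> C"
    and phi_zero: "\<phi> 0 = 0" and phi_one: "\<phi> 1 = 1"
    and phi_add: "\<And>a b. a \<in> C \<Longrightarrow> b \<in> C \<Longrightarrow> \<phi> (a + b) = \<phi> a + \<phi> b"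
    and phi_mult: "\<And>a b. a \<in> C \<Longrightarrow> b \<in> C \<Longrightarrow> \<phi> (a * b) = \<phi> a * \<phi> b"
    and M_zero: "0 \<in> M" and M_add: "\<And>a b. a \<in> M \<Longrightarrow> b \<in> M \<Longrightarrow> a + b \<in> M"
    and chi_zero: "\<chi> 0 = 1"
    and chi_add: "\<And>a b. a \<in> M \<Longrightarrow> b \<in> M \<Longrightarrow> \<chi> (a + b) = \<chi> a * \<chi> b"
begin

definition dom :: "('a \<Rightarrow>\<^sub>0 'b) set" where
  "dom = {f. (\<forall>a. Poly_Mapping.lookup f a \<in> C) \<and> Poly_Mapping.keys f \<subseteq> M}"

lemma dom_zero: "0 \<in> dom"
  by (simp add: dom_def C_zero)

lemma dom_add: "f \<in> dom \<Longrightarrow> g \<in> dom \<Longrightarrow> f + g \<in> dom"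
  using Poly_Mapping.keys_add[of f g] by (auto simp: dom_def lookup_add C_add)

lemma dom_sum: "(\<And>i. i \<in> A \<Longrightarrow> f i \<in> dom) \<Longrightarrow> sum f A \<in> dom"
  by (induction A rule: infinite_finite_induct) (auto simp: dom_zero dom_add)

lemma dom_single: "a \<in> M \<Longrightarrow> b \<in> C \<Longrightarrow> Poly_Mapping.single a b \<in> dom"
  by (auto simp: dom_def lookup_single when_def C_zero)

lemma dom_mult: "f \<in> dom \<Longrightarrow> g \<in> dom \<Longrightarrow> f * g \<in> dom"
  unfolding mult_sum_single[of f g]
  by (intro dom_sum dom_single M_add C_mult) (auto simp: dom_def)

lemma lin_add: "f \<in> dom \<Longrightarrow> g \<in> dom \<Longrightarrow> lin \<phi> \<chi> (f + g) = lin \<phi> \<chi> f + lin \<phi> \<chi> g"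
  using Poly_Mapping.keys_add[of f g]
  by (subst (1 2 3) lin_superset[where A = "Poly_Mapping.keys f \<union> Poly_Mapping.keys g"])
    (auto simp: lookup_add phi_zero phi_add dom_def distrib_right sum.distrib)

lemma lin_sum: "(\<And>i. i \<in> A \<Longrightarrow> f i \<in> dom) \<Longrightarrow> lin \<phi> \<chi> (sum f A) = (\<Sum>i\<in>A. lin \<phi> \<chi> (f i))"
  by (induction A rule: infinite_finite_induct) (auto simp: lin_add dom_sum)

lemma lin_mult:
  assumes f: "f \<in> dom" and g: "g \<in> dom"
  shows "lin \<phi> \<chi> (f * g) = lin \<phi> \<chi> f * lin \<phi> \<chi> g"
proof -
  have in_dom: "Poly_Mapping.single (a + b) (Poly_Mapping.lookup f a * Poly_Mapping.lookup g b) \<in> dom"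
    if "a \<in> Poly_Mapping.keys f" "b \<in> Poly_Mapping.keys g" for a b
    using that f g by (intro dom_single M_add C_mult) (auto simp: dom_def)
  have "lin \<phi> \<chi> (f * g) = (\<Sum>a\<in>Poly_Mapping.keys f. \<Sum>b\<in>Poly_Mapping.keys g.
      lin \<phi> \<chi> (Poly_Mapping.single (a + b) (Poly_Mapping.lookup f a * Poly_Mapping.lookup g b)))"
    unfolding mult_sum_single[of f g] using in_dom by (simp add: lin_sum dom_sum)
  also have "\<dots> = (\<Sum>a\<in>Poly_Mapping.keys f. \<Sum>b\<in>Poly_Mapping.keys g.
      (\<phi> (Poly_Mapping.lookup f a) * \<chi> a) * (\<phi> (Poly_Mapping.lookup g b) * \<chi> b))"
    using f g by (intro sum.cong refl)
      (auto simp: lin_single phi_zero phi_mult dom_def subset_iff chi_add mult_ac)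
  finally show ?thesis by (simp add: lin_def sum_product)
qed

lemma dom_one: "1 \<in> dom"
  using dom_single[OF M_zero C_one] by simp

lemma lin_one: "lin \<phi> \<chi> 1 = 1"
  using lin_single[of \<phi> \<chi> 0 1] by (simp add: chi_zero phi_one phi_zero)

lemma dom_prod: "(\<And>i. i \<in> A \<Longrightarrow> f i \<in> dom) \<Longrightarrow> prod f A \<in> dom"
  by (induction A rule: infinite_finite_induct) (auto simp: dom_one dom_mult)

lemma lin_prod: "(\<And>i. i \<in> A \<Longrightarrow> f i \<in> dom) \<Longrightarrow> lin \<phi> \<chi> (prod f A) = (\<Prod>i\<in>A. lin \<phi> \<chi> (f i))"
  by (induction A rule: infinite_finite_induct) (auto simp: dom_prod lin_mult lin_one)

end

lemma type_hom_lin: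
  fixes \<phi> :: "'b :: comm_ring_1 \<Rightarrow> 'c :: comm_ring_1" and \<chi> :: "'a :: comm_monoid_add \<Rightarrow> 'c"
  assumes "type_hom \<phi>" "\<chi> 0 = 1" "\<And>a b. \<chi> (a + b) = \<chi> a * \<chi> b"
  shows "type_hom (lin \<phi> \<chi>)"
proof -
  interpret \<phi>: type_hom \<phi> by fact
  interpret partial_hom UNIV \<phi> UNIV \<chi>
    using assms by unfold_locales (auto simp: \<phi>.hom_add \<phi>.hom_mult)
  have "f \<in> dom" for f by (simp add: dom_def)
  then show ?thesis
    by unfold_locales (auto simp: lin_add lin_mult lin_one)
qed

lemma (in type_hom) hom_lin: "h (lin \<phi> \<chi> f) = lin (\<lambda>b. h (\<phi> b)) (\<lambda>a. h (\<chi> a)) f"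
  by (simp add: lin_def hom_sum hom_mult)

lemma lin_map:
  assumes "g 0 = 0" "\<phi> 0 = 0"
  shows "lin \<phi> \<chi> (Poly_Mapping.map g f) = lin (\<lambda>b. \<phi> (g b)) \<chi> f"
proof -
  have *: "Poly_Mapping.lookup (Poly_Mapping.map g f) a = g (Poly_Mapping.lookup f a)" for a
    using assms by (simp add: map.rep_eq when_def)
  have "Poly_Mapping.keys (Poly_Mapping.map g f) \<subseteq> Poly_Mapping.keys f"
    using assms by (auto simp: in_keys_iff *)
  then show ?thesis
    using assms by (simp add: lin_superset[where A = "Poly_Mapping.keys f"] *)
qed

definition mon :: "('d :: finite \<Rightarrow> 'c :: comm_monoid_mult) \<Rightarrow> ('d \<Rightarrow>\<^sub>0 nat) \<Rightarrow> 'c" where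
  "mon x \<alpha> = (\<Prod>d\<in>UNIV. x d ^ Poly_Mapping.lookup \<alpha> d)"

lemma mon_zero [simp]: "mon x 0 = 1"
  by (simp add: mon_def)

lemma mon_add: "mon x (\<alpha> + \<beta>) = mon x \<alpha> * mon x \<beta>"
  by (simp add: mon_def lookup_add power_add prod.distrib)

lemma mon_single [simp]: "mon x (Poly_Mapping.single d n) = x d ^ n"
proof -
  have "mon x (Poly_Mapping.single d n) = (\<Prod>e\<in>UNIV. if e = d then x d ^ n else 1)"
    unfolding mon_def by (intro prod.cong) (auto simp: lookup_single when_def)
  then show ?thesis by simp
qed

lemma (in type_hom) hom_mon: "h (mon x \<alpha>) = mon (\<lambda>d. h (x d)) \<alpha>"
  by (simp add: mon_def hom_prod hom_power)

lemma poly_eval_lin: "poly_eval \<kappa> x = lin \<kappa> (mon x)"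
  by (simp add: fun_eq_iff poly_eval_def lin_def mon_def)

lemma type_hom_lin_mon: "type_hom \<phi> \<Longrightarrow> type_hom (lin \<phi> (mon x))"
  by (rule type_hom_lin) (auto simp: mon_add)


section \<open>Extension of homomorphisms to fractions\<close>

text \<open>Cross-multiplication turns an equality of two fractions into an element of the kernel of
  i; as this is also the kernel of j, sending i a / i b to j a / j b is well defined. Applied to the
  fraction field of a group ring and to a field of rational functions.\<close>

lemma hom_extend_fractions:
  fixes i :: "'a :: comm_ring_1 \<Rightarrow> 'f :: field" and j :: "'a \<Rightarrow> 'g :: field"
  assumes i: "type_hom i" and j: "type_hom j"
    and ker: "\<And>a. i a = 0 \<longleftrightarrow> j a = 0"
    and frac: "\<And>v. \<exists>a b. i b \<noteq> 0 \<and> v = i a / i b"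
  shows "\<exists>\<theta>. field_hom \<theta> \<and> (\<forall>a. \<theta> (i a) = j a)"
proof -
  interpret i: type_hom i by fact
  interpret j: type_hom j by fact
  have eq: "j a / j b = j a' / j b'" if "i b \<noteq> 0" "i b' \<noteq> 0" "i a / i b = i a' / i b'" for a b a' b'
  proof -
    have "i (a * b' - a' * b) = 0" using that by (simp add: i.hom_diff i.hom_mult field_simps)
    then have "j a * j b' = j a' * j b" by (simp add: ker j.hom_diff j.hom_mult)
    then show ?thesis using that by (simp add: ker field_simps)
  qed
  define \<theta> where "\<theta> v = (SOME w. \<exists>a b. i b \<noteq> 0 \<and> v = i a / i b \<and> w = j a / j b)" for v
  have \<theta>: "\<theta> (i a / i b) = j a / j b" if "i b \<noteq> 0" for a b
  proof -
    have "\<exists>a' b'. i b' \<noteq> 0 \<and> i a / i b = i a' / i b' \<and> \<theta> (i a / i b) = j a' / j b'"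
      unfolding \<theta>_def by (rule someI_ex) (use that in blast)
    then show ?thesis using eq that by metis
  qed
  have "type_hom \<theta>"
  proof
    show "\<theta> 1 = 1" using \<theta>[of 1 1] by simp
    fix u v
    obtain a b where u: "i b \<noteq> 0" "u = i a / i b" using frac by blast
    obtain c d where v: "i d \<noteq> 0" "v = i c / i d" using frac by blast
    have bd: "i (b * d) \<noteq> 0" "j b \<noteq> 0" "j d \<noteq> 0" using u v by (simp_all add: i.hom_mult flip: ker)
    have "u + v = i (a * d + c * b) / i (b * d)" "u * v = i (a * c) / i (b * d)"
      using u v by (simp_all add: i.hom_mult i.hom_add field_simps)
    then have "\<theta> (u + v) = j (a * d + c * b) / j (b * d)" "\<theta> (u * v) = j (a * c) / j (b * d)"
      using \<theta>[OF bd(1)] by simp_all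
    then show "\<theta> (u + v) = \<theta> u + \<theta> v" "\<theta> (u * v) = \<theta> u * \<theta> v"
      using bd by (simp_all add: u v \<theta> j.hom_mult j.hom_add field_simps)
  qed
  moreover have "\<theta> (i a) = j a" for a using \<theta>[of 1 a] by simp
  ultimately show ?thesis by (auto simp: field_hom_iff)
qed

lemma fract_eq_quotient: "\<exists>a b. to_fract b \<noteq> 0 \<and> v = to_fract a / to_fract b"
  by (cases v) (metis Fract_conv_to_fract to_fract_eq_0_iff)


section \<open>Elementary symmetric polynomials\<close>

lemma elem_sym_0 [simp]: "finite A \<Longrightarrow> elem_sym 0 A f = 1"
proof -
  assume A: "finite A"
  have "{J. J \<subseteq> A \<and> card J = 0} = {{}}"
    using A by (auto dest: finite_subset)
  then show ?thesis by (simp add: elem_sym_def)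
qed

lemma elem_sym_card: "finite A \<Longrightarrow> elem_sym (card A) A f = prod f A"
proof -
  assume A: "finite A"
  have "{J. J \<subseteq> A \<and> card J = card A} = {A}"
    using A by (auto dest: card_subset_eq)
  then show ?thesis by (simp add: elem_sym_def)
qed

text \<open>Expand over the set J of those factors that contribute f, then group the sets J by
  cardinality.\<close>

lemma prod_add_const:
  fixes f :: "'i \<Rightarrow> 'a :: comm_ring_1"
  assumes A: "finite A"
  shows "(\<Prod>i\<in>A. f i + c) = (\<Sum>l\<le>card A. elem_sym l A f * c ^ (card A - l))"
proof -
  have "(\<Prod>i\<in>A. f i + c) = (\<Sum>J\<in>Pow A. prod f J * c ^ card (A - J))"
    using A by (simp add: prod_add)
  also have "\<dots> = (\<Sum>J\<in>Pow A. prod f J * c ^ (card A - card J))"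
    using A by (intro sum.cong refl) (auto simp: card_Diff_subset finite_subset)
  also have "\<dots> = (\<Sum>l\<le>card A. \<Sum>J\<in>{J \<in> Pow A. card J = l}. prod f J * c ^ (card A - card J))"
    using A by (intro sum.group [symmetric]) (auto simp: card_mono)
  also have "\<dots> = (\<Sum>l\<le>card A. elem_sym l A f * c ^ (card A - l))"
    by (intro sum.cong refl) (auto simp: elem_sym_def sum_distrib_right intro!: sum.cong)
  finally show ?thesis .
qed

lemma elem_sym_scale:
  fixes f :: "'i \<Rightarrow> 'a :: comm_ring_1"
  shows "elem_sym l A (\<lambda>i. f i * c) = elem_sym l A f * c ^ l"
  by (auto simp: elem_sym_def sum_distrib_right prod.distrib intro!: sum.cong)

lemma prod_one_plus:
  fixes f :: "'i \<Rightarrow> 'a :: comm_ring_1"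
  assumes "finite A"
  shows "(\<Prod>i\<in>A. 1 + f i * c) = (\<Sum>l\<le>card A. elem_sym l A f * c ^ l)"
  using prod_add_const[OF assms, of "\<lambda>i. f i * c" 1] by (simp add: elem_sym_scale add.commute)

text \<open>Vieta: the required values are the negated roots of a monic polynomial with coefficients
  \<open>z 1\<close>, ..., \<open>z r\<close>.\<close>

lemma exists_elem_sym:
  fixes z :: "nat \<Rightarrow> 'k :: alg_closed_field"
  shows "\<exists>\<zeta>. \<forall>l\<in>{1..r}. elem_sym l {1..r} \<zeta> = z l"
proof -
  \<comment> \<open>The polynomial is u^r + z 1 u^(r-1) + ... + z r, so u^k has coefficient z (r -
    k), except that the leading one is 1.\<close>
  define c where "c k = (if k = r then 1 else z (r - k))" for k
  define p where "p = (\<Sum>k\<le>r. Polynomial.monom (c k) k)"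
  have coeff_p: "Polynomial.coeff p k = (if k \<le> r then c k else 0)" for k
    by (simp add: p_def Polynomial.coeff_sum)
  have deg: "Polynomial.degree p = r"
    by (rule antisym; intro Polynomial.degree_le Polynomial.le_degree) (auto simp: coeff_p c_def)
  have "p \<noteq> 0" using coeff_p[of r] by (auto simp: c_def)
  then obtain A where A: "size A = r" "p = (\<Prod>x\<in>#A. [:- x, 1:])"
    using alg_closed_imp_factorization[of p] coeff_p[of r] by (auto simp: deg c_def)
  obtain xs where xs: "mset xs = A" using ex_mset by blast
  then have len: "length xs = r" using A by auto
  \<comment> \<open>The negation makes p a product of factors u + \<zeta> m, free of signs. List
    positions start at 0, the index m at 1.\<close>
  define \<zeta> where "\<zeta> m = - xs ! (m - 1)" for m
  have "p = (\<Prod>m<r. [:- xs ! m, 1:])"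
    unfolding A(2) xs [symmetric]
    by (simp add: prod_mset_prod_list prod.list_conv_set_nth len atLeast0LessThan flip: mset_map)
  also have "\<dots> = (\<Prod>m\<in>{1..r}. [:\<zeta> m, 1:])"
    by (rule prod.reindex_bij_witness[of _ "\<lambda>m. m - 1" Suc]) (auto simp: \<zeta>_def)
  also have "\<dots> = (\<Prod>m\<in>{1..r}. [:\<zeta> m:] + Polynomial.monom 1 1)"
    by (simp add: Polynomial.monom_altdef)
  also have "\<dots> = (\<Sum>l\<le>r. elem_sym l {1..r} (\<lambda>m. [:\<zeta> m:]) * Polynomial.monom 1 1 ^ (r - l))"
    by (simp add: prod_add_const)
  also have "\<dots> = (\<Sum>l\<le>r. Polynomial.monom (elem_sym l {1..r} \<zeta>) (r - l))"
  proof (intro sum.cong refl)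
    fix l
    interpret C: type_hom "\<lambda>a :: 'k. [:a:]" by unfold_locales (auto simp: one_pCons)
    show "elem_sym l {1..r} (\<lambda>m. [:\<zeta> m:]) * Polynomial.monom 1 1 ^ (r - l) =
        Polynomial.monom (elem_sym l {1..r} \<zeta>) (r - l)"
      by (simp add: C.hom_elem_sym [symmetric] Polynomial.monom_power Polynomial.smult_monom)
  qed
  finally have p: "p = (\<Sum>l\<le>r. Polynomial.monom (elem_sym l {1..r} \<zeta>) (r - l))" .
  have "elem_sym l {1..r} \<zeta> = z l" if l: "l \<in> {1..r}" for l
  proof -
    have "Polynomial.coeff p (r - l) = (\<Sum>m\<le>r. if m = l then elem_sym m {1..r} \<zeta> else 0)"
      unfolding p Polynomial.coeff_sum using l by (intro sum.cong refl) auto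
    moreover have "r - l \<noteq> r" using l by auto
    ultimately show ?thesis using l by (simp add: coeff_p c_def)
  qed
  then show ?thesis by blast
qed


section \<open>Group rings\<close>

lemma gr_mult: "gr (p * q) = gr p * gr q"
  by (simp add: gr_def mult_single plus_expo_def)

lemma gr_one [simp]: "gr 1 = 1"
  by (simp add: gr_def flip: zero_expo_def)

lemma gr_prod: "gr (prod f A) = (\<Prod>i\<in>A. gr (f i))"
  by (induction A rule: infinite_finite_induct) (auto simp: gr_mult)

lemma gr_nonzero: "gr p \<noteq> 0"
  by (metis gr_def lookup_single_eq lookup_zero one_neq_zero)

lemma gr_eq_iff [simp]: "gr p = gr q \<longleftrightarrow> p = q"
proof
  assume "gr p = gr q"
  then have "Poly_Mapping.lookup (gr p) (Expo q) = 1" by (simp add: gr_def)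
  then show "p = q" by (auto simp: gr_def lookup_single when_def split: if_splits)
qed simp

lemma of_int_mult_gr: "of_int n * gr p = Poly_Mapping.single (Expo p) n"
proof -
  have "of_int n * gr p = Poly_Mapping.single 0 n * Poly_Mapping.single (Expo p) 1"
    by (metis gr_def id_apply of_int_eq_id single_of_int)
  then show ?thesis by (simp add: mult_single)
qed

lemma group_ring_sum:
  "c = (\<Sum>a\<in>Poly_Mapping.keys c. of_int (Poly_Mapping.lookup c a) * gr (expo_base a))"
  by (simp add: of_int_mult_gr lookup_sum_single)

lemma type_hom_s_const: "type_hom (s_const :: 'p :: semifield group_ring \<Rightarrow> ('p, 'd :: linorder) srat)"
  by unfold_locales (simp_all add: s_const_def single_add mult_single flip: to_fract_add to_fract_mult)

lemma to_fract_inject: "to_fract a = to_fract b \<longleftrightarrow> a = b"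
  by simp

lemma s_const_eq_iff: "s_const a = s_const b \<longleftrightarrow> a = b"
  unfolding s_const_def to_fract_inject by (metis lookup_single_eq)

lemma rat_of_pbar_power: "rat_of_pbar (p ^ n) = rat_of_pbar p ^ n"
  by (induction n) (auto simp: one_pbar.rep_eq times_pbar.rep_eq)

lemma rat_of_pbar_prod: "rat_of_pbar (prod f A) = (\<Prod>i\<in>A. rat_of_pbar (f i))"
  by (induction A rule: infinite_finite_induct) (auto simp: one_pbar.rep_eq times_pbar.rep_eq)

lemma rat_of_pbar_nonzero: "rat_of_pbar p \<noteq> 0"
  using pbar_set_nonzero rat_of_pbar by blast

lemma inP_mult: "inP (p * q) = inP p * inP q"
  using type_hom.hom_mult[OF type_hom_s_const]
  by (simp add: rat_of_pbar_inject [symmetric] inP.rep_eq times_pbar.rep_eq gr_mult)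

lemma inP_one [simp]: "inP 1 = 1"
  using type_hom.hom_one[OF type_hom_s_const]
  by (simp add: rat_of_pbar_inject [symmetric] inP.rep_eq one_pbar.rep_eq)

lemma inP_power: "inP (p ^ n) = inP p ^ n"
  by (induction n) (auto simp: inP_mult)

lemma inP_eq_iff [simp]: "inP p = inP q \<longleftrightarrow> p = q"
  by (simp add: rat_of_pbar_inject [symmetric] inP.rep_eq s_const_eq_iff)

lemma type_hom_inZP: "type_hom (inZP :: 'p :: semifield group_ring \<Rightarrow> ('p, 'd :: linorder) pbar group_ring)"
proof -
  have eq: "inZP = (lin of_int (\<lambda>a. gr (inP (expo_base a))) ::
      'p group_ring \<Rightarrow> ('p, 'd) pbar group_ring)"
    by (simp add: fun_eq_iff inZP_def lin_def)
  have "type_hom (of_int :: int \<Rightarrow> ('p, 'd) pbar group_ring)" by unfold_locales auto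
  then show ?thesis
    unfolding eq by (intro type_hom_lin) (auto simp: zero_expo_def plus_expo_def inP_mult gr_mult)
qed

lemma inZP_gr: "inZP (gr p) = gr (inP p)"
  by (simp add: inZP_def gr_def)

text \<open>Distinct basis elements go to distinct basis elements because \<open>inP\<close> is
  injective, so each coefficient of c can be read off from its image.\<close>

lemma inj_inZP: "inZP c = 0 \<Longrightarrow> c = 0"
proof (rule poly_mapping_eqI)
  fix a
  assume 0: "inZP c = (0 :: ('a, 'b) pbar group_ring)"
  have "Poly_Mapping.lookup (inZP c :: ('a, 'b) pbar group_ring) (Expo (inP (expo_base a))) =
    (\<Sum>b\<in>Poly_Mapping.keys c. if b = a then Poly_Mapping.lookup c b else 0)"
    unfolding inZP_def of_int_mult_gr lookup_sum
    by (intro sum.cong) (auto simp: lookup_single when_def expo.expand)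
  then show "Poly_Mapping.lookup c a = Poly_Mapping.lookup 0 a"
    using 0 by (auto simp: in_keys_iff split: if_splits)
qed

interpretation pi0: partial_hom "{0 :: int ..}" "\<lambda>n. of_nat (nat n)" UNIV
  "\<lambda>a :: 'p :: semifield expo. Nz (expo_base a)"
  by unfold_locales
    (auto simp: nat_add_distrib nat_mult_distrib zero_expo_def plus_expo_def one_with_zero_def)

lemma pi0_lin: "pi0 = lin (\<lambda>n. of_nat (nat n)) (\<lambda>a. Nz (expo_base a))"
  by (simp add: fun_eq_iff pi0_def lin_def)

lemma pi0_dom: "pi0.dom = NP"
  by (auto simp: pi0.dom_def NP_def)

lemma pi0_add: "f \<in> NP \<Longrightarrow> g \<in> NP \<Longrightarrow> pi0 (f + g) = pi0 f + pi0 g"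
  unfolding pi0_lin by (rule pi0.lin_add) (auto simp: pi0_dom)

lemma pi0_mult: "f \<in> NP \<Longrightarrow> g \<in> NP \<Longrightarrow> pi0 (f * g) = pi0 f * pi0 g"
  unfolding pi0_lin by (rule pi0.lin_mult) (auto simp: pi0_dom)

lemma pi0_zero [simp]: "pi0 0 = 0"
  by (simp add: pi0_def)

lemma pi0_gr [simp]: "pi0 (gr p) = Nz p"
  by (simp add: pi0_def gr_def)

lemma pi0_one [simp]: "pi0 1 = 1"
  using pi0_gr[of 1] by (simp add: one_with_zero_def)

lemma gr_NP: "gr p \<in> NP"
  by (auto simp: NP_def gr_def lookup_single when_def)


lemma NPs_single: "c \<in> NP \<Longrightarrow> Poly_Mapping.single \<alpha> c \<in> NPs"
  by (auto simp: NPs_def lookup_single when_def NP_zero)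


section \<open>Homomorphisms out of the extended semifield\<close>

text \<open>The data at the initial vertex, on which S, psi and psihat depend: x is the composite
  cluster and Z are the exchange polynomials there. Mutations enter only later.\<close>

locale composite_base =
  fixes r :: "'n :: finite \<Rightarrow> nat"
    and D :: "'n \<Rightarrow> nat \<Rightarrow> 'd :: {finite, linorder}"
    and \<kappa> :: "('p :: semifield, 'd) pbar qfield \<Rightarrow> 'g :: field"
    and x :: "'d \<Rightarrow> 'g"
    and Z :: "'n \<Rightarrow> 'p group_ring poly"
  assumes r_pos: "1 \<le> r i"
    and D: "bij_betw (\<lambda>(i, l). D i l) {(i, l). 1 \<le> l \<and> l \<le> r i} UNIV"
    and kappa: "type_hom \<kappa>"
    and free: "free_generating \<kappa> x"
    and Z_degree: "Polynomial.degree (Z i) = r i"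
    and Z_0: "Polynomial.coeff (Z i) 0 = 1"
    and Z_r: "Polynomial.coeff (Z i) (r i) = 1"
begin

sublocale \<kappa>: field_hom \<kappa>
  by (simp add: field_hom_iff kappa)

definition ix :: "'d \<Rightarrow> 'n" where
  "ix d = fst (inv_into {(i, l). 1 \<le> l \<and> l \<le> r i} (\<lambda>(i, l). D i l) d)"

definition lx :: "'d \<Rightarrow> nat" where
  "lx d = snd (inv_into {(i, l). 1 \<le> l \<and> l \<le> r i} (\<lambda>(i, l). D i l) d)"

lemma ix_D [simp]: "1 \<le> l \<Longrightarrow> l \<le> r i \<Longrightarrow> ix (D i l) = i"
  and lx_D [simp]: "1 \<le> l \<Longrightarrow> l \<le> r i \<Longrightarrow> lx (D i l) = l"
  using bij_betw_inv_into_left[OF D, of "(i, l)"] by (auto simp: ix_def lx_def)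

lemma D_ix_lx [simp]: "D (ix d) (lx d) = d"
  and lx_ge: "1 \<le> lx d" and lx_le: "lx d \<le> r (ix d)"
proof -
  let ?A = "{(i, l). 1 \<le> l \<and> l \<le> r i}"
  have "d \<in> (\<lambda>(i, l). D i l) ` ?A" using bij_betw_imp_surj_on[OF D] by auto
  from inv_into_into[OF this] f_inv_into_f[OF this]
  show "D (ix d) (lx d) = d" "1 \<le> lx d" "lx d \<le> r (ix d)"
    by (auto simp: ix_def lx_def split: prod.splits)
qed

lemma prod_D: "(\<Prod>d\<in>UNIV. f d) = (\<Prod>i\<in>UNIV. \<Prod>l\<in>{1..r i}. f (D i l))"
proof -
  have *: "{(i, l). 1 \<le> l \<and> l \<le> r i} = Sigma UNIV (\<lambda>i. {1..r i})" by auto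
  show ?thesis
    using prod.reindex_bij_betw[OF D, of f, symmetric] unfolding *
    by (simp add: prod.Sigma case_prod_unfold)
qed

definition emb :: "'p group_ring \<Rightarrow> 'g" where
  "emb c = \<kappa> (to_fract (inZP c))"

sublocale emb: type_hom emb
  unfolding emb_def
  by (intro type_hom_compose[OF kappa] type_hom_compose[OF type_hom_to_fract] type_hom_inZP)

lemma emb_gr: "emb (gr p) = embP \<kappa> (inP p)"
  by (simp add: emb_def inZP_gr)

text \<open>Mapping the coefficients by \<phi> yields a polynomial relation between free generators.
  The parameter \<phi> allows coefficients from both group rings and from the smaller fraction
  field.\<close>

lemma lin_free:
  assumes \<phi>: "type_hom \<phi>" and inj: "\<And>b. \<phi> b = 0 \<Longrightarrow> b = 0" and 0: "lin (\<lambda>b. \<kappa> (\<phi> b)) (mon x) F = 0"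
  shows "F = 0"
proof -
  interpret \<phi>: type_hom \<phi> by fact
  have "poly_eval \<kappa> x (Poly_Mapping.map \<phi> F) = 0"
    unfolding poly_eval_lin using 0 by (simp add: lin_map)
  then have "Poly_Mapping.map \<phi> F = 0" using free by (auto simp: free_generating_def)
  then have "\<phi> (Poly_Mapping.lookup F \<alpha>) = 0" for \<alpha>
    by (cases "\<alpha> \<in> Poly_Mapping.keys F") (auto simp: map_eq_zero_iff in_keys_iff)
  then show ?thesis using inj by (auto intro!: poly_mapping_eqI)
qed

lemma emb_free: "lin emb (mon x) F = 0 \<Longrightarrow> F = 0"
  unfolding emb_def
  by (rule lin_free[OF type_hom_compose[OF type_hom_to_fract type_hom_inZP]]) (auto dest: inj_inZP)

lemma x_free: "mon x \<alpha> = mon x \<beta> \<Longrightarrow> \<alpha> = \<beta>"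
proof (rule ccontr)
  assume *: "mon x \<alpha> = mon x \<beta>" "\<alpha> \<noteq> \<beta>"
  let ?F = "Poly_Mapping.single \<alpha> 1 - Poly_Mapping.single \<beta> 1 :: ('d \<Rightarrow>\<^sub>0 nat) \<Rightarrow>\<^sub>0 'p group_ring"
  have "type_hom (lin emb (mon x))" by (rule type_hom_lin_mon) unfold_locales
  then have "lin emb (mon x) ?F = 0"
    using * by (simp add: type_hom.hom_diff lin_single)
  then have "Poly_Mapping.lookup ?F \<alpha> = 0" using emb_free by fastforce
  then show False using * by (simp add: lookup_minus lookup_single when_def)
qed

definition e_poly :: "'n \<Rightarrow> nat \<Rightarrow> ('p, 'd) spoly" where
  "e_poly i l = elem_sym l {1..r i} (\<lambda>m. Poly_Mapping.single (Poly_Mapping.single (D i m) 1) 1)"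

lemma e_elem_poly: "e_elem r D i l = to_fract (e_poly i l)"
  by (simp only: e_elem_def e_poly_def s_var_def type_hom.hom_elem_sym[OF type_hom_to_fract])

text \<open>The substitution of elementary symmetric polynomials for variables. The type
  \<open>'d\<close> indexes the new variables as well as the old ones, since the family of i has as
  many e_il as s_il.\<close>

definition evE :: "(('d \<Rightarrow>\<^sub>0 nat) \<Rightarrow>\<^sub>0 'p group_ring) \<Rightarrow> ('p, 'd) spoly" where
  "evE = lin (Poly_Mapping.single 0) (mon (\<lambda>d. e_poly (ix d) (lx d)))"

sublocale evE: type_hom evE
  unfolding evE_def
  by (rule type_hom_lin_mon) (unfold_locales; simp add: single_add mult_single)

lemma lin_e_poly:
  assumes "type_hom \<phi>"
  shows "lin \<phi> (mon \<zeta>) (e_poly i l) = elem_sym l {1..r i} (\<lambda>m. \<zeta> (D i m))"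
proof -
  interpret \<phi>: type_hom \<phi> by fact
  show ?thesis
    unfolding e_poly_def type_hom.hom_elem_sym[OF type_hom_lin_mon[OF assms]]
    by (simp add: lin_single)
qed

text \<open>Serves two purposes: with prescribed values of the symmetric functions it gives their
  algebraic independence, and with permuted generators it expresses the symmetry of the elements of
  NP[e].\<close>

lemma lin_evE:
  assumes \<phi>: "type_hom \<phi>"
  shows "lin \<phi> (mon \<zeta>) (evE F) =
    lin \<phi> (mon (\<lambda>d. elem_sym (lx d) {1..r (ix d)} (\<lambda>m. \<zeta> (D (ix d) m)))) F"
  unfolding evE_def type_hom.hom_lin[OF type_hom_lin_mon[OF \<phi>]]
    type_hom.hom_mon[OF type_hom_lin_mon[OF \<phi>]] lin_e_poly[OF \<phi>]
  by (simp add: lin_single type_hom.hom_zero[OF \<phi>])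

lemma exists_families_elem_sym:
  fixes z :: "'d \<Rightarrow> 'k :: alg_closed_field"
  shows "\<exists>\<zeta>. \<forall>d. elem_sym (lx d) {1..r (ix d)} (\<lambda>m. \<zeta> (D (ix d) m)) = z d"
proof -
  have "\<forall>i. \<exists>\<zeta>. \<forall>l\<in>{1..r i}. elem_sym l {1..r i} \<zeta> = z (D i l)"
    by (rule allI exists_elem_sym)+
  from choice[OF this] obtain \<zeta>
    where \<zeta>: "\<And>i l. l \<in> {1..r i} \<Longrightarrow> elem_sym l {1..r i} (\<zeta> i) = z (D i l)"
    by blast
  have "elem_sym (lx d) {1..r (ix d)} (\<lambda>m. \<zeta> (ix (D (ix d) m)) (lx (D (ix d) m))) = z d" for d
  proof -
    have "elem_sym (lx d) {1..r (ix d)} (\<lambda>m. \<zeta> (ix (D (ix d) m)) (lx (D (ix d) m))) =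
        elem_sym (lx d) {1..r (ix d)} (\<zeta> (ix d))"
      unfolding elem_sym_def by (intro sum.cong prod.cong refl) auto
    then show ?thesis using \<zeta>[of "lx d" "ix d"] lx_ge lx_le by simp
  qed
  then show ?thesis by (intro exI[of _ "\<lambda>d. \<zeta> (ix d) (lx d)"]) blast
qed

text \<open>
  The elementary symmetric polynomials are algebraically independent: over an algebraically closed
  field they can be given arbitrary values, in particular those of the free generators \<open>x\<close>.
\<close>

lemma evE_inj: "evE F = 0 \<Longrightarrow> F = 0"
proof -
  assume 0: "evE F = 0"
  obtain \<zeta> where \<zeta>: "\<And>d. elem_sym (lx d) {1..r (ix d)} (\<lambda>m. \<zeta> (D (ix d) m)) = to_ac (x d)"
    using exists_families_elem_sym[of "\<lambda>d. to_ac (x d)"] by blast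
  let ?\<phi> = "\<lambda>c. to_ac (emb c)"
  have \<phi>: "type_hom ?\<phi>" by (rule type_hom_compose[OF type_hom_to_ac]) unfold_locales
  have "0 = lin ?\<phi> (mon \<zeta>) (evE F)" using 0 by simp
  also have "\<dots> = lin ?\<phi> (mon (\<lambda>d. to_ac (x d))) F"
    by (simp only: lin_evE[OF \<phi>] \<zeta>)
  also have "\<dots> = to_ac (lin emb (mon x) F)"
    unfolding type_hom.hom_lin[OF type_hom_to_ac] type_hom.hom_mon[OF type_hom_to_ac] ..
  finally show "F = 0" by (simp add: emb_free)
qed

lemma evE_eq_iff: "evE F = evE G \<longleftrightarrow> F = G"
  using evE.inj_homI evE_inj by (auto simp: inj_eq)

text \<open>Together with the injectivity of \<open>evE\<close>, this gives each element of NP[e] a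
  unique expression in the e_il, and one with coefficients in \<open>NP\<close>, where
  \<open>pi0\<close> is additive.\<close>

lemma NPe_evE: "f \<in> NPe r D \<Longrightarrow> \<exists>F\<in>NPs. f = to_fract (evE F)"
proof (induction rule: NPe.induct)
  case (const c)
  then have "s_const c = to_fract (evE (Poly_Mapping.single 0 c))" "Poly_Mapping.single 0 c \<in> NPs"
    by (auto simp: s_const_def evE_def lin_single NPs_single)
  then show ?case by blast
next
  case (elem l i)
  then have "e_elem r D i l = to_fract (evE (Poly_Mapping.single (Poly_Mapping.single (D i l) 1) 1))"
    by (simp add: e_elem_poly evE_def lin_single)
  then show ?case using NPs_single NP_one by blast
next
  case (add f g)
  then obtain F G where "F \<in> NPs" "f = to_fract (evE F)" "G \<in> NPs" "g = to_fract (evE G)"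
    by blast
  then show ?case
    by (intro bexI[of _ "F + G"]) (simp_all add: evE.hom_add NPs_add)
next
  case (mult f g)
  then obtain F G where "F \<in> NPs" "f = to_fract (evE F)" "G \<in> NPs" "g = to_fract (evE G)"
    by blast
  then show ?case
    by (intro bexI[of _ "F * G"]) (simp_all add: evE.hom_mult NPs_mult)
qed

text \<open>Take the unique expression of the argument as a polynomial in the e_il, apply
  \<open>pi0\<close> to its coefficients and replace e_il by the prescribed value. Without algebraic
  independence this would depend on the expression.\<close>

lemma psi0_exists:
  "\<exists>h :: ('p, 'd) srat \<Rightarrow> 'p with_zero.
    (\<forall>f\<in>NPe r D. \<forall>g\<in>NPe r D. h (f + g) = h f + h g \<and> h (f * g) = h f * h g) \<and>
    (\<forall>c\<in>NP. h (s_const c) = pi0 c) \<and>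
    (\<forall>i. \<forall>l\<in>{1..r i}. h (e_elem r D i l) = pi0 (Polynomial.coeff (Z i) l))"
proof -
  define rep where "rep f = (THE F. f = to_fract (evE F))" for f
  have rep: "rep (to_fract (evE F)) = F" for F
    unfolding rep_def by (rule the_equality) (auto simp: evE_eq_iff)
  let ?\<chi> = "mon (\<lambda>d. pi0 (Polynomial.coeff (Z (ix d)) (lx d)))"
  interpret H: partial_hom NP pi0 UNIV ?\<chi>
    by unfold_locales (auto simp: NP_zero NP_one NP_add NP_mult pi0_add pi0_mult mon_add)
  have dom: "H.dom = NPs" by (auto simp: H.dom_def NPs_def)
  define h where "h f = lin pi0 ?\<chi> (rep f)" for f
  have h: "h (to_fract (evE F)) = lin pi0 ?\<chi> F" for F
    by (simp add: h_def rep)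
  show ?thesis
  proof (intro exI[of _ h] conjI ballI allI)
    fix f g :: "('p, 'd) srat" assume "f \<in> NPe r D" "g \<in> NPe r D"
    then obtain F G where FG: "F \<in> NPs" "f = to_fract (evE F)" "G \<in> NPs" "g = to_fract (evE G)"
      using NPe_evE by metis
    have "f + g = to_fract (evE (F + G))" "f * g = to_fract (evE (F * G))"
      by (simp_all add: FG evE.hom_add evE.hom_mult)
    then show "h (f + g) = h f + h g" "h (f * g) = h f * h g"
      using FG by (simp_all add: h H.lin_add H.lin_mult dom del: to_fract_add to_fract_mult)
  next
    fix c :: "'p group_ring"
    have "s_const c = to_fract (evE (Poly_Mapping.single 0 c))"
      by (simp add: s_const_def evE_def lin_single)
    then show "h (s_const c) = pi0 c" by (simp add: h lin_single)
  next
    fix i l assume l: "l \<in> {1..r i}"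
    then have "e_elem r D i l = to_fract (evE (Poly_Mapping.single (Poly_Mapping.single (D i l) 1) 1))"
      by (simp add: e_elem_poly evE_def lin_single)
    then show "h (e_elem r D i l) = pi0 (Polynomial.coeff (Z i) l)"
      using l by (simp add: h lin_single)
  qed
qed

lemma psi0_spec:
  "(\<forall>f\<in>NPe r D. \<forall>g\<in>NPe r D. psi0 r D Z (f + g) = psi0 r D Z f + psi0 r D Z g \<and>
      psi0 r D Z (f * g) = psi0 r D Z f * psi0 r D Z g) \<and>
    (\<forall>c\<in>NP. psi0 r D Z (s_const c) = pi0 c) \<and>
    (\<forall>i. \<forall>l\<in>{1..r i}. psi0 r D Z (e_elem r D i l) = pi0 (Polynomial.coeff (Z i) l))"
  unfolding psi0_def by (rule someI_ex[OF psi0_exists])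

end


section \<open>Arithmetic in a semifield, with and without zero adjoined\<close>

lemma with_zero_nonzero: "w \<noteq> 0 \<Longrightarrow> \<exists>a. w = Nz a"
  by (cases w) (auto simp: zero_with_zero_def)

lemma Nz_nonzero [simp]: "Nz a \<noteq> 0"
  by (simp add: zero_with_zero_def)

lemma with_zero_add_nonzero: "(v :: 'p :: semifield with_zero) \<noteq> 0 \<Longrightarrow> v + w \<noteq> 0"
  by (cases v; cases w) (auto simp: zero_with_zero_def)

lemma Nz_power: "Nz p ^ n = Nz (p ^ n)"
  by (induction n) (auto simp: one_with_zero_def)

lemma semifield_divide_one [simp]: "(a :: 'p :: semifield) / 1 = a"
  by (simp add: semifield_divide_inverse semifield_inverse_one)

lemma semifield_divide_mult: "(a :: 'p :: semifield) / b * (c / d) = (a * c) / (b * d)"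
  by (simp add: semifield_divide_inverse semifield_inverse_mult mult_ac)

lemma semifield_inverse_divide: "inverse ((a :: 'p :: semifield) / b) = b / a"
  by (simp add: semifield_divide_inverse semifield_inverse_mult semifield_inverse_inverse mult_ac)

lemma semifield_divide_eq_iff: "(a :: 'p :: semifield) / b = c / d \<longleftrightarrow> a * d = c * b"
proof -
  have "(a / b) * (b * d) = a * d" "(c / d) * (b * d) = c * b"
    by (simp_all add: semifield_divide_inverse mult_ac)
      (metis mult.assoc mult.commute mult_1_right semifield_left_inverse)+
  then show ?thesis by (metis semifield_cancel)
qed

lemma semifield_mult_divide_cancel: "(a * c :: 'p :: semifield) / a = c"
  using semifield_divide_eq_iff[of "a * c" a c 1] by (simp add: mult_ac)

lemma elem_sym_full: "elem_sym n {1..n} f = prod f {1..n}"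
  using elem_sym_card[of "{1..n}" f] by simp

text \<open>The image under \<pi> permutes the subsets of each size. An involution is its own
  inverse and so gives both directions of the bijection; it is applied to the exchange of two
  members of a family.\<close>

lemma elem_sym_involution:
  assumes "\<And>m. m \<in> A \<Longrightarrow> \<pi> m \<in> A" "\<And>m. m \<in> A \<Longrightarrow> \<pi> (\<pi> m) = m"
  shows "elem_sym l A (\<lambda>m. f (\<pi> m)) = elem_sym l A f"
proof -
  have inj: "inj_on \<pi> A" using assms(2) by (metis inj_onI)
  have img: "\<pi> ` \<pi> ` J = J" if "J \<subseteq> A" for J
    using that assms(2) by (force simp: image_image)
  have sub: "\<pi> ` J \<subseteq> A" "card (\<pi> ` J) = card J" if "J \<subseteq> A" for J
    using that assms(1) inj by (auto intro: card_image inj_on_subset)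
  have *: "(\<Prod>m\<in>\<pi> ` J. f m) = (\<Prod>m\<in>J. f (\<pi> m))" if "J \<subseteq> A" for J
    using prod.reindex[of \<pi> J f] that inj by (simp add: inj_on_subset)
  show ?thesis
    unfolding elem_sym_def
    by (rule sum.reindex_bij_witness[of _ "image \<pi>" "image \<pi>"])
      (auto simp: img sub * intro: subsetD[OF sub(1)])
qed

section \<open>The semifield S and the homomorphism psi\<close>

context composite_base
begin

lemma psi0_add: "f \<in> NPe r D \<Longrightarrow> g \<in> NPe r D \<Longrightarrow> psi0 r D Z (f + g) = psi0 r D Z f + psi0 r D Z g"
  and psi0_mult: "f \<in> NPe r D \<Longrightarrow> g \<in> NPe r D \<Longrightarrow> psi0 r D Z (f * g) = psi0 r D Z f * psi0 r D Z g"
  and psi0_const: "c \<in> NP \<Longrightarrow> psi0 r D Z (s_const c) = pi0 c"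
  and psi0_elem: "1 \<le> l \<Longrightarrow> l \<le> r i \<Longrightarrow> psi0 r D Z (e_elem r D i l) = pi0 (Polynomial.coeff (Z i) l)"
  using psi0_spec by auto

lemma NPe_zero: "0 \<in> NPe r D" and psi0_zero [simp]: "psi0 r D Z 0 = 0"
  using NPe.const[OF NP_zero, of r D] psi0_const[OF NP_zero]
  by (simp_all add: type_hom.hom_zero[OF type_hom_s_const])

lemma NPe_one: "1 \<in> NPe r D" and psi0_one [simp]: "psi0 r D Z 1 = 1"
  using NPe.const[OF NP_one, of r D] psi0_const[OF NP_one]
  by (simp_all add: type_hom.hom_one[OF type_hom_s_const])

lemma e_elem_0: "e_elem r D i 0 = 1"
  by (simp add: e_elem_def)

lemma NPe_power: "f \<in> NPe r D \<Longrightarrow> f ^ n \<in> NPe r D"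
  and psi0_power: "f \<in> NPe r D \<Longrightarrow> psi0 r D Z (f ^ n) = psi0 r D Z f ^ n"
proof -
  assume f: "f \<in> NPe r D"
  show 1: "f ^ n \<in> NPe r D" for n by (induction n) (auto simp: NPe_one f NPe.mult)
  show "psi0 r D Z (f ^ n) = psi0 r D Z f ^ n" by (induction n) (auto simp: f 1 psi0_mult)
qed

lemma NPe_sum: "(\<And>l. l \<in> A \<Longrightarrow> f l \<in> NPe r D) \<Longrightarrow> sum f A \<in> NPe r D"
  by (induction A rule: infinite_finite_induct) (auto simp: NPe_zero NPe.add)

lemma psi0_sum: "(\<And>l. l \<in> A \<Longrightarrow> f l \<in> NPe r D) \<Longrightarrow> psi0 r D Z (sum f A) = (\<Sum>l\<in>A. psi0 r D Z (f l))"
  by (induction A rule: infinite_finite_induct) (auto simp: NPe_sum psi0_add)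

text \<open>Two expressions f / g = f' / g' of p give f g' = f' g inside NP[e], and
  \<open>psi0\<close> turns this into a b' = a' b, so the value is independent of the expression.
  The denominators are nonzero because division by 0 would make the quotient 0, a value that
  \<open>rat_of_pbar\<close> never takes.\<close>

lemma SS_psi:
  assumes f: "f \<in> NPe r D" "psi0 r D Z f = Nz a" and g: "g \<in> NPe r D" "psi0 r D Z g = Nz b"
    and p: "rat_of_pbar p = f / g"
  shows SSI: "p \<in> SS r D Z" and psi_eq: "psi r D Z p = a / b"
proof -
  show "p \<in> SS r D Z" using assms by (force simp: SS_def)
  have "v = a / b" if *: "f' \<in> NPe r D" "g' \<in> NPe r D" "psi0 r D Z f' \<noteq> 0" "psi0 r D Z g' \<noteq> 0"
    "rat_of_pbar p = f' / g'" "v = unNz (psi0 r D Z f') / unNz (psi0 r D Z g')" for f' g' v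
  proof -
    obtain a' b' where ab: "psi0 r D Z f' = Nz a'" "psi0 r D Z g' = Nz b'"
      using with_zero_nonzero[OF *(3)] with_zero_nonzero[OF *(4)] by blast
    have "f / g = f' / g'" "g \<noteq> 0" "g' \<noteq> 0"
      using p * rat_of_pbar_nonzero[of p] by auto
    then have "f * g' = f' * g" by (simp add: field_simps)
    then have "psi0 r D Z (f * g') = psi0 r D Z (f' * g)" by simp
    then have "a * b' = a' * b" using f g * ab by (simp add: psi0_mult)
    then show ?thesis using * ab by (simp add: semifield_divide_eq_iff)
  qed
  note uniq = this
  show "psi r D Z p = a / b"
    unfolding psi_def
  proof (rule the_equality)
    show "\<exists>f\<in>NPe r D. \<exists>g\<in>NPe r D. psi0 r D Z f \<noteq> 0 \<and> psi0 r D Z g \<noteq> 0 \<and>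
        rat_of_pbar p = f / g \<and> a / b = unNz (psi0 r D Z f) / unNz (psi0 r D Z g)"
      using assms by (intro bexI[of _ f] bexI[of _ g]) auto
  qed (blast intro: uniq)
qed

lemma SSE:
  assumes "p \<in> SS r D Z"
  obtains f g a b where "f \<in> NPe r D" "psi0 r D Z f = Nz a" "g \<in> NPe r D" "psi0 r D Z g = Nz b"
    "rat_of_pbar p = f / g" "psi r D Z p = a / b"
proof -
  obtain f g where *: "f \<in> NPe r D" "g \<in> NPe r D" "psi0 r D Z f \<noteq> 0" "psi0 r D Z g \<noteq> 0"
    "rat_of_pbar p = f / g"
    using assms by (auto simp: SS_def)
  obtain a b where "psi0 r D Z f = Nz a" "psi0 r D Z g = Nz b"
    using with_zero_nonzero[OF *(3)] with_zero_nonzero[OF *(4)] by blast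
  then show thesis using that[OF *(1) _ *(2) _ *(5) psi_eq] * by blast
qed

lemma SS_mult: "p \<in> SS r D Z \<Longrightarrow> q \<in> SS r D Z \<Longrightarrow> p * q \<in> SS r D Z"
  and psi_mult: "p \<in> SS r D Z \<Longrightarrow> q \<in> SS r D Z \<Longrightarrow> psi r D Z (p * q) = psi r D Z p * psi r D Z q"
proof -
  assume pS: "p \<in> SS r D Z" and qS: "q \<in> SS r D Z"
  obtain f g a b where
    p: "f \<in> NPe r D" "psi0 r D Z f = Nz a" "g \<in> NPe r D" "psi0 r D Z g = Nz b"
      "rat_of_pbar p = f / g" "psi r D Z p = a / b"
    using pS by (rule SSE)
  obtain f' g' a' b' where
    q: "f' \<in> NPe r D" "psi0 r D Z f' = Nz a'" "g' \<in> NPe r D" "psi0 r D Z g' = Nz b'"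
      "rat_of_pbar q = f' / g'" "psi r D Z q = a' / b'"
    using qS by (rule SSE)
  have "rat_of_pbar (p * q) = (f * f') / (g * g')" by (simp add: times_pbar.rep_eq p q)
  from SS_psi[OF _ _ _ _ this, of "a * a'" "b * b'"] p q
  show "p * q \<in> SS r D Z" "psi r D Z (p * q) = psi r D Z p * psi r D Z q"
    by (simp_all add: NPe.mult psi0_mult semifield_divide_mult)
qed

lemma SS_inverse: "p \<in> SS r D Z \<Longrightarrow> inverse p \<in> SS r D Z"
  and psi_inverse: "p \<in> SS r D Z \<Longrightarrow> psi r D Z (inverse p) = inverse (psi r D Z p)"
proof -
  assume "p \<in> SS r D Z"
  then obtain f g a b where
    p: "f \<in> NPe r D" "psi0 r D Z f = Nz a" "g \<in> NPe r D" "psi0 r D Z g = Nz b"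
      "rat_of_pbar p = f / g" "psi r D Z p = a / b"
    by (rule SSE)
  have "rat_of_pbar (inverse p) = g / f" by (simp add: inverse_pbar.rep_eq p)
  from SS_psi[OF p(3,4,1,2) this] p
  show "inverse p \<in> SS r D Z" "psi r D Z (inverse p) = inverse (psi r D Z p)"
    by (simp_all add: semifield_inverse_divide)
qed

lemma SS_inP: "inP p \<in> SS r D Z" and psi_inP [simp]: "psi r D Z (inP p) = p"
  using SS_psi[of "s_const (gr p)" p 1 1 "inP p"]
  by (simp_all add: NPe.const gr_NP psi0_const NPe_one one_with_zero_def inP.rep_eq)

lemma SS_one: "1 \<in> SS r D Z" and psi_one [simp]: "psi r D Z 1 = 1"
  using SS_inP[of 1] psi_inP[of 1] by simp_all

lemma SS_power: "p \<in> SS r D Z \<Longrightarrow> p ^ n \<in> SS r D Z"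
  and psi_power: "p \<in> SS r D Z \<Longrightarrow> psi r D Z (p ^ n) = psi r D Z p ^ n"
proof -
  assume p: "p \<in> SS r D Z"
  show 1: "p ^ n \<in> SS r D Z" for n by (induction n) (auto simp: p SS_one SS_mult)
  show "psi r D Z (p ^ n) = psi r D Z p ^ n" by (induction n) (auto simp: p 1 psi_mult)
qed

lemma SS_powi: "p \<in> SS r D Z \<Longrightarrow> p powi n \<in> SS r D Z"
  and psi_powi: "p \<in> SS r D Z \<Longrightarrow> psi r D Z (p powi n) = psi r D Z p powi n"
  by (auto simp: power_int_def SS_power psi_power SS_inverse psi_inverse)

lemma SS_prod: "(\<And>i. i \<in> A \<Longrightarrow> f i \<in> SS r D Z) \<Longrightarrow> prod f A \<in> SS r D Z"
  and psi_prod: "(\<And>i. i \<in> A \<Longrightarrow> f i \<in> SS r D Z) \<Longrightarrow> psi r D Z (prod f A) = (\<Prod>i\<in>A. psi r D Z (f i))"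
proof -
  show "(\<And>i. i \<in> A \<Longrightarrow> f i \<in> SS r D Z) \<Longrightarrow> prod f A \<in> SS r D Z" for A
    by (induction A rule: infinite_finite_induct) (auto simp: SS_one SS_mult)
  then show "(\<And>i. i \<in> A \<Longrightarrow> f i \<in> SS r D Z) \<Longrightarrow> psi r D Z (prod f A) = (\<Prod>i\<in>A. psi r D Z (f i))"
    by (induction A rule: infinite_finite_induct) (auto simp: psi_mult)
qed

text \<open>The product is the top elementary symmetric polynomial, and its value is the leading
  coefficient of the exchange polynomial.\<close>

lemma SS_prod_svar: "(\<Prod>m\<in>{1..r i}. svar (D i m)) \<in> SS r D Z"
  and psi_prod_svar: "psi r D Z (\<Prod>m\<in>{1..r i}. svar (D i m)) = 1"
proof -
  have "rat_of_pbar (\<Prod>m\<in>{1..r i}. svar (D i m)) = e_elem r D i (r i) / 1"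
    unfolding e_elem_def elem_sym_full by (simp add: rat_of_pbar_prod svar.rep_eq)
  from SS_psi[OF _ _ _ _ this, of 1 1]
  show "(\<Prod>m\<in>{1..r i}. svar (D i m)) \<in> SS r D Z" "psi r D Z (\<Prod>m\<in>{1..r i}. svar (D i m)) = 1"
    using r_pos by (simp_all add: NPe.elem psi0_elem Z_r NPe_one one_with_zero_def)
qed

text \<open>The constant term contributes 1, and a sum with a nonzero summand cannot vanish after
  adjoining zero; hence \<open>unNz\<close> in \<open>Ztrop\<close> is applied to a proper
  value.\<close>

lemma Ztrop_Nz:
  "(\<Sum>l\<le>r i. pi0 (Polynomial.coeff (Z i) l) * Nz y ^ l) = Nz (Ztrop (Z i) y)"
proof -
  have "(\<Sum>l\<le>r i. pi0 (Polynomial.coeff (Z i) l) * Nz y ^ l) \<noteq> 0"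
    by (subst sum.atMost_shift, rule with_zero_add_nonzero) (simp add: Z_0)
  then show ?thesis
    unfolding Ztrop_def Z_degree using with_zero_nonzero by force
qed

text \<open>Reverse the order of summation and take out y^r; this is the semifield version of
  evaluating u^r Z(1/u).\<close>

lemma Ztrop_reflect: "Ztrop (reflect_poly (Z i)) y = y ^ r i * Ztrop (Z i) (inverse y)"
proof -
  \<comment> \<open>The constant term of Z i is nonzero, so reflection keeps the degree and
    \<open>Ztrop\<close> sums over the same range.\<close>
  have deg: "Polynomial.degree (reflect_poly (Z i)) = r i"
    using degree_reflect_poly_eq[of "Z i"] by (simp add: Z_0 Z_degree)
  have "(\<Sum>l\<le>r i. pi0 (Polynomial.coeff (reflect_poly (Z i)) l) * Nz y ^ l) =
      (\<Sum>l\<le>r i. pi0 (Polynomial.coeff (Z i) l) * Nz y ^ (r i - l))"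
    by (rule sum.reindex_bij_witness[of _ "\<lambda>l. r i - l" "\<lambda>l. r i - l"])
      (auto simp: coeff_reflect_poly Z_degree)
  also have "\<dots> = (\<Sum>l\<le>r i. Nz (y ^ r i) * (pi0 (Polynomial.coeff (Z i) l) * Nz (inverse y) ^ l))"
  proof (intro sum.cong refl)
    fix l assume "l \<in> {..r i}"
    then have pow: "y ^ r i = y ^ l * y ^ (r i - l)" by (simp flip: power_add)
    have "y ^ r i * inverse y ^ l = (y ^ l * inverse y ^ l) * y ^ (r i - l)"
      by (simp only: pow mult_ac)
    also have "\<dots> = y ^ (r i - l)"
      by (simp add: semifield_right_inverse flip: semifield_inverse_power)
    finally have "Nz y ^ (r i - l) = Nz (y ^ r i) * Nz (inverse y) ^ l" by (simp add: Nz_power)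
    then show "pi0 (Polynomial.coeff (Z i) l) * Nz y ^ (r i - l) =
        Nz (y ^ r i) * (pi0 (Polynomial.coeff (Z i) l) * Nz (inverse y) ^ l)"
      by (simp only: mult_ac)
  qed
  also have "\<dots> = Nz (y ^ r i * Ztrop (Z i) (inverse y))"
    by (simp add: Ztrop_Nz flip: sum_distrib_left)
  finally show ?thesis by (simp add: Ztrop_def[of "reflect_poly (Z i)"] deg)
qed

text \<open>The product is the sum of the e_il w^l. With w = f / g the common denominator g^r is
  cleared, since membership in S requires a numerator and a denominator in NP[e].\<close>

lemma
  assumes w: "w \<in> SS r D Z"
  shows SS_prod_one_plus: "(\<Prod>m\<in>{1..r i}. 1 + svar (D i m) * w) \<in> SS r D Z"
    and psi_prod_one_plus: "psi r D Z (\<Prod>m\<in>{1..r i}. 1 + svar (D i m) * w) = Ztrop (Z i) (psi r D Z w)"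
proof -
  obtain f g a b where fg: "f \<in> NPe r D" "psi0 r D Z f = Nz a" "g \<in> NPe r D" "psi0 r D Z g = Nz b"
      "rat_of_pbar w = f / g" "psi r D Z w = a / b"
    using w by (rule SSE)
  then have g0: "g \<noteq> 0" by auto
  have e: "(e_elem r D i l :: ('p, 'd) srat) \<in> NPe r D" "psi0 r D Z (e_elem r D i l) = pi0 (Polynomial.coeff (Z i) l)"
    if "l \<le> r i" for l
    using that NPe_one NPe.elem[of l r i D] psi0_elem[of l i]
    by (cases "l = 0"; simp add: e_elem_0 Z_0)+
  define N where "N = (\<Sum>l\<le>r i. e_elem r D i l * f ^ l * g ^ (r i - l))"
  have "rat_of_pbar (\<Prod>m\<in>{1..r i}. 1 + svar (D i m) * w) = (\<Prod>m\<in>{1..r i}. 1 + s_var (D i m) * (f / g))"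
    by (simp add: rat_of_pbar_prod plus_pbar.rep_eq times_pbar.rep_eq one_pbar.rep_eq svar.rep_eq fg)
  also have "\<dots> = (\<Sum>l\<le>r i. e_elem r D i l * (f / g) ^ l)"
    unfolding e_elem_def by (subst prod_one_plus) simp_all
  also have "\<dots> = (\<Sum>l\<le>r i. e_elem r D i l * f ^ l * g ^ (r i - l) / g ^ r i)"
    by (intro sum.cong refl) (simp add: g0 power_divide power_diff)
  also have "\<dots> = N / g ^ r i" by (simp add: N_def sum_divide_distrib)
  finally have rat: "rat_of_pbar (\<Prod>m\<in>{1..r i}. 1 + svar (D i m) * w) = N / g ^ r i" .
  have N: "N \<in> NPe r D"
    unfolding N_def by (intro NPe_sum NPe.mult NPe_power fg) (simp add: e)
  \<comment> \<open>This turns a^l b^(r-l) into b^r (a / b)^l and so recovers the exchange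
    polynomial at a / b from its homogenization.\<close>
  have "a = a / b * b"
    by (metis mult.assoc mult_1_right semifield_divide_inverse semifield_left_inverse)
  then have ab: "Nz a = Nz (a / b) * Nz b" by simp
  have "psi0 r D Z N = (\<Sum>l\<le>r i. pi0 (Polynomial.coeff (Z i) l) * Nz a ^ l * Nz b ^ (r i - l))"
    unfolding N_def using fg e
    by (subst psi0_sum) (auto simp: NPe.mult NPe_power psi0_mult psi0_power intro!: sum.cong)
  also have "\<dots> = (\<Sum>l\<le>r i. Nz b ^ r i * (pi0 (Polynomial.coeff (Z i) l) * Nz (a / b) ^ l))"
  proof (intro sum.cong refl)
    fix l assume "l \<in> {..r i}"
    then have "Nz b ^ r i = Nz b ^ l * Nz b ^ (r i - l)" by (simp flip: power_add)
    then show "pi0 (Polynomial.coeff (Z i) l) * Nz a ^ l * Nz b ^ (r i - l) =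
        Nz b ^ r i * (pi0 (Polynomial.coeff (Z i) l) * Nz (a / b) ^ l)"
      unfolding ab power_mult_distrib by (simp add: mult_ac del: times_with_zero.simps)
  qed
  also have "\<dots> = Nz (b ^ r i * Ztrop (Z i) (a / b))"
    by (simp only: Ztrop_Nz flip: sum_distrib_left) (simp add: Nz_power)
  finally have psiN: "psi0 r D Z N = Nz (b ^ r i * Ztrop (Z i) (a / b))" .
  have "psi0 r D Z (g ^ r i) = Nz (b ^ r i)" by (simp add: psi0_power fg Nz_power)
  from SS_psi[OF N psiN NPe_power[OF fg(3)] this rat] fg(6)
  show "(\<Prod>m\<in>{1..r i}. 1 + svar (D i m) * w) \<in> SS r D Z"
    "psi r D Z (\<Prod>m\<in>{1..r i}. 1 + svar (D i m) * w) = Ztrop (Z i) (psi r D Z w)"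
    by (simp_all add: semifield_mult_divide_cancel)
qed

text \<open>
  The elements of \<open>SS\<close> are symmetric in the variables \<open>svar (D i 1), \<dots>, svar (D i (r i))\<close>, so a
  monomial lies in \<open>SS\<close> only if its exponents are constant along each of these families.
\<close>

lemma SS_monomial_symmetric:
  assumes p: "p \<in> SS r D Z" and q: "q \<in> SS r D Z" and eq: "p * mon svar \<alpha> = q * mon svar \<beta>"
    and l: "1 \<le> l" "l \<le> r i" and m: "1 \<le> m" "m \<le> r i"
  shows "Poly_Mapping.lookup \<alpha> (D i l) + Poly_Mapping.lookup \<beta> (D i m) =
    Poly_Mapping.lookup \<alpha> (D i m) + Poly_Mapping.lookup \<beta> (D i l)"
proof -
  \<comment> \<open>Elements of NP[e] have the same value at x and at x composed with the
    transposition \<sigma>, whereas in a monomial the two exponents trade places; comparing the two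
    evaluations isolates the exponents.\<close>
  define \<sigma> where "\<sigma> d = (if d = D i l then D i m else if d = D i m then D i l else d)" for d
  have invol: "\<sigma> (\<sigma> d) = d" for d by (simp add: \<sigma>_def)
  have inj: "inj \<sigma>" by (metis injI invol)
  have ix_\<sigma>: "ix (\<sigma> d) = ix d" for d using l m by (auto simp: \<sigma>_def)
  let ?ev = "lin emb (mon x)" and ?ev' = "lin emb (mon (\<lambda>d. x (\<sigma> d)))"
  have emb: "type_hom emb" by unfold_locales
  interpret ev: type_hom ?ev by (rule type_hom_lin_mon[OF emb])
  interpret ev': type_hom ?ev' by (rule type_hom_lin_mon[OF emb])
  have sym: "elem_sym k {1..r j} (\<lambda>n. x (\<sigma> (D j n))) = elem_sym k {1..r j} (\<lambda>n. x (D j n))" for j k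
  proof -
    have "\<sigma> (D j n) = D j (lx (\<sigma> (D j n)))" if "n \<in> {1..r j}" for n
      using D_ix_lx[of "\<sigma> (D j n)"] ix_\<sigma>[of "D j n"] that by auto
    then have "elem_sym k {1..r j} (\<lambda>n. x (\<sigma> (D j n))) =
        elem_sym k {1..r j} (\<lambda>n. x (D j (lx (\<sigma> (D j n)))))"
      unfolding elem_sym_def by (intro sum.cong prod.cong refl) (auto dest!: subsetD)
    also have "\<dots> = elem_sym k {1..r j} (\<lambda>n. x (D j n))"
    proof (rule elem_sym_involution)
      fix n assume n: "n \<in> {1..r j}"
      then have ixn: "ix (\<sigma> (D j n)) = j" using ix_\<sigma> by simp
      then show "lx (\<sigma> (D j n)) \<in> {1..r j}" using lx_ge lx_le by (metis atLeastAtMost_iff)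
      show "lx (\<sigma> (D j (lx (\<sigma> (D j n))))) = n"
        using D_ix_lx[of "\<sigma> (D j n)"] n by (simp add: ixn invol)
    qed
    finally show ?thesis .
  qed
  have rep: "\<exists>u. f = to_fract u \<and> ?ev u = ?ev' u \<and> ?ev u \<noteq> 0" if f: "f \<in> NPe r D" "f \<noteq> 0"
    for f :: "('p, 'd) srat"
  proof -
    obtain F where F: "f = to_fract (evE F)" using NPe_evE[OF f(1)] by blast
    moreover have "?ev (evE F) \<noteq> 0" using emb_free[of "evE F"] f(2) F by auto
    moreover have "?ev (evE F) = ?ev' (evE F)" by (simp only: lin_evE[OF emb] sym)
    ultimately show ?thesis by blast
  qed
  obtain f g where p: "f \<in> NPe r D" "g \<in> NPe r D" "rat_of_pbar p = f / g"
    using p by (rule SSE)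
  obtain f' g' where q: "f' \<in> NPe r D" "g' \<in> NPe r D" "rat_of_pbar q = f' / g'"
    using q by (rule SSE)
  have nz: "f \<noteq> 0" "g \<noteq> 0" "f' \<noteq> 0" "g' \<noteq> 0"
    using p q rat_of_pbar_nonzero[of p] rat_of_pbar_nonzero[of q] by auto
  obtain u v u' v' where u: "f = to_fract u" "?ev u = ?ev' u" "?ev u \<noteq> 0"
    and v: "g = to_fract v" "?ev v = ?ev' v" "?ev v \<noteq> 0"
    and u': "f' = to_fract u'" "?ev u' = ?ev' u'" "?ev u' \<noteq> 0"
    and v': "g' = to_fract v'" "?ev v' = ?ev' v'" "?ev v' \<noteq> 0"
    using rep[OF p(1) nz(1)] rep[OF p(2) nz(2)] rep[OF q(1) nz(3)] rep[OF q(2) nz(4)] by blast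
  let ?s = "\<lambda>d. Poly_Mapping.single (Poly_Mapping.single d 1) 1 :: ('p, 'd) spoly"
  have rat_mon: "rat_of_pbar (mon svar \<gamma>) = to_fract (mon ?s \<gamma>)" for \<gamma>
    unfolding type_hom.hom_mon[OF type_hom_to_fract]
    by (simp add: mon_def rat_of_pbar_prod rat_of_pbar_power svar.rep_eq s_var_def)
  have "f / g * rat_of_pbar (mon svar \<alpha>) = f' / g' * rat_of_pbar (mon svar \<beta>)"
    using arg_cong[OF eq, of rat_of_pbar] by (simp add: times_pbar.rep_eq p q)
  then have "to_fract (u * v' * mon ?s \<alpha>) = to_fract (u' * v * mon ?s \<beta>)"
    unfolding rat_mon using nz by (simp add: u(1) v(1) u'(1) v'(1) field_simps)
  then have poly: "u * v' * mon ?s \<alpha> = u' * v * mon ?s \<beta>" by (simp only: to_fract_inject)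
  have ev_s: "?ev (?s d) = x d" "?ev' (?s d) = x (\<sigma> d)" for d by (simp_all add: lin_single)
  have "?ev u * ?ev v' * mon x \<alpha> = ?ev u' * ?ev v * mon x \<beta>"
    using arg_cong[OF poly, of ?ev] by (simp only: ev.hom_mult ev.hom_mon ev_s)
  moreover have "?ev u * ?ev v' * mon (\<lambda>d. x (\<sigma> d)) \<alpha> = ?ev u' * ?ev v * mon (\<lambda>d. x (\<sigma> d)) \<beta>"
    using arg_cong[OF poly, of ?ev'] by (simp only: ev'.hom_mult ev'.hom_mon ev_s u v u' v')
  \<comment> \<open>Multiplying the two evaluations crosswise puts the same product of nonzero
    symmetric values on both sides, so that only monomials in x remain after cancellation.\<close>
  ultimately have "(?ev u * ?ev v' * mon x \<alpha>) * (?ev u' * ?ev v * mon (\<lambda>d. x (\<sigma> d)) \<beta>) =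
      (?ev u' * ?ev v * mon x \<beta>) * (?ev u * ?ev v' * mon (\<lambda>d. x (\<sigma> d)) \<alpha>)"
    by (simp only:)
  then have "(?ev u * ?ev v' * ?ev u' * ?ev v) * (mon x \<alpha> * mon (\<lambda>d. x (\<sigma> d)) \<beta>) =
      (?ev u * ?ev v' * ?ev u' * ?ev v) * (mon x \<beta> * mon (\<lambda>d. x (\<sigma> d)) \<alpha>)"
    by (simp only: mult_ac)
  moreover have "mon (\<lambda>d. x (\<sigma> d)) \<gamma> = mon x (Poly_Mapping.map_key \<sigma> \<gamma>)" for \<gamma>
    unfolding mon_def map_key.rep_eq[OF inj]
    by (rule prod.reindex_bij_witness[of _ \<sigma> \<sigma>]) (auto simp: invol)
  ultimately have "mon x (\<alpha> + Poly_Mapping.map_key \<sigma> \<beta>) = mon x (\<beta> + Poly_Mapping.map_key \<sigma> \<alpha>)"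
    using u v u' v' by (simp add: mon_add)
  then have "\<alpha> + Poly_Mapping.map_key \<sigma> \<beta> = \<beta> + Poly_Mapping.map_key \<sigma> \<alpha>" by (rule x_free)
  from arg_cong[OF this, of "\<lambda>\<gamma>. Poly_Mapping.lookup \<gamma> (D i l)"]
  show ?thesis by (simp add: lookup_add map_key.rep_eq[OF inj] \<sigma>_def)
qed

end


section \<open>Generated subrings of a commutative ring\<close>

lemma a_inv_type: "\<ominus>\<^bsub>ring_of_type_algebra\<^esub> a = - (a :: 'a :: comm_ring_1)"
proof -
  interpret R: cring "ring_of_type_algebra :: 'a ring" by (rule cring_from_type_algebra)
  show ?thesis by (rule R.minus_equality) (auto simp: ring_of_type_algebra_def)
qed

abbreviation gen_ring :: "'a :: comm_ring_1 set \<Rightarrow> 'a set" where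
  "gen_ring \<equiv> generate_ring ring_of_type_algebra"

lemma gen_ring_one: "1 \<in> gen_ring H"
  and gen_ring_incl: "a \<in> H \<Longrightarrow> a \<in> gen_ring H"
  and gen_ring_uminus: "a \<in> gen_ring H \<Longrightarrow> - a \<in> gen_ring H"
  and gen_ring_add: "a \<in> gen_ring H \<Longrightarrow> b \<in> gen_ring H \<Longrightarrow> a + b \<in> gen_ring H"
  and gen_ring_mult: "a \<in> gen_ring H \<Longrightarrow> b \<in> gen_ring H \<Longrightarrow> a * b \<in> gen_ring H"
  using generate_ring.intros[where R = ring_of_type_algebra and H = H]
  unfolding a_inv_type by (auto simp: ring_of_type_algebra_def)

lemma gen_ring_zero: "0 \<in> gen_ring H"
  using gen_ring_add[OF gen_ring_one gen_ring_uminus[OF gen_ring_one]] by simp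

lemma gen_ring_sum: "(\<And>i. i \<in> A \<Longrightarrow> f i \<in> gen_ring H) \<Longrightarrow> sum f A \<in> gen_ring H"
  by (induction A rule: infinite_finite_induct) (auto simp: gen_ring_zero gen_ring_add)

lemma gen_ring_of_int: "of_int k \<in> gen_ring H"
proof -
  have "of_nat n \<in> gen_ring H" for n
    by (induction n) (auto simp: gen_ring_zero gen_ring_one gen_ring_add)
  then show ?thesis by (cases k) (auto intro: gen_ring_uminus simp del: of_nat_Suc)
qed

lemma gen_ring_induct [consumes 1, case_names one incl uminus add mult]:
  assumes "a \<in> gen_ring H" and "P 1" "\<And>a. a \<in> H \<Longrightarrow> P a" "\<And>a. P a \<Longrightarrow> P (- a)"
    "\<And>a b. P a \<Longrightarrow> P b \<Longrightarrow> P (a + b)" "\<And>a b. P a \<Longrightarrow> P b \<Longrightarrow> P (a * b)"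
  shows "P a"
  using assms(1)
proof (induction rule: generate_ring.induct)
  case (a_inv a)
  then show ?case using assms(4) unfolding a_inv_type by blast
qed (use assms(2,3,5,6) in \<open>auto simp: ring_of_type_algebra_def\<close>)

lemma ring_hom_sub_iff:
  "h \<in> ring_hom (ring_of_type_algebra\<lparr>carrier := A\<rparr>) (ring_of_type_algebra\<lparr>carrier := B\<rparr>) \<longleftrightarrow>
    (\<forall>a\<in>A. h a \<in> B) \<and> (\<forall>a\<in>A. \<forall>b\<in>A. h (a * b) = h a * h b \<and> h (a + b) = h a + h b) \<and> h 1 = 1"
  by (auto simp: ring_hom_def ring_of_type_algebra_def)


lemma prod_power:
  "(\<Prod>i\<in>A. f i) ^ n = (\<Prod>i\<in>A. (f i :: 'a :: comm_monoid_mult) ^ n)"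
  by (induction A rule: infinite_finite_induct) (auto simp: power_mult_distrib)


section \<open>Homomorphisms out of the algebra of fractions\<close>

context composite_base
begin

definition X0 :: "'n \<Rightarrow> 'g" where
  "X0 i = (\<Prod>l\<in>{1..r i}. x (D i l))"

text \<open>The negative reciprocals of the roots of the exchange polynomials: over the algebraic
  closure Z i (u) is the product of the factors 1 + \<open>zeta (D i m)\<close> u. Replacing s_im by
  these values turns \<open>ehat\<close> into the coefficients of Z i.\<close>

definition zeta :: "'d \<Rightarrow> 'g alg_closure" where
  "zeta = (SOME \<zeta>. \<forall>d. elem_sym (lx d) {1..r (ix d)} (\<lambda>m. \<zeta> (D (ix d) m)) =
    to_ac (emb (Polynomial.coeff (Z (ix d)) (lx d))))"

lemma zeta:
  assumes "1 \<le> l" "l \<le> r i"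
  shows "elem_sym l {1..r i} (\<lambda>m. zeta (D i m)) = to_ac (emb (Polynomial.coeff (Z i) l))"
proof -
  have "\<forall>d. elem_sym (lx d) {1..r (ix d)} (\<lambda>m. zeta (D (ix d) m)) =
      to_ac (emb (Polynomial.coeff (Z (ix d)) (lx d)))"
    unfolding zeta_def by (rule someI_ex[OF exists_families_elem_sym])
  from this[rule_format, of "D i l"] show ?thesis using assms by simp
qed

lemma prod_zeta: "(\<Prod>m\<in>{1..r i}. zeta (D i m)) = 1"
  using zeta[of "r i" i] r_pos by (simp only: elem_sym_full Z_r) simp

definition val :: "('p, 'd) pbar \<Rightarrow> ('d \<Rightarrow>\<^sub>0 nat) \<Rightarrow> 'g alg_closure" where
  "val p \<alpha> = to_ac (embP \<kappa> (inP (psi r D Z p))) * mon zeta \<alpha>"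

text \<open>By symmetry of S the two monomials differ, family by family, by a power of s_i1 s_i2 ...
  . Both psi and the product of the \<open>zeta\<close> values give this product the value 1, so the
  ambiguity has no effect.\<close>

lemma val_well_defined:
  assumes p: "p \<in> SS r D Z" and q: "q \<in> SS r D Z" and eq: "p * mon svar \<alpha> = q * mon svar \<beta>"
  shows "val p \<alpha> = val q \<beta>"
proof -
  let ?a = "\<lambda>i. Poly_Mapping.lookup \<alpha> (D i 1)" and ?b = "\<lambda>i. Poly_Mapping.lookup \<beta> (D i 1)"
  \<comment> \<open>Exponents are natural numbers, so instead of a division each side is multiplied
    by a power of the full product, with the first exponent of the other side. The identity is
    needed in two monoids, for \<open>svar\<close> and for \<open>zeta\<close>.\<close>
  have balance: "mon t \<alpha> * (\<Prod>i\<in>UNIV. (\<Prod>l\<in>{1..r i}. t (D i l)) ^ ?b i) =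
      mon t \<beta> * (\<Prod>i\<in>UNIV. (\<Prod>l\<in>{1..r i}. t (D i l)) ^ ?a i)" for t :: "'d \<Rightarrow> 'c :: comm_monoid_mult"
  proof -
    have *: "mon t \<gamma> * (\<Prod>i\<in>UNIV. (\<Prod>l\<in>{1..r i}. t (D i l)) ^ k i) =
        (\<Prod>i\<in>UNIV. \<Prod>l\<in>{1..r i}. t (D i l) ^ (Poly_Mapping.lookup \<gamma> (D i l) + k i))" for \<gamma> k
      by (simp add: mon_def prod_D power_add prod.distrib prod_power)
    have "Poly_Mapping.lookup \<alpha> (D i l) + ?b i = Poly_Mapping.lookup \<beta> (D i l) + ?a i"
      if "l \<in> {1..r i}" for i l
      using SS_monomial_symmetric[OF p q eq, of l i 1] r_pos[of i] that by simp
    then show ?thesis unfolding * by (intro prod.cong refl) (simp only:)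
  qed
  let ?E = "\<lambda>i. \<Prod>l\<in>{1..r i}. svar (D i l) :: ('p, 'd) pbar"
  have "p * (\<Prod>i\<in>UNIV. ?E i ^ ?a i) * mon svar \<beta> = (p * mon svar \<alpha>) * (\<Prod>i\<in>UNIV. ?E i ^ ?b i)"
    using balance[of "svar :: 'd \<Rightarrow> ('p, 'd) pbar"] by (simp add: mult_ac)
  also have "\<dots> = q * (\<Prod>i\<in>UNIV. ?E i ^ ?b i) * mon svar \<beta>" by (simp add: eq mult_ac)
  finally have "p * (\<Prod>i\<in>UNIV. ?E i ^ ?a i) = q * (\<Prod>i\<in>UNIV. ?E i ^ ?b i)"
    by (rule semifield_cancel)
  then have "psi r D Z (p * (\<Prod>i\<in>UNIV. ?E i ^ ?a i)) = psi r D Z (q * (\<Prod>i\<in>UNIV. ?E i ^ ?b i))"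
    by (rule arg_cong)
  then have "psi r D Z p = psi r D Z q"
    using p q by (simp only: psi_mult psi_prod psi_power SS_prod SS_power SS_prod_svar psi_prod_svar
      power_one prod.neutral_const mult_1_right)
  moreover have "mon zeta \<alpha> = mon zeta \<beta>"
    using balance[of zeta] by (simp only: prod_zeta power_one prod.neutral_const mult_1_right)
  ultimately show ?thesis by (simp add: val_def)
qed

text \<open>The summands of \<open>ehat\<close> are monomials in the s_il that in general lie
  outside S. Integer combinations of elements of \<open>H\<close> form a ring,
  \<open>L1.dom\<close>, containing these elements as well as S.\<close>

definition H :: "('p, 'd) pbar set" where
  "H = {p * mon svar \<alpha> | p \<alpha>. p \<in> SS r D Z}"

definition chi :: "('p, 'd) pbar \<Rightarrow> 'g alg_closure" where
  "chi h = (THE v. \<exists>p\<in>SS r D Z. \<exists>\<alpha>. h = p * mon svar \<alpha> \<and> v = val p \<alpha>)"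

lemma chi: "p \<in> SS r D Z \<Longrightarrow> chi (p * mon svar \<alpha>) = val p \<alpha>"
  unfolding chi_def by (rule the_equality) (auto intro: val_well_defined)

lemma HI: "p \<in> SS r D Z \<Longrightarrow> p * mon svar \<alpha> \<in> H"
  by (auto simp: H_def)

lemma H_mult: "h \<in> H \<Longrightarrow> h' \<in> H \<Longrightarrow> h * h' \<in> H"
  and chi_mult: "h \<in> H \<Longrightarrow> h' \<in> H \<Longrightarrow> chi (h * h') = chi h * chi h'"
proof -
  assume "h \<in> H" "h' \<in> H"
  then obtain p \<alpha> p' \<alpha>' where h: "h = p * mon svar \<alpha>" "p \<in> SS r D Z"
    and h': "h' = p' * mon svar \<alpha>'" "p' \<in> SS r D Z"
    by (auto simp: H_def)
  have *: "h * h' = (p * p') * mon svar (\<alpha> + \<alpha>')" by (simp add: h h' mon_add mult_ac)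
  show "h * h' \<in> H" unfolding * by (intro HI SS_mult h h')
  have "chi (h * h') = val (p * p') (\<alpha> + \<alpha>')" "chi h = val p \<alpha>" "chi h' = val p' \<alpha>'"
    by (simp_all only: * chi[OF SS_mult[OF h(2) h'(2)]]) (simp_all only: h(1) h'(1) chi[OF h(2)] chi[OF h'(2)])
  then show "chi (h * h') = chi h * chi h'"
    by (simp add: val_def psi_mult h h' mon_add inP_mult gr_mult \<kappa>.hom_mult mult_ac)
qed

lemma H_SS: "p \<in> SS r D Z \<Longrightarrow> p \<in> H"
  and chi_SS: "p \<in> SS r D Z \<Longrightarrow> chi p = to_ac (embP \<kappa> (inP (psi r D Z p)))"
  using HI[of p 0] chi[of p 0] by (simp_all add: val_def)

lemma H_one: "1 \<in> H" and chi_one: "chi 1 = 1"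
  using H_SS[OF SS_one] chi_SS[OF SS_one] by simp_all

lemma H_svar: "svar d \<in> H" and chi_svar: "chi (svar d) = zeta d"
  using HI[OF SS_one, of "Poly_Mapping.single d 1"] chi[OF SS_one, of "Poly_Mapping.single d 1"]
  by (simp_all add: val_def)

lemma H_prod: "(\<And>i. i \<in> A \<Longrightarrow> f i \<in> H) \<Longrightarrow> prod f A \<in> H"
  and chi_prod: "(\<And>i. i \<in> A \<Longrightarrow> f i \<in> H) \<Longrightarrow> chi (prod f A) = (\<Prod>i\<in>A. chi (f i))"
proof -
  show "(\<And>i. i \<in> A \<Longrightarrow> f i \<in> H) \<Longrightarrow> prod f A \<in> H" for A
    by (induction A rule: infinite_finite_induct) (auto simp: H_one H_mult)
  then show "(\<And>i. i \<in> A \<Longrightarrow> f i \<in> H) \<Longrightarrow> chi (prod f A) = (\<Prod>i\<in>A. chi (f i))"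
    by (induction A rule: infinite_finite_induct) (auto simp: chi_one chi_mult)
qed

definition spec1 :: "('p, 'd) pbar group_ring \<Rightarrow> 'g alg_closure" where
  "spec1 = lin of_int (\<lambda>a. chi (expo_base a))"

sublocale L1: partial_hom UNIV "of_int :: int \<Rightarrow> 'g alg_closure" "{a. expo_base a \<in> H}"
  "\<lambda>a. chi (expo_base a)"
  by unfold_locales (auto simp: zero_expo_def plus_expo_def H_one H_mult chi_one chi_mult)

lemma gr_dom: "p \<in> H \<Longrightarrow> gr p \<in> L1.dom" and spec1_gr: "spec1 (gr p) = chi p"
  unfolding gr_def by (auto intro!: L1.dom_single) (simp add: spec1_def lin_single)

text \<open>Each summand is the basis element of a single monomial in \<open>H\<close>, to which
  \<open>chi\<close> applies as a whole and returns a product of \<open>zeta\<close> values.\<close>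

lemma ehat_dom: "ehat r D i l \<in> L1.dom"
  and spec1_ehat: "1 \<le> l \<Longrightarrow> l \<le> r i \<Longrightarrow> spec1 (ehat r D i l) = to_ac (emb (Polynomial.coeff (Z i) l))"
proof -
  have dom: "gr (\<Prod>m\<in>J. svar (D i m)) \<in> L1.dom" for J by (intro gr_dom H_prod H_svar)
  then show "ehat r D i l \<in> L1.dom"
    unfolding ehat_def elem_sym_def gr_prod [symmetric] by (intro L1.dom_sum)
  have "spec1 (ehat r D i l) = elem_sym l {1..r i} (\<lambda>m. zeta (D i m))"
    unfolding ehat_def elem_sym_def gr_prod [symmetric]
    unfolding spec1_def by (subst L1.lin_sum)
      (auto simp: dom chi_prod H_svar chi_svar spec1_gr [unfolded spec1_def] intro!: sum.cong)
  then show "1 \<le> l \<Longrightarrow> l \<le> r i \<Longrightarrow> spec1 (ehat r D i l) = to_ac (emb (Polynomial.coeff (Z i) l))"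
    by (simp only: zeta)
qed

text \<open>Any values whose product over each family is \<open>X0 i\<close> would do.\<close>

definition xi :: "'d \<Rightarrow> 'g alg_closure" where
  "xi d = (if lx d = 1 then to_ac (X0 (ix d)) else 1)"

lemma prod_xi: "(\<Prod>l\<in>{1..r i}. xi (D i l)) = to_ac (X0 i)"
proof -
  have "(\<Prod>l\<in>{1..r i}. xi (D i l)) = (\<Prod>l\<in>{1..r i}. if l = 1 then to_ac (X0 i) else 1)"
    by (intro prod.cong refl) (auto simp: xi_def)
  then show ?thesis using r_pos[of i] by simp
qed

definition spec2 :: "(('d \<Rightarrow>\<^sub>0 nat) \<Rightarrow>\<^sub>0 ('p, 'd) pbar group_ring) \<Rightarrow> 'g alg_closure" where
  "spec2 = lin spec1 (mon xi)"

sublocale L2: partial_hom L1.dom spec1 UNIV "mon xi"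
  unfolding spec1_def
  by unfold_locales (auto simp: L1.dom_zero L1.dom_one L1.dom_add L1.dom_mult L1.lin_add
    L1.lin_mult L1.lin_one mon_add)

text \<open>The true value of a polynomial at the initial cluster, as opposed to its specialization
  \<open>spec2\<close>. Freeness makes it injective, so \<open>spec2\<close> can be transported to
  elements of the ambient field.\<close>

definition realize :: "(('d \<Rightarrow>\<^sub>0 nat) \<Rightarrow>\<^sub>0 ('p, 'd) pbar group_ring) \<Rightarrow> 'g" where
  "realize = lin (\<lambda>c. \<kappa> (to_fract c)) (mon x)"

sublocale realize: type_hom realize
  unfolding realize_def
  by (rule type_hom_lin_mon[OF type_hom_compose[OF kappa type_hom_to_fract]])

lemma realize_eq_iff: "realize F = realize G \<longleftrightarrow> F = G"
proof -
  have "inj realize"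
    using lin_free[OF type_hom_to_fract]
    by (intro realize.inj_homI) (auto simp: realize_def)
  then show ?thesis by (auto simp: inj_eq)
qed

lemma realize_const: "realize (Poly_Mapping.single 0 c) = \<kappa> (to_fract c)"
  and spec2_const: "spec2 (Poly_Mapping.single 0 c) = spec1 c"
  and dom_const: "c \<in> L1.dom \<Longrightarrow> Poly_Mapping.single 0 c \<in> L2.dom"
  by (simp_all add: realize_def spec2_def lin_single L2.phi_zero L2.dom_single)

definition X0_poly :: "'n \<Rightarrow> ('d \<Rightarrow>\<^sub>0 nat) \<Rightarrow>\<^sub>0 ('p, 'd) pbar group_ring" where
  "X0_poly i = (\<Prod>l\<in>{1..r i}. Poly_Mapping.single (Poly_Mapping.single (D i l) 1) 1)"

lemma X0_poly_dom: "X0_poly i \<in> L2.dom"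
  and spec2_X0_poly: "spec2 (X0_poly i) = to_ac (X0 i)"
proof -
  have dom: "Poly_Mapping.single \<alpha> 1 \<in> L2.dom" for \<alpha>
    by (simp add: L2.dom_single L1.dom_one)
  then show "X0_poly i \<in> L2.dom" unfolding X0_poly_def by (intro L2.dom_prod)
  have "spec2 (X0_poly i) = (\<Prod>l\<in>{1..r i}. xi (D i l))"
    unfolding spec2_def X0_poly_def using dom
    by (subst L2.lin_prod) (auto simp: lin_single L2.phi_zero L2.phi_one)
  then show "spec2 (X0_poly i) = to_ac (X0 i)" by (simp only: prod_xi)
qed

lemma realize_X0_poly: "realize (X0_poly i) = X0 i"
  unfolding X0_poly_def realize.hom_prod by (simp add: X0_def realize_def lin_single)

lemma ZPX_emb: "emb c \<in> ZPX \<kappa> X0"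
proof -
  have "emb c = (\<Sum>a\<in>Poly_Mapping.keys c. of_int (Poly_Mapping.lookup c a) * embP \<kappa> (inP (expo_base a)))"
    by (subst group_ring_sum) (simp add: emb.hom_sum emb.hom_mult emb.hom_of_int emb_gr)
  also have "\<dots> \<in> ZPX \<kappa> X0"
    unfolding ZPX_def by (intro gen_ring_sum gen_ring_mult gen_ring_of_int gen_ring_incl) auto
  finally show ?thesis .
qed

lemma ZPX_X0: "X0 i \<in> ZPX \<kappa> X0"
  unfolding ZPX_def by (intro gen_ring_incl) auto

text \<open>The second half of the conclusion brings the construction back from the algebraic
  closure: on the generators, and hence on the whole algebra, the specialized value already lies in
  ZP[X].\<close>

lemma ZSeX_realize:
  "v \<in> ZSeX \<kappa> r D Z X0 \<Longrightarrow> \<exists>F\<in>L2.dom. v = realize F \<and> spec2 F \<in> to_ac ` ZPX \<kappa> X0"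
  unfolding ZSeX_def
proof (induction rule: gen_ring_induct)
  case one
  show ?case using L2.dom_one L2.lin_one gen_ring_one
    by (intro bexI[of _ 1]) (force simp: spec2_def ZPX_def)+
next
  case (incl v)
  then consider p where "p \<in> SS r D Z" "v = embP \<kappa> p"
    | i l where "1 \<le> l" "l \<le> r i" "v = \<kappa> (to_fract (ehat r D i l))"
    | i where "v = X0 i"
    by blast
  then show ?case
  proof cases
    case 1
    then show ?thesis using ZPX_emb[of "gr (psi r D Z p)"]
      by (intro bexI[of _ "Poly_Mapping.single 0 (gr p)"])
        (auto simp: realize_const spec2_const dom_const gr_dom H_SS spec1_gr chi_SS emb_gr)
  next
    case 2
    then show ?thesis using ZPX_emb
      by (intro bexI[of _ "Poly_Mapping.single 0 (ehat r D i l)"])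
        (auto simp: realize_const spec2_const dom_const ehat_dom spec1_ehat)
  next
    case 3
    then show ?thesis using X0_poly_dom spec2_X0_poly realize_X0_poly ZPX_X0
      by (intro bexI[of _ "X0_poly i"]) auto
  qed
next
  case (uminus v)
  then obtain F a where F: "F \<in> L2.dom" "v = realize F" "spec2 F = to_ac a" "a \<in> ZPX \<kappa> X0"
    by blast
  \<comment> \<open>A \<open>partial_hom\<close> knows only sums and products, so negation is
    multiplication by -1. This element must be shown to be supported on \<open>H\<close>, namely at
    the unit.\<close>
  have minus_one: "- 1 = (Poly_Mapping.single (Expo 1) (- 1) :: ('p, 'd) pbar group_ring)"
    using of_int_mult_gr[of "- 1" "1 :: ('p, 'd) pbar"] by simp
  have m: "- 1 \<in> L1.dom" "spec1 (- 1) = - 1"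
    unfolding minus_one by (auto intro!: L1.dom_single simp: H_one spec1_def lin_single chi_one)
  let ?G = "Poly_Mapping.single 0 (- 1) * F"
  have "spec2 ?G = to_ac (- a)"
    using F m spec2_const[of "- 1"] by (simp add: spec2_def L2.lin_mult dom_const)
  moreover have "realize ?G = - v"
    by (simp add: F realize.hom_mult realize_const \<kappa>.hom_uminus)
  moreover have "- a \<in> ZPX \<kappa> X0" using F by (simp add: ZPX_def gen_ring_uminus)
  ultimately show ?case
    using L2.dom_mult[OF dom_const[OF m(1)] F(1)] by (intro bexI[of _ ?G]) (auto simp del: to_ac_minus)
next
  case (add v w)
  then obtain F G a b where "F \<in> L2.dom" "v = realize F" "spec2 F = to_ac a" "a \<in> ZPX \<kappa> X0"
    "G \<in> L2.dom" "w = realize G" "spec2 G = to_ac b" "b \<in> ZPX \<kappa> X0" by blast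
  then show ?case
    by (intro bexI[of _ "F + G"] conjI image_eqI[of _ _ "a + b"])
      (auto simp: L2.dom_add L2.lin_add spec2_def realize.hom_add ZPX_def gen_ring_add)
next
  case (mult v w)
  then obtain F G a b where "F \<in> L2.dom" "v = realize F" "spec2 F = to_ac a" "a \<in> ZPX \<kappa> X0"
    "G \<in> L2.dom" "w = realize G" "spec2 G = to_ac b" "b \<in> ZPX \<kappa> X0" by blast
  then show ?case
    by (intro bexI[of _ "F * G"] conjI image_eqI[of _ _ "a * b"])
      (auto simp: L2.dom_mult L2.lin_mult spec2_def realize.hom_mult ZPX_def gen_ring_mult)
qed

text \<open>Find the polynomial realizing the argument, specialize it in the algebraic closure and
  return by \<open>of_ac\<close>, which is harmless on values coming from the ambient field.\<close>

lemma psihat0_exists: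
  "\<exists>h. h \<in> ring_hom (ring_of_type_algebra\<lparr>carrier := ZSeX \<kappa> r D Z X0\<rparr>)
      (ring_of_type_algebra\<lparr>carrier := ZPX \<kappa> X0\<rparr>) \<and>
    (\<forall>p\<in>SS r D Z. h (embP \<kappa> p) = embP \<kappa> (inP (psi r D Z p))) \<and>
    (\<forall>i. h (X0 i) = X0 i) \<and>
    (\<forall>i. \<forall>l\<in>{1..r i}. h (\<kappa> (to_fract (ehat r D i l)))
      = \<kappa> (to_fract (inZP (Polynomial.coeff (Z i) l))))"
proof -
  define h where "h v = of_ac (spec2 (THE F. v = realize F))" for v
  have h: "h (realize F) = of_ac (spec2 F)" for F
    unfolding h_def by (rule arg_cong[of _ _ "\<lambda>F. of_ac (spec2 F)"], rule the_equality)
      (auto simp: realize_eq_iff)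
  have "h a \<in> ZPX \<kappa> X0" if "a \<in> ZSeX \<kappa> r D Z X0" for a
    using ZSeX_realize[OF that] by (auto simp: h)
  moreover have "h (a * b) = h a * h b \<and> h (a + b) = h a + h b"
    if ab: "a \<in> ZSeX \<kappa> r D Z X0" "b \<in> ZSeX \<kappa> r D Z X0" for a b
  proof -
    obtain F a' G b' where FG: "F \<in> L2.dom" "a = realize F" "spec2 F = to_ac a'"
      "G \<in> L2.dom" "b = realize G" "spec2 G = to_ac b'"
      using ZSeX_realize[OF ab(1)] ZSeX_realize[OF ab(2)] by blast
    have "spec2 (F * G) = to_ac (a' * b')" "spec2 (F + G) = to_ac (a' + b')"
      using FG by (simp_all add: spec2_def L2.lin_mult L2.lin_add)
    then show ?thesis
      by (simp add: FG h flip: realize.hom_mult realize.hom_add)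
        (simp flip: to_ac_mult to_ac_add)
  qed
  moreover have "h 1 = 1"
    using h[of 1] L2.lin_one of_ac_to_ac[of 1] by (simp add: spec2_def)
  moreover have "h (embP \<kappa> p) = embP \<kappa> (inP (psi r D Z p))" if "p \<in> SS r D Z" for p
    using h[of "Poly_Mapping.single 0 (gr p)"] that
    by (simp add: realize_const spec2_const spec1_gr chi_SS)
  moreover have "h (\<kappa> (to_fract (ehat r D i l))) = \<kappa> (to_fract (inZP (Polynomial.coeff (Z i) l)))"
    if "l \<in> {1..r i}" for i l
    using h[of "Poly_Mapping.single 0 (ehat r D i l)"] that
    by (simp add: realize_const spec2_const spec1_ehat emb_def)
  moreover have "h (X0 i) = X0 i" for i
    using h[of "X0_poly i"] by (simp add: realize_X0_poly spec2_X0_poly)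
  ultimately show ?thesis unfolding ring_hom_sub_iff by blast
qed

section \<open>The homomorphism psihat on the algebra of fractions\<close>

abbreviation "ZS \<equiv> ZSeX \<kappa> r D Z X0"

abbreviation "psih0 \<equiv> psihat0 \<kappa> r D Z X0"

lemma psihat0_spec:
  "psih0 \<in> ring_hom (ring_of_type_algebra\<lparr>carrier := ZS\<rparr>) (ring_of_type_algebra\<lparr>carrier := ZPX \<kappa> X0\<rparr>) \<and>
    (\<forall>p\<in>SS r D Z. psih0 (embP \<kappa> p) = embP \<kappa> (inP (psi r D Z p))) \<and>
    (\<forall>i. psih0 (X0 i) = X0 i) \<and>
    (\<forall>i. \<forall>l\<in>{1..r i}. psih0 (\<kappa> (to_fract (ehat r D i l)))
      = \<kappa> (to_fract (inZP (Polynomial.coeff (Z i) l))))"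
  unfolding psihat0_def by (rule someI_ex[OF psihat0_exists])

lemma psih0_ZPX: "a \<in> ZS \<Longrightarrow> psih0 a \<in> ZPX \<kappa> X0"
  and psih0_add: "a \<in> ZS \<Longrightarrow> b \<in> ZS \<Longrightarrow> psih0 (a + b) = psih0 a + psih0 b"
  and psih0_mult: "a \<in> ZS \<Longrightarrow> b \<in> ZS \<Longrightarrow> psih0 (a * b) = psih0 a * psih0 b"
  and psih0_one: "psih0 1 = 1"
  and psih0_SS: "p \<in> SS r D Z \<Longrightarrow> psih0 (embP \<kappa> p) = embP \<kappa> (inP (psi r D Z p))"
  and psih0_X0: "psih0 (X0 i) = X0 i"
  and psih0_ehat: "1 \<le> l \<Longrightarrow> l \<le> r i \<Longrightarrow>
    psih0 (\<kappa> (to_fract (ehat r D i l))) = emb (Polynomial.coeff (Z i) l)"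
  using psihat0_spec unfolding ring_hom_sub_iff emb_def by auto

lemma ZS_one: "1 \<in> ZS" and ZS_zero: "0 \<in> ZS" and ZS_uminus: "a \<in> ZS \<Longrightarrow> - a \<in> ZS"
  and ZS_add: "a \<in> ZS \<Longrightarrow> b \<in> ZS \<Longrightarrow> a + b \<in> ZS"
  and ZS_mult: "a \<in> ZS \<Longrightarrow> b \<in> ZS \<Longrightarrow> a * b \<in> ZS"
  by (simp_all add: ZSeX_def gen_ring_one gen_ring_zero gen_ring_uminus gen_ring_add gen_ring_mult)

lemma ZS_SS: "p \<in> SS r D Z \<Longrightarrow> embP \<kappa> p \<in> ZS" and ZS_X0: "X0 i \<in> ZS"
  and ZS_ehat: "1 \<le> l \<Longrightarrow> l \<le> r i \<Longrightarrow> \<kappa> (to_fract (ehat r D i l)) \<in> ZS"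
  unfolding ZSeX_def by (auto intro!: gen_ring_incl)

lemma psih0_zero: "psih0 0 = 0"
  using psih0_add[OF ZS_zero ZS_zero] by (metis add.right_neutral add_left_cancel)

lemma psih0_uminus: "a \<in> ZS \<Longrightarrow> psih0 (- a) = - psih0 a"
  using psih0_add[OF _ ZS_uminus, of a a] by (simp add: psih0_zero add_eq_0_iff)

abbreviation "cS \<equiv> calS \<kappa> r D Z X0"

abbreviation "psih \<equiv> psihat \<kappa> r D Z X0"

text \<open>Independence of the fraction as for psi: a denominator with nonzero image is itself
  nonzero, so equal fractions can be multiplied out within the algebra.\<close>

lemma
  assumes f: "f \<in> ZS" and g: "g \<in> ZS" "psih0 g \<noteq> 0"
  shows cSI: "f / g \<in> cS" and psih_divide0: "psih (f / g) = psih0 f / psih0 g"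
proof -
  show "f / g \<in> cS" using assms unfolding calS_def by blast
  have uniq: "v = psih0 f / psih0 g"
    if *: "f' \<in> ZS" "g' \<in> ZS" "psih0 g' \<noteq> 0" "f / g = f' / g'" "v = psih0 f' / psih0 g'" for f' g' v
  proof -
    have "g \<noteq> 0" "g' \<noteq> 0" using g * by (auto simp: psih0_zero)
    then have "psih0 (f * g') = psih0 (f' * g)" using *(4) by (simp add: field_simps)
    then have "psih0 f / psih0 g = psih0 f' / psih0 g'"
      using f g * by (simp add: psih0_mult frac_eq_eq)
    then show ?thesis using *(5) by simp
  qed
  show "psih (f / g) = psih0 f / psih0 g"
    unfolding psihat_def
  proof (rule the_equality)
    show "\<exists>f'\<in>ZS. \<exists>g'\<in>ZS. psih0 g' \<noteq> 0 \<and> f / g = f' / g' \<and> psih0 f / psih0 g = psih0 f' / psih0 g'"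
      using assms by (intro bexI[of _ f] bexI[of _ g]) auto
  qed (blast intro: uniq)
qed

lemma cSE:
  assumes "a \<in> cS"
  obtains f g where "f \<in> ZS" "g \<in> ZS" "psih0 g \<noteq> 0" "a = f / g" "psih a = psih0 f / psih0 g"
  using assms psih_divide0 unfolding calS_def by blast

lemma cS_ZS: "a \<in> ZS \<Longrightarrow> a \<in> cS" and psih_ZS: "a \<in> ZS \<Longrightarrow> psih a = psih0 a"
  using cSI[OF _ ZS_one, of a] psih_divide0[OF _ ZS_one, of a] by (simp_all add: psih0_one)

lemma cS_one: "1 \<in> cS" and cS_zero: "0 \<in> cS" and psih_one [simp]: "psih 1 = 1"
  and psih_zero [simp]: "psih 0 = 0"
  by (simp_all add: cS_ZS psih_ZS ZS_one ZS_zero psih0_one psih0_zero)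

lemma
  assumes a: "a \<in> cS" and b: "b \<in> cS"
  shows cS_add: "a + b \<in> cS" and psih_add: "psih (a + b) = psih a + psih b"
    and cS_mult: "a * b \<in> cS" and psih_mult: "psih (a * b) = psih a * psih b"
proof -
  obtain f g where f: "f \<in> ZS" "g \<in> ZS" "psih0 g \<noteq> 0" "a = f / g" "psih a = psih0 f / psih0 g"
    using a by (rule cSE)
  obtain f' g' where f': "f' \<in> ZS" "g' \<in> ZS" "psih0 g' \<noteq> 0" "b = f' / g'" "psih b = psih0 f' / psih0 g'"
    using b by (rule cSE)
  have "g \<noteq> 0" "g' \<noteq> 0" using f f' by (auto simp: psih0_zero)
  then have *: "a + b = (f * g' + f' * g) / (g * g')" "a * b = (f * f') / (g * g')"
    by (simp_all add: f(4) f'(4) add_frac_eq)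
  show "a + b \<in> cS" "a * b \<in> cS"
    unfolding * using f f' by (auto intro!: cSI ZS_add ZS_mult simp: psih0_mult)
  show "psih (a + b) = psih a + psih b" "psih (a * b) = psih a * psih b"
    unfolding * using f f'
    by (subst psih_divide0; simp add: ZS_add ZS_mult psih0_mult psih0_add add_frac_eq)+
qed

lemma cS_uminus: "a \<in> cS \<Longrightarrow> - a \<in> cS"
proof -
  assume "a \<in> cS"
  moreover have "- 1 \<in> cS" by (intro cS_ZS ZS_uminus ZS_one)
  ultimately show "- a \<in> cS" using cS_mult[of "- 1" a] by simp
qed

text \<open>A fraction outside the kernel has a numerator with nonzero image, so numerator and
  denominator may be exchanged. This is why the quotient is a field.\<close>

lemma cS_inverse: "a \<in> cS \<Longrightarrow> psih a \<noteq> 0 \<Longrightarrow> inverse a \<in> cS"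
  and psih_inverse: "a \<in> cS \<Longrightarrow> psih a \<noteq> 0 \<Longrightarrow> psih (inverse a) = inverse (psih a)"
proof -
  assume "a \<in> cS" "psih a \<noteq> 0"
  moreover from \<open>a \<in> cS\<close> obtain f g where
    f: "f \<in> ZS" "g \<in> ZS" "psih0 g \<noteq> 0" "a = f / g" "psih a = psih0 f / psih0 g" by (rule cSE)
  ultimately have "psih0 f \<noteq> 0" by auto
  then show "inverse a \<in> cS" "psih (inverse a) = inverse (psih a)"
    using f cSI[of g f] psih_divide0[of g f] by simp_all
qed

lemma cS_divide: "a \<in> cS \<Longrightarrow> b \<in> cS \<Longrightarrow> psih b \<noteq> 0 \<Longrightarrow> a / b \<in> cS"
  and psih_divide: "a \<in> cS \<Longrightarrow> b \<in> cS \<Longrightarrow> psih b \<noteq> 0 \<Longrightarrow> psih (a / b) = psih a / psih b"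
  by (simp_all add: divide_inverse cS_mult cS_inverse psih_mult psih_inverse)

lemma cS_power: "a \<in> cS \<Longrightarrow> a ^ n \<in> cS"
  and psih_power: "a \<in> cS \<Longrightarrow> psih (a ^ n) = psih a ^ n"
proof -
  assume a: "a \<in> cS"
  show 1: "a ^ n \<in> cS" for n by (induction n) (auto simp: a cS_one cS_mult)
  show "psih (a ^ n) = psih a ^ n" by (induction n) (auto simp: a 1 psih_mult)
qed

lemma cS_powi: "a \<in> cS \<Longrightarrow> psih a \<noteq> 0 \<Longrightarrow> a powi n \<in> cS"
  and psih_powi: "a \<in> cS \<Longrightarrow> psih a \<noteq> 0 \<Longrightarrow> psih (a powi n) = psih a powi n"
  by (auto simp: power_int_def cS_power psih_power cS_inverse psih_inverse)

lemma cS_prod: "(\<And>i. i \<in> A \<Longrightarrow> f i \<in> cS) \<Longrightarrow> prod f A \<in> cS"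
  and psih_prod: "(\<And>i. i \<in> A \<Longrightarrow> f i \<in> cS) \<Longrightarrow> psih (prod f A) = (\<Prod>i\<in>A. psih (f i))"
proof -
  show "(\<And>i. i \<in> A \<Longrightarrow> f i \<in> cS) \<Longrightarrow> prod f A \<in> cS" for A
    by (induction A rule: infinite_finite_induct) (auto simp: cS_one cS_mult)
  then show "(\<And>i. i \<in> A \<Longrightarrow> f i \<in> cS) \<Longrightarrow> psih (prod f A) = (\<Prod>i\<in>A. psih (f i))"
    by (induction A rule: infinite_finite_induct) (auto simp: psih_mult)
qed

lemma cS_sum: "(\<And>i. i \<in> A \<Longrightarrow> f i \<in> cS) \<Longrightarrow> sum f A \<in> cS"
  and psih_sum: "(\<And>i. i \<in> A \<Longrightarrow> f i \<in> cS) \<Longrightarrow> psih (sum f A) = (\<Sum>i\<in>A. psih (f i))"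
proof -
  show "(\<And>i. i \<in> A \<Longrightarrow> f i \<in> cS) \<Longrightarrow> sum f A \<in> cS" for A
    by (induction A rule: infinite_finite_induct) (auto simp: cS_zero cS_add)
  then show "(\<And>i. i \<in> A \<Longrightarrow> f i \<in> cS) \<Longrightarrow> psih (sum f A) = (\<Sum>i\<in>A. psih (f i))"
    by (induction A rule: infinite_finite_induct) (auto simp: psih_add)
qed

lemma cS_SS: "p \<in> SS r D Z \<Longrightarrow> embP \<kappa> p \<in> cS"
  and psih_SS: "p \<in> SS r D Z \<Longrightarrow> psih (embP \<kappa> p) = embP \<kappa> (inP (psi r D Z p))"
  and cS_X0: "X0 i \<in> cS" and psih_X0: "psih (X0 i) = X0 i"
  and cS_ehat: "1 \<le> l \<Longrightarrow> l \<le> r i \<Longrightarrow> \<kappa> (to_fract (ehat r D i l)) \<in> cS"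
  and psih_ehat: "1 \<le> l \<Longrightarrow> l \<le> r i \<Longrightarrow>
    psih (\<kappa> (to_fract (ehat r D i l))) = emb (Polynomial.coeff (Z i) l)"
  by (simp_all add: cS_ZS psih_ZS ZS_SS ZS_X0 ZS_ehat psih0_SS psih0_X0 psih0_ehat)

lemma embP_nonzero [simp]: "embP \<kappa> p \<noteq> 0"
  by (simp add: gr_nonzero)

lemma embP_inP_inject: "embP \<kappa> (inP p) = embP \<kappa> (inP q) \<longleftrightarrow> p = q"
  by simp

end


text \<open>Torsion-freeness applied to p / q; it yields the uniqueness of the root.\<close>

lemma semifield_power_inject:
  fixes p q :: "'p :: semifield"
  assumes "p ^ n = q ^ n" "0 < n"
  shows "p = q"
proof -
  obtain m where n: "n = Suc m" using assms(2) gr0_implies_Suc by blast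
  have "(p * inverse q) ^ n = 1"
    by (simp add: power_mult_distrib assms(1) semifield_right_inverse flip: semifield_inverse_power)
  then have "p * inverse q = 1" unfolding n by (rule semifield_torsion_free)
  then have "p * inverse q = q * inverse q" by (simp add: semifield_right_inverse)
  then show ?thesis by (rule semifield_cancel)
qed


section \<open>The quotient by the kernel\<close>

context composite_base
begin

lemma ringS_eq: "ringS \<kappa> r D Z X0 = ring_of_type_algebra\<lparr>carrier := cS\<rparr>"
  by (rule ringS_def)

lemma ringS_ring: "ring (ringS \<kappa> r D Z X0)"
proof -
  interpret T: cring "ring_of_type_algebra :: 'g ring" by (rule cring_from_type_algebra)
  have "subring cS (ring_of_type_algebra :: 'g ring)"
  proof (rule T.subringI)
    show "\<ominus>\<^bsub>ring_of_type_algebra\<^esub> a \<in> cS" if "a \<in> cS" for a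
      using that by (simp add: a_inv_type cS_uminus)
  qed (simp_all add: ring_of_type_algebra_def cS_one cS_mult cS_add)
  then show ?thesis unfolding ringS_eq by (rule T.subring_is_ring)
qed

lemma psih_ring_hom: "ring_hom_ring (ringS \<kappa> r D Z X0) ring_of_type_algebra psih"
  using ringS_ring ring_from_type_algebra
  by (rule ring_hom_ringI2)
    (auto simp: ring_hom_def ringS_eq ring_of_type_algebra_def psih_add psih_mult)

sublocale psih: ring_hom_ring "ringS \<kappa> r D Z X0" "ring_of_type_algebra :: 'g ring" psih
  by (rule psih_ring_hom)

abbreviation "Q \<equiv> quotS \<kappa> r D Z X0"

abbreviation "cls \<equiv> clsS \<kappa> r D Z X0"

text \<open>A class is a coset of the kernel, on which \<open>psih\<close> is constant, and
  \<open>the_elem\<close> extracts that constant. Equations between classes thus become equations in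
  the ambient field.\<close>

definition rho :: "'g set \<Rightarrow> 'g" where
  "rho c = the_elem (psih ` c)"

lemma rho_iso: "rho \<in> ring_iso Q (ring_of_type_algebra\<lparr>carrier := psih ` cS\<rparr>)"
  using psih.FactRing_iso_set_aux
  by (simp add: rho_def [abs_def] quotS_def kerS_def) (simp add: ringS_eq)

lemma rho_cls: "a \<in> cS \<Longrightarrow> rho (cls a) = psih a"
  unfolding rho_def clsS_def kerS_def by (rule psih.the_elem_simp) (simp add: ringS_eq)

lemma cls_carrier: "a \<in> cS \<Longrightarrow> cls a \<in> carrier Q"
  unfolding quotS_def clsS_def FactRing_simps ringS_eq by (auto simp: ring_of_type_algebra_def)

lemma rho_inj: "c \<in> carrier Q \<Longrightarrow> c' \<in> carrier Q \<Longrightarrow> rho c = rho c' \<Longrightarrow> c = c'"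
  using rho_iso by (auto simp: ring_iso_def bij_betw_def inj_on_def)

lemma rho_mult: "c \<in> carrier Q \<Longrightarrow> c' \<in> carrier Q \<Longrightarrow> rho (c \<otimes>\<^bsub>Q\<^esub> c') = rho c * rho c'"
  using rho_iso by (auto simp: ring_iso_def ring_hom_def ring_of_type_algebra_def)

lemma rho_one: "rho \<one>\<^bsub>Q\<^esub> = 1"
  using rho_iso by (auto simp: ring_iso_def ring_hom_def ring_of_type_algebra_def)

lemma Q_ring: "ring Q"
  unfolding quotS_def kerS_def by (rule ideal.quotient_is_ring[OF psih.kernel_is_ideal])

sublocale Q: ring Q
  by (rule Q_ring)

lemma rho_power: "c \<in> carrier Q \<Longrightarrow> rho (c [^]\<^bsub>Q\<^esub> (n :: nat)) = rho c ^ n"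
  by (induction n) (simp_all add: rho_one rho_mult mult.commute)

text \<open>Under \<open>rho\<close> a root coming from p in S becomes the equation between the m-th
  powers of psi p and y in the base semifield, where roots are unique.\<close>

lemma root_cls:
  assumes P: "P \<in> SS r D Z" "psi r D Z P = y ^ m" and m: "0 < m"
  shows "rootS \<kappa> r D Z X0 m (cls (embP \<kappa> P)) = cls (embP \<kappa> (inP y))"
proof -
  have rho_SS: "rho (cls (embP \<kappa> p)) = embP \<kappa> (inP (psi r D Z p))" if "p \<in> SS r D Z" for p
    using that by (simp add: rho_cls cS_SS psih_SS)
  have in_Q: "cls (embP \<kappa> p) \<in> carrier Q" if "p \<in> SS r D Z" for p
    using that by (intro cls_carrier cS_SS)
  have pow: "cls (embP \<kappa> p) [^]\<^bsub>Q\<^esub> m = cls (embP \<kappa> P) \<longleftrightarrow> psi r D Z p ^ m = y ^ m"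
    if p: "p \<in> SS r D Z" for p
  proof -
    have "cls (embP \<kappa> p) [^]\<^bsub>Q\<^esub> m = cls (embP \<kappa> P) \<longleftrightarrow>
        rho (cls (embP \<kappa> p) [^]\<^bsub>Q\<^esub> m) = rho (cls (embP \<kappa> P))"
      using rho_inj in_Q p P by (metis Q.nat_pow_closed)
    also have "\<dots> \<longleftrightarrow> embP \<kappa> (inP (psi r D Z p ^ m)) = embP \<kappa> (inP (y ^ m))"
    proof -
      have "embP \<kappa> q ^ m = embP \<kappa> (q ^ m)" for q :: "('p, 'd) pbar"
        by (induction m) (simp_all add: gr_mult \<kappa>.hom_mult)
      then show ?thesis using in_Q p P by (simp add: rho_power rho_SS inP_power)
    qed
    finally show ?thesis by (simp only: embP_inP_inject)
  qed
  show ?thesis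
    unfolding rootS_def
  proof (rule the_equality)
    show "cls (embP \<kappa> (inP y)) \<in> (\<lambda>p. cls (embP \<kappa> p)) ` SS r D Z \<and>
        cls (embP \<kappa> (inP y)) [^]\<^bsub>Q\<^esub> m = cls (embP \<kappa> P)"
      using SS_inP pow[OF SS_inP] by auto
    fix c assume "c \<in> (\<lambda>p. cls (embP \<kappa> p)) ` SS r D Z \<and> c [^]\<^bsub>Q\<^esub> m = cls (embP \<kappa> P)"
    then obtain p where p: "p \<in> SS r D Z" "c = cls (embP \<kappa> p)" "psi r D Z p ^ m = y ^ m"
      using pow by auto
    then have "psi r D Z p = y" using semifield_power_inject m by blast
    then show "c = cls (embP \<kappa> (inP y))"
      unfolding p(2) using p(1) by (intro rho_inj in_Q SS_inP) (simp_all add: rho_SS SS_inP)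
  qed
qed

end


section \<open>The isomorphism\<close>

locale composite_iso = composite_base r D \<kappa> x Z
  for r :: "'n :: finite \<Rightarrow> nat" and D :: "'n \<Rightarrow> nat \<Rightarrow> 'd :: {finite, linorder}"
    and \<kappa> :: "('p :: semifield, 'd) pbar qfield \<Rightarrow> 'g :: field" and x Z +
  fixes \<kappa>f :: "'p qfield \<Rightarrow> 'f :: field" and xg :: "'n \<Rightarrow> 'f"
  assumes kappaf: "type_hom \<kappa>f"
    and free_xg: "free_generating \<kappa>f xg"
begin

sublocale \<kappa>f: field_hom \<kappa>f
  by (simp add: field_hom_iff kappaf)

text \<open>A monomial in the products X_i is a monomial in the composite cluster whose exponents
  are constant along each family.\<close>

definition spread :: "('n \<Rightarrow>\<^sub>0 nat) \<Rightarrow> 'd \<Rightarrow>\<^sub>0 nat" where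
  "spread \<alpha> = Abs_poly_mapping (\<lambda>d. Poly_Mapping.lookup \<alpha> (ix d))"

lemma lookup_spread: "Poly_Mapping.lookup (spread \<alpha>) d = Poly_Mapping.lookup \<alpha> (ix d)"
  by (simp add: spread_def)

lemma spread_eq_iff: "spread \<alpha> = spread \<beta> \<longleftrightarrow> \<alpha> = \<beta>"
proof
  assume *: "spread \<alpha> = spread \<beta>"
  show "\<alpha> = \<beta>"
  proof (rule poly_mapping_eqI)
    fix i
    have "ix (D i 1) = i" using r_pos by simp
    then show "Poly_Mapping.lookup \<alpha> i = Poly_Mapping.lookup \<beta> i"
      using lookup_spread[of \<alpha> "D i 1"] lookup_spread[of \<beta> "D i 1"] * by simp
  qed
qed simp

lemma mon_X0: "mon X0 \<alpha> = mon x (spread \<alpha>)"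
  by (simp add: mon_def lookup_spread prod_D X0_def prod_power)

text \<open>The X_i are products over disjoint sets of free generators, so \<open>spread\<close>
  carries distinct monomials to distinct monomials, and a relation between the X_i is a relation
  between the x with the same coefficients.\<close>

lemma X0_free:
  assumes \<iota>: "field_hom \<iota>" and 0: "lin (\<lambda>q. \<kappa> (\<iota> q)) (mon X0) F = 0"
  shows "F = 0"
proof -
  interpret \<iota>: field_hom \<iota> by fact
  define G where "G = (\<Sum>\<alpha>\<in>Poly_Mapping.keys F. Poly_Mapping.single (spread \<alpha>) (Poly_Mapping.lookup F \<alpha>))"
  have hom: "type_hom (\<lambda>q. \<kappa> (\<iota> q))" by (rule type_hom_compose[OF kappa]) unfold_locales
  have "lin (\<lambda>q. \<kappa> (\<iota> q)) (mon x) G = lin (\<lambda>q. \<kappa> (\<iota> q)) (mon X0) F"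
    unfolding G_def type_hom.hom_sum[OF type_hom_lin_mon[OF hom]]
    by (simp add: lin_single lin_def[of _ _ F] mon_X0)
  then have "G = 0" using 0 by (intro lin_free[of \<iota>]) (auto intro: \<iota>.type_hom_axioms)
  show "F = 0"
  proof (rule poly_mapping_eqI)
    fix \<alpha>
    have "Poly_Mapping.lookup G (spread \<alpha>) =
        (\<Sum>\<beta>\<in>Poly_Mapping.keys F. if \<beta> = \<alpha> then Poly_Mapping.lookup F \<beta> else 0)"
      unfolding G_def lookup_sum
      by (intro sum.cong) (auto simp: lookup_single when_def spread_eq_iff)
    then show "Poly_Mapping.lookup F \<alpha> = Poly_Mapping.lookup 0 \<alpha>"
      using \<open>G = 0\<close> by (auto simp: in_keys_iff split: if_splits)
  qed
qed

text \<open>The embedding is built in two stages: first between the fraction fields of the two group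
  rings, then on rational functions in the initial cluster, where freeness of both \<open>xg\<close>
  and \<open>X0\<close> makes the kernels trivial.\<close>

lemma theta_exists:
  "\<exists>\<theta>. field_hom \<theta> \<and> (\<forall>i. \<theta> (xg i) = X0 i) \<and> (\<forall>p. \<theta> (embP \<kappa>f p) = embP \<kappa> (inP p))"
proof -
  have "\<exists>\<iota>. field_hom \<iota> \<and> (\<forall>c. \<iota> (to_fract c) = to_fract (inZP c :: ('p, 'd) pbar group_ring))"
    by (rule hom_extend_fractions[OF type_hom_to_fract
      type_hom_compose[OF type_hom_to_fract type_hom_inZP] _ fract_eq_quotient])
      (auto dest: inj_inZP simp: type_hom.hom_zero[OF type_hom_inZP])
  then obtain \<iota> where \<iota>: "field_hom \<iota>"
    "\<And>c. \<iota> (to_fract c) = to_fract (inZP c :: ('p, 'd) pbar group_ring)" by blast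
  have hom: "type_hom (\<lambda>q. \<kappa> (\<iota> q))"
    using \<iota>(1) by (intro type_hom_compose[OF kappa]) (simp add: field_hom_iff)
  let ?i = "lin \<kappa>f (mon xg)" and ?j = "lin (\<lambda>q. \<kappa> (\<iota> q)) (mon X0)"
  have "\<exists>\<theta>. field_hom \<theta> \<and> (\<forall>F. \<theta> (?i F) = ?j F)"
  proof (rule hom_extend_fractions[OF type_hom_lin_mon[OF kappaf] type_hom_lin_mon[OF hom]])
    fix F v
    have "?i F = 0 \<longleftrightarrow> F = 0"
      using free_xg by (auto simp: free_generating_def poly_eval_lin)
    moreover have "?j F = 0 \<longleftrightarrow> F = 0" using X0_free[OF \<iota>(1)] by auto
    ultimately show "?i F = 0 \<longleftrightarrow> ?j F = 0" by (simp only:)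
    show "\<exists>a b. ?i b \<noteq> 0 \<and> v = ?i a / ?i b"
      using free_xg by (auto simp: free_generating_def poly_eval_lin)
  qed
  then obtain \<theta> where \<theta>: "field_hom \<theta>" "\<And>F. \<theta> (?i F) = ?j F" by blast
  interpret hom: type_hom "\<lambda>q. \<kappa> (\<iota> q)" by fact
  have "\<theta> (xg i) = X0 i" for i
    using \<theta>(2)[of "Poly_Mapping.single (Poly_Mapping.single i 1) 1"] by (simp add: lin_single)
  moreover have "\<theta> (embP \<kappa>f p) = embP \<kappa> (inP p)" for p
    using \<theta>(2)[of "Poly_Mapping.single 0 (to_fract (gr p))"]
    by (simp add: lin_single \<iota>(2) inZP_gr)
  ultimately show ?thesis using \<theta>(1) by blast
qed

definition theta :: "'f \<Rightarrow> 'g" where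
  "theta = (SOME \<theta>. field_hom \<theta> \<and> (\<forall>i. \<theta> (xg i) = X0 i) \<and> (\<forall>p. \<theta> (embP \<kappa>f p) = embP \<kappa> (inP p)))"

lemma theta_spec: "field_hom theta \<and> (\<forall>i. theta (xg i) = X0 i) \<and> (\<forall>p. theta (embP \<kappa>f p) = embP \<kappa> (inP p))"
  unfolding theta_def by (rule someI_ex[OF theta_exists])

sublocale theta: field_hom theta
  using theta_spec by blast

lemma theta_xg: "theta (xg i) = X0 i" and theta_embP: "theta (embP \<kappa>f p) = embP \<kappa> (inP p)"
  using theta_spec by auto

lemma hom_values:
  assumes \<theta>: "field_hom \<theta>" and xg: "\<And>i. \<theta> (xg i) = X0 i"
    and p: "\<And>p. \<theta> (embP \<kappa>f p) = embP \<kappa> (inP p)"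
  shows "\<theta> (\<kappa>f (to_fract c)) = emb c"
    and "\<exists>F G. \<theta> v = lin (\<lambda>q. \<theta> (\<kappa>f q)) (mon X0) F / lin (\<lambda>q. \<theta> (\<kappa>f q)) (mon X0) G \<and>
      v = poly_eval \<kappa>f xg F / poly_eval \<kappa>f xg G"
proof -
  interpret \<theta>: field_hom \<theta> by fact
  interpret T: type_hom "\<lambda>c :: 'p group_ring. \<theta> (\<kappa>f (to_fract c))"
    by (intro type_hom_compose[OF _ type_hom_compose[OF kappaf type_hom_to_fract]]) unfold_locales
  show "\<theta> (\<kappa>f (to_fract c)) = emb c"
    by (subst (1 2) group_ring_sum)
      (simp only: T.hom_sum T.hom_mult T.hom_of_int emb.hom_sum emb.hom_mult emb.hom_of_int p emb_gr)
  obtain F G where "v = poly_eval \<kappa>f xg F / poly_eval \<kappa>f xg G"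
    using free_xg unfolding free_generating_def by blast
  moreover have "\<theta> (poly_eval \<kappa>f xg F) = lin (\<lambda>q. \<theta> (\<kappa>f q)) (mon X0) F" for F
    by (simp add: poly_eval_lin \<theta>.hom_lin \<theta>.hom_mon xg)
  ultimately show "\<exists>F G. \<theta> v = lin (\<lambda>q. \<theta> (\<kappa>f q)) (mon X0) F / lin (\<lambda>q. \<theta> (\<kappa>f q)) (mon X0) G \<and>
      v = poly_eval \<kappa>f xg F / poly_eval \<kappa>f xg G"
    by (auto simp: \<theta>.hom_divide)
qed

lemma theta_emb: "theta (\<kappa>f (to_fract c)) = emb c"
  by (rule hom_values(1)[OF theta.field_hom_axioms theta_xg theta_embP])

text \<open>The values on the semifield force those on its group ring by additivity, then those on
  the fraction field, and with the values on \<open>xg\<close> those on every rational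
  function.\<close>

lemma hom_unique:
  assumes \<theta>: "field_hom \<theta>" and xg: "\<And>i. \<theta> (xg i) = X0 i"
    and p: "\<And>p. \<theta> (embP \<kappa>f p) = embP \<kappa> (inP p)"
  shows "\<theta> v = theta v"
proof -
  interpret \<theta>: field_hom \<theta> by fact
  have q: "\<theta> (\<kappa>f q) = theta (\<kappa>f q)" for q
  proof -
    obtain a b where "q = to_fract a / to_fract b" using fract_eq_quotient by blast
    then show ?thesis
      by (simp add: \<kappa>f.hom_divide \<theta>.hom_divide theta.hom_divide hom_values(1)[OF \<theta> xg p] theta_emb)
  qed
  obtain F G where v: "v = poly_eval \<kappa>f xg F / poly_eval \<kappa>f xg G"
    using free_xg unfolding free_generating_def by blast
  have "\<theta> (poly_eval \<kappa>f xg F) = theta (poly_eval \<kappa>f xg F)" for F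
    by (simp add: poly_eval_lin \<theta>.hom_lin \<theta>.hom_mon theta.hom_lin theta.hom_mon xg theta_xg q)
  then show ?thesis by (simp add: v \<theta>.hom_divide theta.hom_divide)
qed

lemma ZPX_subset:
  assumes "1 \<in> A" "\<And>a. a \<in> A \<Longrightarrow> - a \<in> A" "\<And>a b. a \<in> A \<Longrightarrow> b \<in> A \<Longrightarrow> a + b \<in> A"
    "\<And>a b. a \<in> A \<Longrightarrow> b \<in> A \<Longrightarrow> a * b \<in> A" "\<And>p. embP \<kappa> (inP p) \<in> A" "\<And>i. X0 i \<in> A"
  shows "ZPX \<kappa> X0 \<subseteq> A"
proof
  fix a assume "a \<in> ZPX \<kappa> X0"
  then show "a \<in> A" unfolding ZPX_def by (induction rule: gen_ring_induct) (use assms in auto)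
qed

lemma psih_image_one: "1 \<in> psih ` cS"
    and psih_image_add: "a \<in> psih ` cS \<Longrightarrow> b \<in> psih ` cS \<Longrightarrow> a + b \<in> psih ` cS"
    and psih_image_mult: "a \<in> psih ` cS \<Longrightarrow> b \<in> psih ` cS \<Longrightarrow> a * b \<in> psih ` cS"
    and psih_image_inverse: "a \<in> psih ` cS \<Longrightarrow> inverse a \<in> psih ` cS"
proof -
  show "1 \<in> psih ` cS" using cS_one psih_one by (metis imageI)
  show "a + b \<in> psih ` cS" "a * b \<in> psih ` cS" if "a \<in> psih ` cS" "b \<in> psih ` cS"
    using that by (auto simp: image_iff) (metis cS_add psih_add, metis cS_mult psih_mult)
  show "inverse a \<in> psih ` cS" if "a \<in> psih ` cS"
  proof (cases "a = 0")
    case False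
    from that obtain b where "b \<in> cS" "a = psih b" by blast
    then show ?thesis using False cS_inverse psih_inverse by (metis imageI)
  qed (use that in simp)
qed

text \<open>Both sides are the fraction field of ZP[X] inside the ambient field. The image of
  \<open>psih\<close> contains the generators and is closed under inverses; conversely its elements
  are quotients of elements of ZP[X].\<close>

lemma range_theta: "range theta = psih ` cS"
proof
  have ZPX: "ZPX \<kappa> X0 \<subseteq> psih ` cS"
  proof (rule ZPX_subset[OF psih_image_one _ psih_image_add psih_image_mult])
    show "- a \<in> psih ` cS" if "a \<in> psih ` cS" for a
    proof -
      have "psih (- 1) = - 1"
        using psih_ZS[OF ZS_uminus[OF ZS_one]] psih0_uminus[OF ZS_one] psih0_one by simp
      then have "- 1 \<in> psih ` cS" using cS_uminus[OF cS_one] by (metis imageI)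
      from psih_image_mult[OF this that] show ?thesis by simp
    qed
    show "embP \<kappa> (inP p) \<in> psih ` cS" for p
      using cS_SS[OF SS_inP] psih_SS[OF SS_inP] by (metis imageI psi_inP)
    show "X0 i \<in> psih ` cS" for i using cS_X0 psih_X0 by (metis imageI)
  qed
  show "range theta \<subseteq> psih ` cS"
  proof
    fix a assume "a \<in> range theta"
    then obtain v where v: "a = theta v" by blast
    have div: "b / c \<in> psih ` cS" if "b \<in> psih ` cS" "c \<in> psih ` cS" for b c
      unfolding divide_inverse by (intro psih_image_mult psih_image_inverse that)
    have q: "theta (\<kappa>f q) \<in> psih ` cS" for q
    proof -
      obtain a b where "q = to_fract a / to_fract b" using fract_eq_quotient by blast
      then show ?thesis
        using ZPX_emb ZPX by (auto simp: \<kappa>f.hom_divide theta.hom_divide theta_emb intro!: div)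
    qed
    have gen: "X0 i \<in> psih ` cS" for i using cS_X0 psih_X0 by (metis imageI)
    have pow: "b ^ n \<in> psih ` cS" if "b \<in> psih ` cS" for b n
      using that by (induction n) (auto intro: psih_image_one psih_image_mult)
    have prod: "prod f A \<in> psih ` cS" if "\<And>i. f i \<in> psih ` cS" for f :: "'n \<Rightarrow> 'g" and A
      using that by (induction A rule: infinite_finite_induct) (auto intro: psih_image_one psih_image_mult)
    have mon: "mon X0 \<alpha> \<in> psih ` cS" for \<alpha>
      unfolding mon_def by (intro prod pow gen)
    have zero: "0 \<in> psih ` cS" using cS_zero psih_zero by (metis imageI)
    have sum: "sum f A \<in> psih ` cS" if "\<And>i. f i \<in> psih ` cS" for f :: "('n \<Rightarrow>\<^sub>0 nat) \<Rightarrow> 'g" and A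
      using that by (induction A rule: infinite_finite_induct) (auto intro: zero psih_image_add)
    have "lin (\<lambda>q. theta (\<kappa>f q)) (mon X0) F \<in> psih ` cS" for F
      unfolding lin_def by (rule sum, rule psih_image_mult[OF q mon])
    then show "a \<in> psih ` cS"
      using hom_values(2)[OF theta.field_hom_axioms theta_xg theta_embP, of v] v div by auto
  qed
  have "ZPX \<kappa> X0 \<subseteq> range theta"
  proof (rule ZPX_subset)
    show "1 \<in> range theta" using theta.hom_one by (metis rangeI)
    show "- a \<in> range theta" if "a \<in> range theta" for a
      using that by (auto simp flip: theta.hom_uminus)
    show "a + b \<in> range theta" if "a \<in> range theta" "b \<in> range theta" for a b
      using that by (auto simp flip: theta.hom_add)
    show "a * b \<in> range theta" if "a \<in> range theta" "b \<in> range theta" for a b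
      using that by (auto simp flip: theta.hom_mult)
    show "embP \<kappa> (inP p) \<in> range theta" for p using theta_embP by (metis rangeI)
    show "X0 i \<in> range theta" for i using theta_xg by (metis rangeI)
  qed
  then have quot: "psih0 f \<in> range theta" if "f \<in> ZS" for f using psih0_ZPX[OF that] by blast
  show "psih ` cS \<subseteq> range theta"
  proof
    fix b assume "b \<in> psih ` cS"
    then obtain a where a: "a \<in> cS" "b = psih a" by blast
    obtain f g where "f \<in> ZS" "g \<in> ZS" "psih a = psih0 f / psih0 g" using a(1) by (rule cSE)
    moreover from this quot obtain u v where "psih0 f = theta u" "psih0 g = theta v" by blast
    ultimately have "b = theta (u / v)" by (simp add: a(2) theta.hom_divide)
    then show "b \<in> range theta" by blast
  qed
qed

text \<open>The composite of \<Phi> and \<open>rho\<close> is a homomorphism with the values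
  prescribed for \<open>theta\<close>, so uniqueness identifies the two.\<close>

lemma is_Phi_rho:
  assumes "is_Phi \<kappa>f \<kappa> r D Z X0 xg \<Phi>"
  shows "\<Phi> v \<in> carrier Q" and "rho (\<Phi> v) = theta v"
proof -
  have \<Phi>: "\<Phi> \<in> ring_hom ring_of_type_algebra Q" "\<And>i. \<Phi> (xg i) = cls (X0 i)"
    "\<And>p. \<Phi> (embP \<kappa>f p) = cls (embP \<kappa> (inP p))"
    using assms by (auto simp: is_Phi_def ring_iso_def)
  show in_Q: "\<Phi> v \<in> carrier Q" for v
    using ring_hom_closed[OF \<Phi>(1)] by (simp add: ring_of_type_algebra_def)
  have "rho \<in> ring_hom Q ring_of_type_algebra"
    using rho_iso by (auto simp: ring_iso_def ring_hom_def ring_of_type_algebra_def)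
  from ring_hom_trans[OF \<Phi>(1) this]
  have "(\<lambda>v. rho (\<Phi> v)) \<in> ring_hom ring_of_type_algebra ring_of_type_algebra"
    by (simp add: comp_def)
  then show "rho (\<Phi> v) = theta v"
    by (intro hom_unique)
      (auto simp: field_hom_iff type_hom_ring_hom \<Phi> rho_cls cS_X0 psih_X0 cS_SS SS_inP psih_SS)
qed

lemma is_Phi_eq_cls:
  "is_Phi \<kappa>f \<kappa> r D Z X0 xg \<Phi> \<Longrightarrow> a \<in> cS \<Longrightarrow> psih a = theta v \<Longrightarrow> \<Phi> v = cls a"
  using is_Phi_rho by (intro rho_inj cls_carrier) (auto simp: rho_cls)

text \<open>\<open>theta\<close> and \<open>rho\<close> are injective with the same range, so \<Phi>
  can only be \<open>theta\<close> followed by the inverse of \<open>rho\<close>.\<close>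

lemma Phi_unique_existence: "\<exists>!\<Phi>. is_Phi \<kappa>f \<kappa> r D Z X0 xg \<Phi>"
proof
  let ?T = "ring_of_type_algebra :: 'f ring" and ?R = "ring_of_type_algebra\<lparr>carrier := psih ` cS\<rparr> :: 'g ring"
  let ?\<Phi> = "\<lambda>v. inv_into (carrier Q) rho (theta v)"
  have bij: "bij_betw rho (carrier Q) (psih ` cS)" using rho_iso by (simp add: ring_iso_def)
  have "theta \<in> ring_iso ?T ?R"
    using range_theta by (auto simp: ring_iso_def ring_hom_def ring_of_type_algebra_def bij_betw_def
      inj_on_def theta.hom_add theta.hom_mult)
  moreover have "inv_into (carrier Q) rho \<in> ring_iso ?R Q"
    by (rule ring_iso_set_sym[OF Q_ring rho_iso])
  ultimately have iso: "?\<Phi> \<in> ring_iso ?T Q"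
    using ring_iso_set_trans by (fastforce simp: comp_def)
  have eq: "?\<Phi> v = cls a" if "a \<in> cS" "psih a = theta v" for a v
    using that bij_betw_inv_into_left[OF bij cls_carrier[OF that(1)]] by (simp add: rho_cls)
  have "?\<Phi> (xg i) = cls (X0 i)" for i
    by (rule eq) (simp_all add: cS_X0 psih_X0 theta_xg)
  moreover have "?\<Phi> (embP \<kappa>f p) = cls (embP \<kappa> (inP p))" for p
    by (rule eq) (simp_all only: cS_SS SS_inP psih_SS theta_embP psi_inP)
  ultimately show "is_Phi \<kappa>f \<kappa> r D Z X0 xg ?\<Phi>"
    using iso unfolding is_Phi_def by blast
  fix \<Phi> assume *: "is_Phi \<kappa>f \<kappa> r D Z X0 xg \<Phi>"
  show "\<Phi> = ?\<Phi>"
  proof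
    fix v
    show "\<Phi> v = ?\<Phi> v"
      using bij_betw_inv_into_left[OF bij is_Phi_rho(1)[OF *, of v]] by (simp add: is_Phi_rho(2)[OF *])
  qed
qed

end


section \<open>Mutation of the composite seeds\<close>

lemma semifield_inverse_prod: "inverse (\<Prod>i\<in>A. f i) = (\<Prod>i\<in>A. inverse (f i :: 'p :: semifield))"
  by (induction A rule: infinite_finite_induct)
    (auto simp: semifield_inverse_one semifield_inverse_mult)

lemma semifield_prod_powi: "(\<Prod>i\<in>A. f i powi n) = (\<Prod>i\<in>A. (f i :: 'p :: semifield)) powi n"
  by (simp add: power_int_def prod_power semifield_inverse_prod)

lemma field_prod_powi: "(\<Prod>i\<in>A. f i powi n) = (\<Prod>i\<in>A. (f i :: 'a :: field)) powi n"
  by (simp add: power_int_def prod_power flip: prod_inversef)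

lemma powi_pos: "(a :: 'p :: semifield) powi pos n = a ^ nat n"
  by (auto simp: power_int_def max_def)

lemma Ztrop_ordinary: "Ztrop [:1, 1:] y = 1 + y"
  by (simp add: Ztrop_def one_with_zero_def)

lemma ord_mutation_simps:
  assumes "type_hom \<kappa>"
  shows "sx (ord_mutation \<kappa> k \<sigma>) = (\<lambda>i. if i = k
      then inverse (sx \<sigma> k) * (\<Prod>j\<in>UNIV. sx \<sigma> j powi pos (- sB \<sigma> j k))
        * (1 + embP \<kappa> (sy \<sigma> k) * (\<Prod>j\<in>UNIV. sx \<sigma> j powi sB \<sigma> j k)) / embP \<kappa> (1 + sy \<sigma> k)
      else sx \<sigma> i)"
    and "sy (ord_mutation \<kappa> k \<sigma>) = (\<lambda>i. if i = k then inverse (sy \<sigma> k)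
      else sy \<sigma> i * (sy \<sigma> k powi pos (sB \<sigma> k i) * (1 + sy \<sigma> k) powi (- sB \<sigma> k i)))"
    and "sB (ord_mutation \<kappa> k \<sigma>) = (\<lambda>i j. if i = k \<or> j = k then - sB \<sigma> i j
      else sB \<sigma> i j + (sB \<sigma> i k * pos (sB \<sigma> k j) + pos (- sB \<sigma> i k) * sB \<sigma> k j))"
proof -
  interpret \<kappa>: type_hom \<kappa> by fact
  show "sx (ord_mutation \<kappa> k \<sigma>) = (\<lambda>i. if i = k
      then inverse (sx \<sigma> k) * (\<Prod>j\<in>UNIV. sx \<sigma> j powi pos (- sB \<sigma> j k))
        * (1 + embP \<kappa> (sy \<sigma> k) * (\<Prod>j\<in>UNIV. sx \<sigma> j powi sB \<sigma> j k)) / embP \<kappa> (1 + sy \<sigma> k)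
      else sx \<sigma> i)"
    by (simp add: fun_eq_iff ord_mutation_def gen_mutation_def ord_seed.truncate_def Let_def Ztrop_ordinary
      yhat_def map_poly_pCons)
  show "sy (ord_mutation \<kappa> k \<sigma>) = (\<lambda>i. if i = k then inverse (sy \<sigma> k)
      else sy \<sigma> i * (sy \<sigma> k powi pos (sB \<sigma> k i) * (1 + sy \<sigma> k) powi (- sB \<sigma> k i)))"
    by (simp add: fun_eq_iff ord_mutation_def gen_mutation_def ord_seed.truncate_def Let_def Ztrop_ordinary
      mult.assoc)
  show "sB (ord_mutation \<kappa> k \<sigma>) = (\<lambda>i j. if i = k \<or> j = k then - sB \<sigma> i j
      else sB \<sigma> i j + (sB \<sigma> i k * pos (sB \<sigma> k j) + pos (- sB \<sigma> i k) * sB \<sigma> k j))"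
    by (simp add: fun_eq_iff ord_mutation_def gen_mutation_def ord_seed.truncate_def Let_def)
qed

context composite_base
begin

text \<open>The state after m single mutations within block k. Entries inside the block are 0
  because b k k = 0, hence a mutation there leaves the x- and y-variables of the other members
  untouched and each step uses the original ones. Outside the block every step adds the same
  correction to the matrix, whence the factor m.\<close>

lemma fold_ord_mutation:
  fixes \<sigma> :: "('g, ('p, 'd) pbar, 'd) ord_seed"
  assumes B: "\<And>d e. sB \<sigma> d e = b (ix d) (ix e)" and bkk: "b k k = 0" and m: "m \<le> r k"
  defines "\<tau> \<equiv> fold (\<lambda>l. ord_mutation \<kappa> (D k l)) [1..<Suc m] \<sigma>"
  shows "sx \<tau> = (\<lambda>d. if ix d = k \<and> lx d \<le> m
      then inverse (sx \<sigma> d) * (\<Prod>e\<in>UNIV. sx \<sigma> e powi pos (- b (ix e) k))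
        * (1 + embP \<kappa> (sy \<sigma> d) * (\<Prod>e\<in>UNIV. sx \<sigma> e powi b (ix e) k)) / embP \<kappa> (1 + sy \<sigma> d)
      else sx \<sigma> d) \<and>
    sy \<tau> = (\<lambda>d. if ix d = k then if lx d \<le> m then inverse (sy \<sigma> d) else sy \<sigma> d
      else sy \<sigma> d * (\<Prod>l\<in>{1..m}. sy \<sigma> (D k l) powi pos (b k (ix d))
        * (1 + sy \<sigma> (D k l)) powi (- b k (ix d)))) \<and>
    sB \<tau> = (\<lambda>d e. if ix d = k then if lx d \<le> m then - b k (ix e) else b k (ix e)
      else if ix e = k then if lx e \<le> m then - b (ix d) k else b (ix d) k
      else b (ix d) (ix e) + int m * (b (ix d) k * pos (b k (ix e)) + pos (- b (ix d) k) * b k (ix e)))"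
  using m unfolding \<tau>_def
proof (induction m)
  case 0
  have lx: "lx d \<noteq> 0" for d using lx_ge[of d] by simp
  show ?case by (simp add: B fun_eq_iff lx)
next
  case (Suc m)
  define T where "T = fold (\<lambda>l. ord_mutation \<kappa> (D k l)) [1..<Suc m] \<sigma>"
  let ?d = "D k (Suc m)"
  have d: "ix ?d = k" "lx ?d = Suc m" using Suc.prems by simp_all
  have neq: "ix d = k \<and> lx d \<le> Suc m \<longleftrightarrow> ix d = k \<and> lx d \<le> m" if "d \<noteq> ?d" for d
    using that by (metis D_ix_lx le_Suc_eq)
  have "m \<le> r k" using Suc.prems by simp
  note IH = Suc.IH[OF this, folded T_def]
  have sx: "sx T e = (if ix e = k \<and> lx e \<le> m
      then inverse (sx \<sigma> e) * (\<Prod>e\<in>UNIV. sx \<sigma> e powi pos (- b (ix e) k))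
        * (1 + embP \<kappa> (sy \<sigma> e) * (\<Prod>e\<in>UNIV. sx \<sigma> e powi b (ix e) k)) / embP \<kappa> (1 + sy \<sigma> e)
      else sx \<sigma> e)" for e
    using IH by simp
  have sy: "sy T e = (if ix e = k then if lx e \<le> m then inverse (sy \<sigma> e) else sy \<sigma> e
      else sy \<sigma> e * (\<Prod>l\<in>{1..m}. sy \<sigma> (D k l) powi pos (b k (ix e))
        * (1 + sy \<sigma> (D k l)) powi (- b k (ix e))))" for e
    using IH by simp
  have sB: "sB T e f = (if ix e = k then if lx e \<le> m then - b k (ix f) else b k (ix f)
      else if ix f = k then if lx f \<le> m then - b (ix e) k else b (ix e) k
      else b (ix e) (ix f) + int m * (b (ix e) k * pos (b k (ix f)) + pos (- b (ix e) k) * b k (ix f)))"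
    for e f
    using IH by simp
  \<comment> \<open>The column of the next direction vanishes on block k and is still unmutated
    elsewhere.\<close>
  have col: "sB T e ?d = (if ix e = k then 0 else b (ix e) k)" for e
    by (simp add: sB d bkk)
  have row: "sB T ?d e = b k (ix e)" for e
    by (simp add: sB d)
  \<comment> \<open>The variables already changed by earlier steps belong to block k and occur with
    exponent 0.\<close>
  have P: "(\<Prod>e\<in>UNIV. sx T e powi pos (- sB T e ?d)) = (\<Prod>e\<in>UNIV. sx \<sigma> e powi pos (- b (ix e) k))"
    by (intro prod.cong refl) (auto simp: col sx bkk)
  have M: "(\<Prod>e\<in>UNIV. sx T e powi sB T e ?d) = (\<Prod>e\<in>UNIV. sx \<sigma> e powi b (ix e) k)"
    by (intro prod.cong refl) (auto simp: col sx bkk)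
  have step: "fold (\<lambda>l. ord_mutation \<kappa> (D k l)) [1..<Suc (Suc m)] \<sigma> = ord_mutation \<kappa> ?d T"
    by (simp add: T_def)
  have sxd: "sx T ?d = sx \<sigma> ?d" and syd: "sy T ?d = sy \<sigma> ?d"
    using d by (simp_all add: sx sy)
  show ?case
    unfolding step ord_mutation_simps[OF kappa] P M sxd syd row
  proof (intro conjI ext)
    fix e
    show "(if e = ?d
        then inverse (sx \<sigma> ?d) * (\<Prod>e\<in>UNIV. sx \<sigma> e powi pos (- b (ix e) k))
          * (1 + embP \<kappa> (sy \<sigma> ?d) * (\<Prod>e\<in>UNIV. sx \<sigma> e powi b (ix e) k)) / embP \<kappa> (1 + sy \<sigma> ?d)
        else sx T e) =
      (if ix e = k \<and> lx e \<le> Suc m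
        then inverse (sx \<sigma> e) * (\<Prod>e\<in>UNIV. sx \<sigma> e powi pos (- b (ix e) k))
          * (1 + embP \<kappa> (sy \<sigma> e) * (\<Prod>e\<in>UNIV. sx \<sigma> e powi b (ix e) k)) / embP \<kappa> (1 + sy \<sigma> e)
        else sx \<sigma> e)"
      using d neq[of e] by (cases "e = ?d") (simp_all only: sx if_True if_False simp_thms le_refl)
    show "(if e = ?d then inverse (sy \<sigma> ?d)
        else sy T e * (sy \<sigma> ?d powi pos (b k (ix e)) * (1 + sy \<sigma> ?d) powi (- b k (ix e)))) =
      (if ix e = k then if lx e \<le> Suc m then inverse (sy \<sigma> e) else sy \<sigma> e
        else sy \<sigma> e * (\<Prod>l\<in>{1..Suc m}. sy \<sigma> (D k l) powi pos (b k (ix e))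
          * (1 + sy \<sigma> (D k l)) powi (- b k (ix e))))"
    proof (cases "e = ?d")
      case False
      then show ?thesis
        using neq[of e] by (cases "ix e = k") (simp_all add: sy bkk mult_ac)
    qed (simp add: d)
    fix f
    show "(if e = ?d \<or> f = ?d then - sB T e f
        else sB T e f + (sB T e ?d * pos (b k (ix f)) + pos (- sB T e ?d) * b k (ix f))) =
      (if ix e = k then if lx e \<le> Suc m then - b k (ix f) else b k (ix f)
        else if ix f = k then if lx f \<le> Suc m then - b (ix e) k else b (ix e) k
        else b (ix e) (ix f) +
          int (Suc m) * (b (ix e) k * pos (b k (ix f)) + pos (- b (ix e) k) * b k (ix f)))"
    proof (cases "e = ?d \<or> f = ?d")
      case True
      then show ?thesis using d by (auto simp: sB bkk)
    next
      case False
      then show ?thesis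
        using neq[of e] neq[of f]
        by (cases "ix e = k"; cases "ix f = k") (simp_all add: sB col bkk d algebra_simps)
    qed
  qed
qed

section \<open>Images of the y-variables and of the exchange binomials\<close>

lemma embP_mult: "embP \<kappa> (p * q) = embP \<kappa> p * embP \<kappa> q"
  by (simp add: gr_mult \<kappa>.hom_mult)

lemma embP_inverse: "embP \<kappa> (inverse p) = inverse (embP \<kappa> p)"
proof -
  have "embP \<kappa> (inverse p) * embP \<kappa> p = 1"
    unfolding embP_mult [symmetric] by (simp add: semifield_left_inverse)
  then show ?thesis by (metis inverse_unique mult.commute)
qed

lemma embP_prod: "embP \<kappa> (prod f A) = (\<Prod>i\<in>A. embP \<kappa> (f i))"
  by (induction A rule: infinite_finite_induct) (simp_all add: embP_mult del: to_fract_mult)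

lemma embP_power: "embP \<kappa> (p ^ n) = embP \<kappa> p ^ n"
  by (induction n) (simp_all add: embP_mult del: to_fract_mult)

text \<open>
  In every composite seed, the \<open>y\<close>-variables belonging to one index \<open>i\<close> have this form, with the same
  \<open>\<epsilon>\<close> and \<open>w\<close>.
\<close>

definition branch :: "bool \<Rightarrow> ('p, 'd) pbar \<Rightarrow> 'd \<Rightarrow> ('p, 'd) pbar" where
  "branch \<epsilon> w d = (if \<epsilon> then svar d else inverse (svar d)) * w"

definition exch_poly :: "bool \<Rightarrow> 'n \<Rightarrow> 'p group_ring poly" where
  "exch_poly \<epsilon> i = (if \<epsilon> then Z i else reflect_poly (Z i))"

lemma inverse_branch: "inverse (branch \<epsilon> w d) = branch (\<not> \<epsilon>) (inverse w) d"
  by (simp add: branch_def semifield_inverse_mult semifield_inverse_inverse)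

lemma reflect_exch_poly: "reflect_poly (exch_poly \<epsilon> i) = exch_poly (\<not> \<epsilon>) i"
  by (simp add: exch_poly_def Z_0)

text \<open>The factors \<open>svar\<close> combine to the full product or its inverse, which psi
  sends to 1 in either case; only the power of w survives.\<close>

lemma SS_prod_branch: "w \<in> SS r D Z \<Longrightarrow> (\<Prod>l\<in>{1..r i}. branch \<epsilon> w (D i l)) \<in> SS r D Z"
  and psi_prod_branch: "w \<in> SS r D Z \<Longrightarrow>
    psi r D Z (\<Prod>l\<in>{1..r i}. branch \<epsilon> w (D i l)) = psi r D Z w ^ r i"
proof -
  assume w: "w \<in> SS r D Z"
  let ?E = "\<Prod>l\<in>{1..r i}. svar (D i l) :: ('p, 'd) pbar"
  have eq: "(\<Prod>l\<in>{1..r i}. branch \<epsilon> w (D i l)) = (if \<epsilon> then ?E else inverse ?E) * w ^ r i"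
    by (simp add: branch_def prod.distrib semifield_inverse_prod)
  show "(\<Prod>l\<in>{1..r i}. branch \<epsilon> w (D i l)) \<in> SS r D Z"
    unfolding eq
    by (intro SS_mult SS_power w) (simp add: SS_inverse SS_prod_svar del: One_nat_def)
  have E: "(if \<epsilon> then ?E else inverse ?E) \<in> SS r D Z" "psi r D Z (if \<epsilon> then ?E else inverse ?E) = 1"
    using SS_prod_svar psi_prod_svar
    by (simp_all add: SS_inverse psi_inverse semifield_inverse_one del: One_nat_def)
  show "psi r D Z (\<Prod>l\<in>{1..r i}. branch \<epsilon> w (D i l)) = psi r D Z w ^ r i"
    unfolding eq by (simp only: psi_mult E SS_power psi_power w mult_1_left)
qed

text \<open>Reduces an inverted branch to a straight one at the inverse of w. Over a whole family
  the extracted factors have the image y^r that appears in \<open>Ztrop_reflect\<close>.\<close>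

lemma one_plus_branch: "1 + branch False w d = branch False w d * (1 + svar d * inverse w)"
proof -
  have "branch False w d * (svar d * inverse w) = (inverse (svar d) * svar d) * (w * inverse w)"
    by (simp add: branch_def mult_ac)
  then show ?thesis
    by (simp add: distrib_left semifield_left_inverse semifield_right_inverse add.commute)
qed

lemma
  assumes w: "w \<in> SS r D Z"
  shows SS_prod_one_plus_branch: "(\<Prod>l\<in>{1..r i}. 1 + branch \<epsilon> w (D i l)) \<in> SS r D Z"
    and psi_prod_one_plus_branch:
      "psi r D Z (\<Prod>l\<in>{1..r i}. 1 + branch \<epsilon> w (D i l)) = Ztrop (exch_poly \<epsilon> i) (psi r D Z w)"
proof -
  have *: "(\<Prod>l\<in>{1..r i}. 1 + branch \<epsilon> w (D i l)) \<in> SS r D Z \<and>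
    psi r D Z (\<Prod>l\<in>{1..r i}. 1 + branch \<epsilon> w (D i l)) = Ztrop (exch_poly \<epsilon> i) (psi r D Z w)"
  proof (cases \<epsilon>)
    case True
    then show ?thesis
      using SS_prod_one_plus[OF w] psi_prod_one_plus[OF w] by (simp add: branch_def exch_poly_def)
  next
    case False
    have eq: "(\<Prod>l\<in>{1..r i}. 1 + branch False w (D i l)) =
        (\<Prod>l\<in>{1..r i}. branch False w (D i l)) * (\<Prod>l\<in>{1..r i}. 1 + svar (D i l) * inverse w)"
      unfolding one_plus_branch prod.distrib ..
    have "exch_poly False i = reflect_poly (Z i)" by (simp add: exch_poly_def)
    moreover have "\<epsilon> = False" using False by simp
    ultimately show ?thesis
      using w
      by (simp only: eq SS_mult SS_prod_branch SS_prod_one_plus SS_inverse psi_mult psi_prod_branch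
        psi_prod_one_plus psi_inverse Ztrop_reflect simp_thms)
  qed
  then show "(\<Prod>l\<in>{1..r i}. 1 + branch \<epsilon> w (D i l)) \<in> SS r D Z"
    "psi r D Z (\<Prod>l\<in>{1..r i}. 1 + branch \<epsilon> w (D i l)) = Ztrop (exch_poly \<epsilon> i) (psi r D Z w)"
    by blast+
qed

lemma emb_eq_0: "emb c = 0 \<Longrightarrow> c = 0"
  by (simp add: emb_def inj_inZP)

lemma degree_map_Z: "Polynomial.degree (map_poly emb (Z i)) = r i"
  by (subst degree_map_poly) (auto simp: Z_degree dest: emb_eq_0)

lemma map_reflect_Z: "map_poly emb (reflect_poly (Z i)) = reflect_poly (map_poly emb (Z i))"
  by (rule poly_eqI) (simp add: coeff_map_poly coeff_reflect_poly degree_map_Z Z_degree)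

text \<open>The field version of the tropical computation: the product is the sum of the
  \<open>ehat\<close> times v^l, and psihat replaces each \<open>ehat\<close> by the coefficient of
  Z i. The case l = 0 is separate, as \<open>ehat\<close> is a generator for positive l
  only.\<close>

lemma
  assumes v: "v \<in> cS"
  shows cS_prod_one_plus: "(\<Prod>l\<in>{1..r i}. 1 + embP \<kappa> (svar (D i l)) * v) \<in> cS"
    and psih_prod_one_plus:
      "psih (\<Prod>l\<in>{1..r i}. 1 + embP \<kappa> (svar (D i l)) * v) = poly (map_poly emb (Z i)) (psih v)"
proof -
  have hom: "type_hom (\<lambda>c :: ('p, 'd) pbar group_ring. \<kappa> (to_fract c))"
    by (rule type_hom_compose[OF kappa type_hom_to_fract])
  have e: "elem_sym l {1..r i} (\<lambda>m. embP \<kappa> (svar (D i m))) \<in> cS"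
    "psih (elem_sym l {1..r i} (\<lambda>m. embP \<kappa> (svar (D i m)))) = emb (Polynomial.coeff (Z i) l)"
    if "l \<le> r i" for l
  proof -
    have "elem_sym l {1..r i} (\<lambda>m. embP \<kappa> (svar (D i m))) = \<kappa> (to_fract (ehat r D i l))"
      unfolding ehat_def type_hom.hom_elem_sym[OF hom] ..
    then show "elem_sym l {1..r i} (\<lambda>m. embP \<kappa> (svar (D i m))) \<in> cS"
      "psih (elem_sym l {1..r i} (\<lambda>m. embP \<kappa> (svar (D i m)))) = emb (Polynomial.coeff (Z i) l)"
      using that by (cases "l = 0"; simp add: cS_ehat psih_ehat cS_one Z_0)+
  qed
  have eq: "(\<Prod>l\<in>{1..r i}. 1 + embP \<kappa> (svar (D i l)) * v) =
      (\<Sum>l\<le>r i. elem_sym l {1..r i} (\<lambda>m. embP \<kappa> (svar (D i m))) * v ^ l)"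
    by (subst prod_one_plus) simp_all
  show "(\<Prod>l\<in>{1..r i}. 1 + embP \<kappa> (svar (D i l)) * v) \<in> cS"
    unfolding eq by (intro cS_sum cS_mult cS_power v e) simp
  have "psih (\<Prod>l\<in>{1..r i}. 1 + embP \<kappa> (svar (D i l)) * v) =
      (\<Sum>l\<le>r i. emb (Polynomial.coeff (Z i) l) * psih v ^ l)"
    unfolding eq
    by (subst psih_sum) (auto simp: cS_mult cS_power v e psih_mult psih_power simp del: One_nat_def intro!: sum.cong)
  also have "\<dots> = poly (map_poly emb (Z i)) (psih v)"
    by (simp add: poly_altdef degree_map_Z coeff_map_poly)
  finally show "psih (\<Prod>l\<in>{1..r i}. 1 + embP \<kappa> (svar (D i l)) * v) = poly (map_poly emb (Z i)) (psih v)" .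
qed

text \<open>In the reflected case each binomial is divided by its second term, which substitutes the
  inverse of w M for the argument; this is where the image of M has to be nonzero.\<close>

lemma
  assumes w: "w \<in> SS r D Z" and M: "M \<in> cS" "psih M \<noteq> 0"
  shows cS_prod_branch: "(\<Prod>l\<in>{1..r i}. 1 + embP \<kappa> (branch \<epsilon> w (D i l)) * M) \<in> cS"
    and psih_prod_branch: "psih (\<Prod>l\<in>{1..r i}. 1 + embP \<kappa> (branch \<epsilon> w (D i l)) * M) =
      poly (map_poly emb (exch_poly \<epsilon> i)) (embP \<kappa> (inP (psi r D Z w)) * psih M)"
proof -
  let ?v = "embP \<kappa> w * M"
  have v: "?v \<in> cS" "psih ?v = embP \<kappa> (inP (psi r D Z w)) * psih M" "psih ?v \<noteq> 0"
    using M w by (simp_all add: cS_mult cS_SS psih_mult psih_SS gr_nonzero)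
  have *: "(\<Prod>l\<in>{1..r i}. 1 + embP \<kappa> (branch \<epsilon> w (D i l)) * M) \<in> cS \<and>
    psih (\<Prod>l\<in>{1..r i}. 1 + embP \<kappa> (branch \<epsilon> w (D i l)) * M) =
      poly (map_poly emb (exch_poly \<epsilon> i)) (psih ?v)"
  proof (cases \<epsilon>)
    case True
    then have "(\<Prod>l\<in>{1..r i}. 1 + embP \<kappa> (branch \<epsilon> w (D i l)) * M) =
        (\<Prod>l\<in>{1..r i}. 1 + embP \<kappa> (svar (D i l)) * ?v)"
      by (intro prod.cong refl) (simp only: branch_def if_True embP_mult mult.assoc)
    then show ?thesis
      using True cS_prod_one_plus[OF v(1)] psih_prod_one_plus[OF v(1)] by (simp add: exch_poly_def)
  next
    case False
    let ?N = "\<Prod>l\<in>{1..r i}. embP \<kappa> (branch False w (D i l)) * M"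
    have nz: "embP \<kappa> w \<noteq> 0" "M \<noteq> 0" and s: "embP \<kappa> (svar (D i l)) \<noteq> 0" for l
      using M by (auto simp: gr_nonzero)
    have "1 + inverse t * u * M = (inverse t * u * M) * (1 + t * inverse (u * M))"
      if "t \<noteq> 0" "u \<noteq> 0" for t u :: 'g
      using that nz by (simp add: field_simps)
    then have "1 + embP \<kappa> (branch False w (D i l)) * M =
        (embP \<kappa> (branch False w (D i l)) * M) * (1 + embP \<kappa> (svar (D i l)) * inverse ?v)" for l
      unfolding branch_def if_False embP_mult embP_inverse using nz(1) s[of l] by blast
    then have eq: "(\<Prod>l\<in>{1..r i}. 1 + embP \<kappa> (branch \<epsilon> w (D i l)) * M) =
        ?N * (\<Prod>l\<in>{1..r i}. 1 + embP \<kappa> (svar (D i l)) * inverse ?v)"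
      using False by (simp add: prod.distrib)
    have "?N = embP \<kappa> (\<Prod>l\<in>{1..r i}. branch False w (D i l)) * M ^ r i"
      by (simp add: prod.distrib embP_prod)
    then have N: "?N \<in> cS" "psih ?N = psih ?v ^ r i"
      using M w SS_prod_branch[OF w, of False i] psi_prod_branch[OF w, of False i]
      by (simp_all only: cS_mult cS_SS cS_power psih_mult psih_SS psih_power v(2) power_mult_distrib)
        (simp only: inP_power embP_power)
    have inv: "inverse ?v \<in> cS" "psih (inverse ?v) = inverse (psih ?v)"
      by (rule cS_inverse[OF v(1,3)], rule psih_inverse[OF v(1,3)])
    have "poly (map_poly emb (exch_poly \<epsilon> i)) (psih ?v) =
        psih ?v ^ r i * poly (map_poly emb (Z i)) (inverse (psih ?v))"
      using False v(3) by (simp add: exch_poly_def map_reflect_Z poly_reflect_poly_nz degree_map_Z)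
    then show ?thesis
      unfolding eq using N inv cS_prod_one_plus[OF inv(1)] psih_prod_one_plus[OF inv(1)]
      by (simp only: cS_mult psih_mult simp_thms)
  qed
  then show "(\<Prod>l\<in>{1..r i}. 1 + embP \<kappa> (branch \<epsilon> w (D i l)) * M) \<in> cS"
    "psih (\<Prod>l\<in>{1..r i}. 1 + embP \<kappa> (branch \<epsilon> w (D i l)) * M) =
      poly (map_poly emb (exch_poly \<epsilon> i)) (embP \<kappa> (inP (psi r D Z w)) * psih M)"
    using v(2) by auto
qed

end


lemma (in type_hom) hom_poly: "h 0 = 0 \<Longrightarrow> h (poly p v) = poly (map_poly h p) (h v)"
  by (induction p) (simp_all add: hom_add hom_mult map_poly_pCons)

section \<open>The induction invariant and its preservation under mutation\<close>

context composite_iso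
begin

text \<open>\<open>\<epsilon> i\<close> flips with each mutation in direction i and couples the
  exponent of \<open>svar\<close> to the reflection of Z i. Of \<open>w\<close> only the image under
  psi is prescribed, and x-variables are compared through their products over a family.\<close>

definition matches :: "('f, 'p, 'n) gen_seed \<Rightarrow> ('g, ('p, 'd) pbar, 'd) ord_seed \<Rightarrow> bool" where
  "matches \<sigma> \<tau> \<longleftrightarrow>
    (\<exists>\<epsilon> w. (\<forall>i. w i \<in> SS r D Z \<and> psi r D Z (w i) = sy \<sigma> i \<and> sZ \<sigma> i = exch_poly (\<epsilon> i) i) \<and>
      (\<forall>d. sy \<tau> d = branch (\<epsilon> (ix d)) (w (ix d)) d)) \<and>
    (\<forall>d e. sB \<tau> d e = sB \<sigma> (ix d) (ix e)) \<and>
    (\<forall>i. bigX r D \<tau> i \<in> cS \<and> psih (bigX r D \<tau> i) = theta (sx \<sigma> i))"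

lemma matches_mutation:
  assumes "matches \<sigma> \<tau>" and bkk: "sB \<sigma> k k = 0" and nz: "\<And>i. sx \<sigma> i \<noteq> 0"
  shows "matches (gen_mutation \<kappa>f r k \<sigma>) (comp_mutation \<kappa> r D k \<tau>)"
proof -
  obtain \<epsilon> w where w: "\<And>i. w i \<in> SS r D Z" and psi_w: "\<And>i. psi r D Z (w i) = sy \<sigma> i"
    and sZ: "\<And>i. sZ \<sigma> i = exch_poly (\<epsilon> i) i"
    and sy: "\<And>d. sy \<tau> d = branch (\<epsilon> (ix d)) (w (ix d)) d"
    and sB: "\<And>d e. sB \<tau> d e = sB \<sigma> (ix d) (ix e)"
    and cX: "\<And>i. bigX r D \<tau> i \<in> cS" and psih_X: "\<And>i. psih (bigX r D \<tau> i) = theta (sx \<sigma> i)"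
    using assms(1) unfolding matches_def by blast
  let ?b = "sB \<sigma>" and ?\<sigma> = "gen_mutation \<kappa>f r k \<sigma>" and ?\<tau> = "comp_mutation \<kappa> r D k \<tau>"
  let ?z = "Ztrop (sZ \<sigma> k) (sy \<sigma> k)" and ?X = "bigX r D \<tau>"
  let ?y = "\<lambda>l. branch (\<epsilon> k) (w k) (D k l)"
  let ?F = "\<lambda>i. (\<Prod>l\<in>{1..r k}. ?y l) powi pos (?b k i) * (\<Prod>l\<in>{1..r k}. 1 + ?y l) powi (- ?b k i)"
  define P where "P = (\<Prod>e\<in>UNIV. sx \<tau> e powi pos (- ?b (ix e) k))"
  define M where "M = (\<Prod>e\<in>UNIV. sx \<tau> e powi ?b (ix e) k)"
  \<comment> \<open>With m = r k the bound in \<open>fold_ord_mutation\<close> holds on all of block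
    k, so its case distinctions collapse.\<close>
  have lx_r: "ix d = k \<Longrightarrow> lx d \<le> r k" for d using lx_le[of d] by simp
  have syD: "sy \<tau> (D k l) = ?y l" if "l \<in> {1..r k}" for l using that by (simp add: sy)
  note desc = fold_ord_mutation[of \<tau> ?b k "r k", OF sB bkk order_refl,
      folded comp_mutation_def, folded P_def M_def]
  have sx': "sx ?\<tau> d = (if ix d = k then inverse (sx \<tau> d) * P * (1 + embP \<kappa> (sy \<tau> d) * M) /
      embP \<kappa> (1 + sy \<tau> d) else sx \<tau> d)" for d
    using desc lx_r[of d] by simp
  have sy': "sy ?\<tau> d = (if ix d = k then inverse (sy \<tau> d) else sy \<tau> d * ?F (ix d))" for d
  proof (cases "ix d = k")
    case True
    then show ?thesis using desc lx_r[of d] by simp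
  next
    case False
    have "(\<Prod>l\<in>{1..r k}. sy \<tau> (D k l) powi pos (?b k (ix d)) * (1 + sy \<tau> (D k l)) powi (- ?b k (ix d))) =
        (\<Prod>l\<in>{1..r k}. ?y l powi pos (?b k (ix d)) * (1 + ?y l) powi (- ?b k (ix d)))"
      by (intro prod.cong refl) (simp only: syD)
    also have "\<dots> = ?F (ix d)" by (simp only: prod.distrib semifield_prod_powi)
    finally show ?thesis using desc False by simp
  qed
  have sB': "sB ?\<tau> d e = sB ?\<sigma> (ix d) (ix e)" for d e
    using desc lx_r[of d] lx_r[of e] by (auto simp: gen_mutation_def Let_def)
  have F: "?F i \<in> SS r D Z" "psi r D Z (?F i) = (sy \<sigma> k powi pos (?b k i)) ^ r k * ?z powi (- ?b k i)" for i
  proof -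
    have 1: "(\<Prod>l\<in>{1..r k}. ?y l) \<in> SS r D Z" "psi r D Z (\<Prod>l\<in>{1..r k}. ?y l) = sy \<sigma> k ^ r k"
      "(\<Prod>l\<in>{1..r k}. 1 + ?y l) \<in> SS r D Z" "psi r D Z (\<Prod>l\<in>{1..r k}. 1 + ?y l) = ?z"
      by (simp_all only: SS_prod_branch psi_prod_branch SS_prod_one_plus_branch
        psi_prod_one_plus_branch w psi_w sZ)
    show "?F i \<in> SS r D Z" by (intro SS_mult SS_powi 1)
    have "psi r D Z (?F i) = (sy \<sigma> k ^ r k) powi pos (?b k i) * ?z powi (- ?b k i)"
      by (simp only: psi_mult SS_powi psi_powi 1)
    then show "psi r D Z (?F i) = (sy \<sigma> k powi pos (?b k i)) ^ r k * ?z powi (- ?b k i)"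
      by (simp only: powi_pos power_mult [symmetric] mult.commute)
  qed
  \<comment> \<open>In direction k inversion flips both the branch and w; in the other directions
    the new factor does not depend on l and is absorbed into w.\<close>
  define w' where "w' i = (if i = k then inverse (w k) else w i * ?F i)" for i
  define \<epsilon>' where "\<epsilon>' i = (if i = k then \<not> \<epsilon> k else \<epsilon> i)" for i
  have "w' i \<in> SS r D Z \<and> psi r D Z (w' i) = sy ?\<sigma> i \<and> sZ ?\<sigma> i = exch_poly (\<epsilon>' i) i" for i
  proof (cases "i = k")
    case True
    then show ?thesis
      using w psi_w by (simp add: w'_def \<epsilon>'_def gen_mutation_def Let_def SS_inverse psi_inverse sZ
        reflect_exch_poly)
  next
    case False
    then have "sy ?\<sigma> i = sy \<sigma> i * ((sy \<sigma> k powi pos (?b k i)) ^ r k * ?z powi (- ?b k i))"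
      by (simp add: gen_mutation_def Let_def mult.assoc)
    moreover have "w' i = w i * ?F i" "\<epsilon>' i = \<epsilon> i" "sZ ?\<sigma> i = sZ \<sigma> i"
      using False by (simp_all add: w'_def \<epsilon>'_def gen_mutation_def Let_def)
    ultimately show ?thesis by (simp only: SS_mult psi_mult w psi_w F sZ simp_thms)
  qed
  moreover have "sy ?\<tau> d = branch (\<epsilon>' (ix d)) (w' (ix d)) d" for d
  proof (cases "ix d = k")
    case True
    then show ?thesis by (simp add: sy' sy \<epsilon>'_def w'_def inverse_branch)
  next
    case False
    then have "sy ?\<tau> d = branch (\<epsilon> (ix d)) (w (ix d)) d * ?F (ix d)" by (simp only: sy' sy if_False)
    then show ?thesis using False by (simp only: \<epsilon>'_def w'_def if_False branch_def mult.assoc)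
  qed
  moreover have "bigX r D ?\<tau> i \<in> cS \<and> psih (bigX r D ?\<tau> i) = theta (sx ?\<sigma> i)" for i
  proof (cases "i = k")
    case False
    then have "bigX r D ?\<tau> i = ?X i" unfolding bigX_def by (intro prod.cong refl) (simp add: sx')
    moreover have "sx ?\<sigma> i = sx \<sigma> i" using False by (simp add: gen_mutation_def Let_def)
    ultimately show ?thesis using cX psih_X by simp
  next
    case True
    \<comment> \<open>Negative powers and inverses of X are admissible in the algebra of fractions
      only because the cluster variables are nonzero.\<close>
    have X_nz: "psih (?X j) \<noteq> 0" for j using nz by (simp add: psih_X)
    \<comment> \<open>Exponents depend only on the family, so the x-variables of each family combine
      to powers of X.\<close>
    have P: "P = (\<Prod>j\<in>UNIV. ?X j powi pos (- ?b j k))" and M: "M = (\<Prod>j\<in>UNIV. ?X j powi ?b j k)"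
      by (simp_all add: P_def M_def prod_D field_prod_powi bigX_def)
    have cP: "P \<in> cS" "psih P = theta (\<Prod>j\<in>UNIV. sx \<sigma> j powi pos (- ?b j k))"
      unfolding P using cX X_nz
      by (simp_all add: cS_prod cS_powi psih_prod psih_powi psih_X theta.hom_prod theta.hom_powi)
    have cM: "M \<in> cS" "psih M = theta (\<Prod>j\<in>UNIV. sx \<sigma> j powi ?b j k)"
      unfolding M using cX X_nz
      by (simp_all add: cS_prod cS_powi psih_prod psih_powi psih_X theta.hom_prod theta.hom_powi)
    have M_nz: "psih M \<noteq> 0"
      unfolding cM(2) theta.hom_eq_0_iff using nz by (simp add: power_int_eq_0_iff)
    let ?N = "\<Prod>l\<in>{1..r k}. 1 + embP \<kappa> (?y l) * M" and ?E = "embP \<kappa> (\<Prod>l\<in>{1..r k}. 1 + ?y l)"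
    have "bigX r D ?\<tau> k = (\<Prod>l\<in>{1..r k}. inverse (sx \<tau> (D k l)) * P * (1 + embP \<kappa> (?y l) * M) / embP \<kappa> (1 + ?y l))"
      unfolding bigX_def by (intro prod.cong refl) (simp add: sx' sy)
    \<comment> \<open>P and M are the same for all members of block k, so multiplying the exchange
      relations gives the power of P and the product of the binomials.\<close>
    also have "\<dots> = inverse (?X k) * P ^ r k * ?N / ?E"
      unfolding embP_prod bigX_def by (simp add: prod.distrib prod_dividef prod_inversef[symmetric] comp_def)
    finally have X': "bigX r D ?\<tau> k = inverse (?X k) * P ^ r k * ?N / ?E" .
    have N: "?N \<in> cS" "psih ?N = poly (map_poly emb (sZ \<sigma> k)) (embP \<kappa> (inP (sy \<sigma> k)) * psih M)"
      unfolding sZ psi_w [symmetric]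
      using cS_prod_branch[OF w cM(1) M_nz] psih_prod_branch[OF w cM(1) M_nz] by blast+
    have E: "?E \<in> cS" "psih ?E = embP \<kappa> (inP ?z)"
      by (simp_all only: cS_SS psih_SS SS_prod_one_plus_branch psi_prod_one_plus_branch w psi_w sZ)
    have E_nz: "psih ?E \<noteq> 0" unfolding E(2) by (rule embP_nonzero)
    have c: "inverse (?X k) \<in> cS" "P ^ r k \<in> cS" "inverse (?X k) * P ^ r k \<in> cS"
      "inverse (?X k) * P ^ r k * ?N \<in> cS"
      by (intro cS_mult cS_inverse cS_power cX X_nz cP N)+
    have "bigX r D ?\<tau> k \<in> cS"
      unfolding X' by (rule cS_divide[OF c(4) E(1) E_nz])
    moreover have "psih (bigX r D ?\<tau> k) = inverse (theta (sx \<sigma> k)) * psih P ^ r k * psih ?N / psih ?E"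
      unfolding X' psih_divide[OF c(4) E(1) E_nz] psih_mult[OF c(3) N(1)] psih_mult[OF c(1,2)]
        psih_inverse[OF cX X_nz] psih_power[OF cP(1)] psih_X ..
    moreover have "psih ?N = theta (poly (map_poly (\<lambda>c. \<kappa>f (to_fract c)) (sZ \<sigma> k)) (yhat \<kappa>f \<sigma> k))"
    proof -
      have "theta (yhat \<kappa>f \<sigma> k) = embP \<kappa> (inP (sy \<sigma> k)) * psih M"
        by (simp only: yhat_def theta.hom_mult theta_embP cM)
      moreover have "map_poly theta (map_poly (\<lambda>c. \<kappa>f (to_fract c)) (sZ \<sigma> k)) = map_poly emb (sZ \<sigma> k)"
        by (simp add: map_poly_map_poly comp_def theta_emb)
      ultimately show ?thesis unfolding N(2) by (simp only: theta.hom_poly theta.hom_zero)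
    qed
    moreover have "sx ?\<sigma> k = inverse (sx \<sigma> k) * (\<Prod>j\<in>UNIV. sx \<sigma> j powi pos (- ?b j k)) ^ r k *
        poly (map_poly (\<lambda>c. \<kappa>f (to_fract c)) (sZ \<sigma> k)) (yhat \<kappa>f \<sigma> k) / embP \<kappa>f ?z"
      by (simp add: gen_mutation_def Let_def)
    ultimately show ?thesis
      unfolding True
      by (simp only: theta.hom_divide theta.hom_mult theta.hom_inverse theta.hom_power cP(2) E(2)
        theta_embP simp_thms)
  qed
  ultimately show ?thesis unfolding matches_def using sB' by blast
qed

lemma matches_Phi:
  assumes "matches \<sigma> \<tau>" and \<Phi>: "is_Phi \<kappa>f \<kappa> r D Z X0 xg \<Phi>"
  shows "\<Phi> (embP \<kappa>f (sy \<sigma> i)) = rootS \<kappa> r D Z X0 (r i) (cls (embP \<kappa> (\<Prod>l\<in>{1..r i}. sy \<tau> (D i l))))"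
    and "\<Phi> (sx \<sigma> i) = cls (bigX r D \<tau> i)"
proof -
  obtain \<epsilon> w where w: "\<And>i. w i \<in> SS r D Z" and psi_w: "\<And>i. psi r D Z (w i) = sy \<sigma> i"
    and sy: "\<And>d. sy \<tau> d = branch (\<epsilon> (ix d)) (w (ix d)) d"
    using assms(1) unfolding matches_def by blast
  have eq: "(\<Prod>l\<in>{1..r i}. sy \<tau> (D i l)) = (\<Prod>l\<in>{1..r i}. branch (\<epsilon> i) (w i) (D i l))"
    by (intro prod.cong refl) (simp add: sy)
  have "0 < r i" using r_pos[of i] by simp
  then show "\<Phi> (embP \<kappa>f (sy \<sigma> i)) =
      rootS \<kappa> r D Z X0 (r i) (cls (embP \<kappa> (\<Prod>l\<in>{1..r i}. sy \<tau> (D i l))))"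
    unfolding eq using \<Phi> root_cls[OF SS_prod_branch[OF w] psi_prod_branch[OF w], of i]
    by (simp only: psi_w is_Phi_def)
  show "\<Phi> (sx \<sigma> i) = cls (bigX r D \<tau> i)"
    using assms by (intro is_Phi_eq_cls) (auto simp: matches_def)
qed

end

lemma free_generating_nonzero:
  fixes \<kappa> :: "'p :: semifield qfield \<Rightarrow> 'f :: field" and x :: "'n :: finite \<Rightarrow> 'f"
  assumes "free_generating \<kappa> x"
  shows "x i \<noteq> 0"
proof
  assume i: "x i = 0"
  let ?F = "Poly_Mapping.single (Poly_Mapping.single i 1) 1 :: ('n \<Rightarrow>\<^sub>0 nat) \<Rightarrow>\<^sub>0 'p qfield"
  have "poly_eval \<kappa> x ?F = \<kappa> 1 * mon x (Poly_Mapping.single i 1)"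
    by (simp add: poly_eval_def mon_def)
  also have "\<dots> = 0" using i by simp
  finally have "?F = 0" using assms by (auto simp: free_generating_def)
  then show False by (metis lookup_single_eq lookup_zero one_neq_zero)
qed

lemma skew_symmetrizable_diagonal: "skew_symmetrizable B \<Longrightarrow> B k k = 0"
proof -
  assume "skew_symmetrizable B"
  then obtain d :: "'a \<Rightarrow> int" where d: "0 < d k" "d k * B k k = - (d k * B k k)"
    unfolding skew_symmetrizable_def by blast
  then have "d k * B k k = 0" by linarith
  then show ?thesis using d by simp
qed

text \<open>Existence and uniqueness of \<Phi> are proved together with the formulas, so that
  quantifying over all \<Phi> is not vacuous and speaks of one map.\<close>

theorem theorem5p4:
  fixes r :: "'n :: finite \<Rightarrow> nat"
    and D :: "'n \<Rightarrow> nat \<Rightarrow> 'd :: {finite, linorder}"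
    and adj :: "'n \<Rightarrow> 't \<Rightarrow> 't \<Rightarrow> bool"
    and t0 :: 't
    and \<kappa> :: "'p :: semifield qfield \<Rightarrow> 'f :: field"
    and \<kappa>c :: "('p, 'd) pbar qfield \<Rightarrow> 'g :: field"
    and \<Sigma>g :: "'t \<Rightarrow> ('f, 'p, 'n) gen_seed"
    and \<Sigma>c :: "'t \<Rightarrow> ('g, ('p, 'd) pbar, 'd) ord_seed"
    and Z :: "'n \<Rightarrow> 'p group_ring poly"
    and X0 :: "'n \<Rightarrow> 'g"
  assumes r: "\<forall>i. 1 \<le> r i"
    and D: "bij_betw (\<lambda>(i, l). D i l) {(i, l). 1 \<le> l \<and> l \<le> r i} UNIV"
    and tree: "labeled_regular_tree adj"
    and \<kappa>: "\<kappa> \<in> ring_hom ring_of_type_algebra ring_of_type_algebra"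
    and gen: "gen_cluster_pattern \<kappa> r adj \<Sigma>g"
    and \<kappa>c: "\<kappa>c \<in> ring_hom ring_of_type_algebra ring_of_type_algebra"
    and comp: "composite_pattern \<kappa>c r D adj t0 (sy (\<Sigma>g t0)) (sB (\<Sigma>g t0)) \<Sigma>c"
    and Z: "Z = sZ (\<Sigma>g t0)"
    and X0: "X0 = bigX r D (\<Sigma>c t0)"
  shows "(\<exists>!\<Phi>. is_Phi \<kappa> \<kappa>c r D Z X0 (sx (\<Sigma>g t0)) \<Phi>) \<and>
    (\<forall>\<Phi>. is_Phi \<kappa> \<kappa>c r D Z X0 (sx (\<Sigma>g t0)) \<Phi> \<longrightarrow>
      (\<forall>i t.
        \<Phi> (embP \<kappa> (sy (\<Sigma>g t) i)) =
          rootS \<kappa>c r D Z X0 (r i)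
            (clsS \<kappa>c r D Z X0 (embP \<kappa>c (\<Prod>l\<in>{1..r i}. sy (\<Sigma>c t) (D i l)))) \<and>
        \<Phi> (sx (\<Sigma>g t) i) = clsS \<kappa>c r D Z X0 (bigX r D (\<Sigma>c t) i)))"
proof -
  have seed: "is_gen_seed \<kappa> r (\<Sigma>g t)" for t
    using gen by (simp add: gen_cluster_pattern_def)
  have hom: "type_hom \<kappa>" "type_hom \<kappa>c" by (simp_all only: type_hom_ring_hom \<kappa> \<kappa>c)
  interpret C: composite_iso r D \<kappa>c "sx (\<Sigma>c t0)" Z \<kappa> "sx (\<Sigma>g t0)"
    by (intro composite_iso.intro composite_base.intro composite_iso_axioms.intro hom D)
      (use r comp seed[of t0] in \<open>auto simp: composite_pattern_def is_gen_seed_def Z\<close>)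
  have X0_eq: "X0 = C.X0"
    unfolding X0 by (simp add: fun_eq_iff bigX_def C.X0_def)
  have "\<forall>i. \<forall>l\<in>{1..r i}. sy (\<Sigma>c t0) (D i l) = svar (D i l) * inP (sy (\<Sigma>g t0) i)"
    and "\<forall>i j. \<forall>l\<in>{1..r i}. \<forall>m\<in>{1..r j}. sB (\<Sigma>c t0) (D i l) (D j m) = sB (\<Sigma>g t0) i j"
    using comp by (simp_all add: composite_pattern_def)
  then have y0: "sy (\<Sigma>c t0) d = svar d * inP (sy (\<Sigma>g t0) (C.ix d))"
    and b0: "sB (\<Sigma>c t0) d e = sB (\<Sigma>g t0) (C.ix d) (C.ix e)" for d e
    using C.lx_ge[of d] C.lx_le[of d] C.lx_ge[of e] C.lx_le[of e] C.D_ix_lx[of d] C.D_ix_lx[of e]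
    by (metis atLeastAtMost_iff)+
  \<comment> \<open>Before any mutation all branches are straight and w is the y-variable of the
    generalized seed.\<close>
  have base: "C.matches (\<Sigma>g t0) (\<Sigma>c t0)"
    unfolding C.matches_def
  proof (intro conjI allI exI[of _ "\<lambda>_. True"] exI[of _ "\<lambda>i. inP (sy (\<Sigma>g t0) i)"])
    fix i
    have "bigX r D (\<Sigma>c t0) i = C.X0 i" using X0 X0_eq by metis
    then show "bigX r D (\<Sigma>c t0) i \<in> C.cS" "C.psih (bigX r D (\<Sigma>c t0) i) = C.theta (sx (\<Sigma>g t0) i)"
      by (simp_all add: C.cS_X0 C.psih_X0 C.theta_xg)
  qed (simp_all add: C.SS_inP C.exch_poly_def C.branch_def y0 b0 flip: Z)
  have step: "C.matches (\<Sigma>g t') (\<Sigma>c t')" if m: "C.matches (\<Sigma>g t) (\<Sigma>c t)" and adj: "adj k t t'" for t t' k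
  proof -
    have "\<Sigma>g t' = gen_mutation \<kappa> r k (\<Sigma>g t)" "\<Sigma>c t' = comp_mutation \<kappa>c r D k (\<Sigma>c t)"
      using gen comp adj by (simp_all add: gen_cluster_pattern_def composite_pattern_def)
    moreover have "sB (\<Sigma>g t) k k = 0" "\<And>i. sx (\<Sigma>g t) i \<noteq> 0"
      using seed[of t] skew_symmetrizable_diagonal free_generating_nonzero[of \<kappa> "sx (\<Sigma>g t)"]
      by (auto simp: is_gen_seed_def)
    ultimately show ?thesis using C.matches_mutation[OF m] by simp
  qed
  have "C.matches (\<Sigma>g t) (\<Sigma>c t)" for t
  proof -
    \<comment> \<open>Every vertex is joined to \<open>t0\<close> by a path, along whose edges the
      invariant is carried.\<close>
    have "(\<lambda>u v. \<exists>k. adj k u v)\<^sup>*\<^sup>* t0 t"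
      using tree by (simp add: labeled_regular_tree_def is_tree_def)
    then show ?thesis by (induction rule: rtranclp_induct) (use base step in blast)+
  qed
  then show ?thesis
    unfolding X0_eq using C.Phi_unique_existence C.matches_Phi by blast
qed

end
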